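(* The tensor product of square groups gives rise to a well-defined bifunctor $-\underline{\circledcirc}-:\mathsf{SG}\times\mathsf{SG}\to\mathsf{SG}$ which equips the category $\mathsf{SG}$ with a symmetric monoidal structure with unit object $\mathbb Z_{\mathrm{nil}}$. The associativity and commutativity isomorphisms on the $ee$-level are the usual isomorphisms for the tensor product of abelian groups, while on the $e$-level the isomorphism $((M\underline{\circledcirc}N)\underline{\circledcirc}K)_e\cong(M\underline{\circledcirc}(N\underline{\circledcirc}K))_e$ is given by $$(x\underline{\circledcirc}y)\underline{\circledcirc}z\mapsto x\underline{\circledcirc}(y\underline{\circledcirc}z),\quad (a\bar\otimes b)\underline{\circledcirc}z\mapsto a\bar\otimes(b\otimes\Delta(z)),\quad (a\otimes b)\bar\otimes c\mapsto a\bar\otimes(b\otimes c),$$ and the isomorphism $(M\underline{\circledcirc}N)_e\cong(N\underline{\circledcirc}M)_e$ is given by $$x\underline{\circledcirc}y\mapsto y\underline{\circledcirc}x-H(y)\bar\otimes TH(x),\quad a\bar\otimes b\mapsto b\bar\otimes a.$$ Under the associativity isomorphism the element $x\underline{\circledcirc}(b\bar\otimes c)=(x|x)_H\bar\otimes(b\otimes c)$ of $(M\underline{\circledcirc}(N\underline{\circledcirc}K))_e$ corresponds to $((x|x)_H\otimes b)\bar\otimes c$. Here $x\in M_e$, $y\in N_e$, $z\in K_e$, $a\in M_{ee}$, $b\in N_{ee}$, $c\in K_{ee}$.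
   Context: Groups are written additively. A map $f:G\to A$ from a group to an abelian group is quadratic if its cross-effect $(x|y)_f:=f(x+y)-f(x)-f(y)$ is linear in $x$ and in $y$. A square group $M=(M_e\xrightarrow{H}M_{ee}\xrightarrow{P}M_e)$ consists of a group $M_e$, an abelian group $M_{ee}$, a homomorphism $P$ and a quadratic map $H$ such that for all $x,y\in M_e$, $a,b\in M_{ee}$: $(Pa|y)_H=0=(x|Pb)_H$, $P(x|y)_H=-x-y+x+y$, $PHP(a)=2P(a)$. Morphisms are pairs of homomorphisms $(f_e,f_{ee})$ commuting with $H$ and $P$; the category is $\mathsf{SG}$. In a square group $\mathrm{Im}(P)$ is central and contains all commutators, so $\mathrm{Coker}(P)$ is an abelian group; $\bar x$ is the class of $x\in M_e$. The cross-effect induces a homomorphism $(-|-)_H:\mathrm{Coker}(P)\otimes\mathrm{Coker}(P)\to M_{ee}$; there is a homomorphism $\Delta:\mathrm{Coker}(P)\to M_{ee}$, $\Delta(\bar x)=HPH(x)+H(x+x)-4H(x)$ (also written $\Delta(x)$); and $T:=HP-\mathrm{Id}:M_{ee}\to M_{ee}$ is a homomorphism with $T^2=\mathrm{Id}$. $\mathbb Z_{\mathrm{nil}}$ is the square group with both levels $\mathbb Z$, $H(n)=\binom n2$, $P=0$. Tensor product: $(M\underline{\circledcirc}N)_{ee}=M_{ee}\otimes N_{ee}$, and $(M\underline{\circledcirc}N)_e$ is the group with generators $x\underline{\circledcirc}y$ ($x\in M_e,y\in N_e$) and $a\bar\otimes b$ ($a\in M_{ee},b\in N_{ee}$) and relations: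 (1) $a\bar\otimes b$ is bilinear and central; (2) $x\underline{\circledcirc}(y_1+y_2)=x\underline{\circledcirc}y_1+x\underline{\circledcirc}y_2$; (3) $(x_1+x_2)\underline{\circledcirc}y=x_1\underline{\circledcirc}y+x_2\underline{\circledcirc}y+(x_2|x_1)_H\bar\otimes H(y)$; (4) $x\underline{\circledcirc}P(b)=(x|x)_H\bar\otimes b$; (5) $P(a)\underline{\circledcirc}y=a\bar\otimes\Delta(y)$; (6) $T(a)\bar\otimes T(b)=-a\bar\otimes b$. The homomorphism $P$ is $P(a\otimes b)=a\bar\otimes b$, so that $\mathrm{Coker}(P^{M\underline{\circledcirc}N})=\mathrm{Coker}(P^M)\otimes\mathrm{Coker}(P^N)$, and $H$ is the unique quadratic map with cross-effect induced by $(\bar x\otimes\bar y)\otimes(\bar x'\otimes\bar y')\mapsto(x|x')_H\otimes(y|y')_H$ and with $H(x\underline{\circledcirc}y)=(x|x)_H\otimes H(y)+H(x)\otimes\Delta(y)$, $H(a\bar\otimes b)=a\otimes b-T(a)\otimes T(b)$. That these data exist and define a square group is part of the claim that the bifunctor is well-defined. *)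

theory Defs
  imports "HOL-Algebra.Elementary_Groups" "HOL-Algebra.Free_Abelian_Groups"
begin

text \<open>
  All groups are multiplicative monoid records of HOL-Algebra: \<open>x + y\<close>, \<open>- x\<close> and \<open>n x\<close>
  become \<open>x \<otimes> y\<close>, \<open>inv x\<close> and \<open>x [^] n\<close>. Structure maps are only meaningful on carriers.
\<close>

definition cross_effect :: "'a monoid \<Rightarrow> 'b monoid \<Rightarrow> ('a \<Rightarrow> 'b) \<Rightarrow> 'a \<Rightarrow> 'a \<Rightarrow> 'b"
  where "cross_effect G A f x y =
    f (x \<otimes>\<^bsub>G\<^esub> y) \<otimes>\<^bsub>A\<^esub> inv\<^bsub>A\<^esub> (f x) \<otimes>\<^bsub>A\<^esub> inv\<^bsub>A\<^esub> (f y)"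

definition quadratic_map :: "'a monoid \<Rightarrow> 'b monoid \<Rightarrow> ('a \<Rightarrow> 'b) \<Rightarrow> bool"
  where "quadratic_map G A f \<longleftrightarrow>
    f \<in> carrier G \<rightarrow> carrier A \<and>
    (\<forall>y \<in> carrier G. (\<lambda>x. cross_effect G A f x y) \<in> hom G A) \<and>
    (\<forall>x \<in> carrier G. (\<lambda>y. cross_effect G A f x y) \<in> hom G A)"

record ('a, 'b) sq_grp =
  sq_e :: "'a monoid"
  sq_ee :: "'b monoid"
  sq_H :: "'a \<Rightarrow> 'b"
  sq_P :: "'b \<Rightarrow> 'a"

definition sq_cross :: "('a, 'b) sq_grp \<Rightarrow> 'a \<Rightarrow> 'a \<Rightarrow> 'b"
  where "sq_cross M = cross_effect (sq_e M) (sq_ee M) (sq_H M)"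

locale square_group =
  fixes M :: "('a, 'b) sq_grp"
  assumes group_e: "group (sq_e M)"
    and comm_group_ee: "comm_group (sq_ee M)"
    and P_hom: "sq_P M \<in> hom (sq_ee M) (sq_e M)"
    and H_quadratic: "quadratic_map (sq_e M) (sq_ee M) (sq_H M)"
    and cross_P_left: "\<lbrakk>a \<in> carrier (sq_ee M); y \<in> carrier (sq_e M)\<rbrakk>
      \<Longrightarrow> sq_cross M (sq_P M a) y = \<one>\<^bsub>sq_ee M\<^esub>"
    and cross_P_right: "\<lbrakk>x \<in> carrier (sq_e M); b \<in> carrier (sq_ee M)\<rbrakk>
      \<Longrightarrow> sq_cross M x (sq_P M b) = \<one>\<^bsub>sq_ee M\<^esub>"
    and P_cross: "\<lbrakk>x \<in> carrier (sq_e M); y \<in> carrier (sq_e M)\<rbrakk>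
      \<Longrightarrow> sq_P M (sq_cross M x y) =
        inv\<^bsub>sq_e M\<^esub> x \<otimes>\<^bsub>sq_e M\<^esub> inv\<^bsub>sq_e M\<^esub> y \<otimes>\<^bsub>sq_e M\<^esub> x \<otimes>\<^bsub>sq_e M\<^esub> y"
    and PHP: "a \<in> carrier (sq_ee M)
      \<Longrightarrow> sq_P M (sq_H M (sq_P M a)) = sq_P M a [^]\<^bsub>sq_e M\<^esub> (2::nat)"

definition sq_T :: "('a, 'b) sq_grp \<Rightarrow> 'b \<Rightarrow> 'b"
  where "sq_T M a = sq_H M (sq_P M a) \<otimes>\<^bsub>sq_ee M\<^esub> inv\<^bsub>sq_ee M\<^esub> a"

definition sq_Delta :: "('a, 'b) sq_grp \<Rightarrow> 'a \<Rightarrow> 'b"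
  where "sq_Delta M x =
    sq_H M (sq_P M (sq_H M x)) \<otimes>\<^bsub>sq_ee M\<^esub> sq_H M (x \<otimes>\<^bsub>sq_e M\<^esub> x)
      \<otimes>\<^bsub>sq_ee M\<^esub> inv\<^bsub>sq_ee M\<^esub> (sq_H M x [^]\<^bsub>sq_ee M\<^esub> (4::nat))"

text \<open>The cokernel of a homomorphism \<open>p : A \<rightarrow> E\<close> with normal image, and its class map.\<close>

definition coker :: "'b monoid \<Rightarrow> 'a monoid \<Rightarrow> ('b \<Rightarrow> 'a) \<Rightarrow> 'a set monoid"
  where "coker A E p = E Mod (p ` carrier A)"

definition coker_class :: "'b monoid \<Rightarrow> 'a monoid \<Rightarrow> ('b \<Rightarrow> 'a) \<Rightarrow> 'a \<Rightarrow> 'a set"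
  where "coker_class A E p x = (p ` carrier A) #>\<^bsub>E\<^esub> x"

definition sq_coker :: "('a, 'b) sq_grp \<Rightarrow> 'a set monoid"
  where "sq_coker M = coker (sq_ee M) (sq_e M) (sq_P M)"

definition sq_coker_class :: "('a, 'b) sq_grp \<Rightarrow> 'a \<Rightarrow> 'a set"
  where "sq_coker_class M = coker_class (sq_ee M) (sq_e M) (sq_P M)"

text \<open>The division is exact, so \<open>H n\<close> is the binomial coefficient \<open>n\<close> over \<open>2\<close> for every
  integer \<open>n\<close>, negative ones included.\<close>

definition Z_nil :: "(int, int) sq_grp"
  where "Z_nil = \<lparr>sq_e = integer_group, sq_ee = integer_group,
    sq_H = (\<lambda>n. n * (n - 1) div 2), sq_P = (\<lambda>_. 0)\<rparr>"

text \<open>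
  An arrow carries its domain and codomain. The underlying functions of a morphism are
  required to be \<^const>\<open>undefined\<close> outside the carriers, so that equality of arrows is
  equality of morphisms.
\<close>

record ('a, 'b, 'c, 'd) sg_arr =
  sg_dom :: "('a, 'b) sq_grp"
  sg_cod :: "('c, 'd) sq_grp"
  map_e :: "'a \<Rightarrow> 'c"
  map_ee :: "'b \<Rightarrow> 'd"

definition sg_hom :: "('a, 'b) sq_grp \<Rightarrow> ('c, 'd) sq_grp \<Rightarrow> ('a, 'b, 'c, 'd) sg_arr set"
  where "sg_hom M N = {f. sg_dom f = M \<and> sg_cod f = N
    \<and> map_e f \<in> hom (sq_e M) (sq_e N) \<inter> extensional (carrier (sq_e M))
    \<and> map_ee f \<in> hom (sq_ee M) (sq_ee N) \<inter> extensional (carrier (sq_ee M))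
    \<and> (\<forall>x \<in> carrier (sq_e M). map_ee f (sq_H M x) = sq_H N (map_e f x))
    \<and> (\<forall>a \<in> carrier (sq_ee M). map_e f (sq_P M a) = sq_P N (map_ee f a))}"

definition sg_id :: "('a, 'b) sq_grp \<Rightarrow> ('a, 'b, 'a, 'b) sg_arr"
  where "sg_id M = \<lparr>sg_dom = M, sg_cod = M,
    map_e = (\<lambda>x \<in> carrier (sq_e M). x), map_ee = (\<lambda>a \<in> carrier (sq_ee M). a)\<rparr>"

definition sg_comp :: "('c, 'd, 'e, 'f) sg_arr \<Rightarrow> ('a, 'b, 'c, 'd) sg_arr \<Rightarrow> ('a, 'b, 'e, 'f) sg_arr"
    (infixr "\<cdot>" 65)
  where "g \<cdot> f = \<lparr>sg_dom = sg_dom f, sg_cod = sg_cod g,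
    map_e = compose (carrier (sq_e (sg_dom f))) (map_e g) (map_e f),
    map_ee = compose (carrier (sq_ee (sg_dom f))) (map_ee g) (map_ee f)\<rparr>"

definition sg_iso :: "('a, 'b) sq_grp \<Rightarrow> ('c, 'd) sq_grp \<Rightarrow> ('a, 'b, 'c, 'd) sg_arr set"
  where "sg_iso M N = {f \<in> sg_hom M N. \<exists>g \<in> sg_hom N M. g \<cdot> f = sg_id M \<and> f \<cdot> g = sg_id N}"

lemma sg_id_hom:
  assumes "square_group M" shows "sg_id M \<in> sg_hom M M"
proof -
  interpret square_group M by fact
  interpret group "sq_e M" by (rule group_e)
  interpret A: comm_group "sq_ee M" by (rule comm_group_ee)
  show ?thesis
    using P_hom H_quadratic
    by (auto simp: sg_id_def sg_hom_def hom_def quadratic_map_def Pi_iff)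
qed

lemma sg_comp_hom:
  assumes "square_group L" "f \<in> sg_hom L M" "g \<in> sg_hom M N"
  shows "g \<cdot> f \<in> sg_hom L N"
proof -
  interpret square_group L by fact
  interpret group "sq_e L" by (rule group_e)
  interpret A: comm_group "sq_ee L" by (rule comm_group_ee)
  show ?thesis
    using P_hom H_quadratic assms(2,3)
    by (auto simp: sg_comp_def sg_hom_def hom_def quadratic_map_def Pi_iff compose_def)
qed

lemma sg_comp_assoc:
  assumes "f \<in> sg_hom K L" "g \<in> sg_hom L M" "h \<in> sg_hom M N"
  shows "(h \<cdot> g) \<cdot> f = h \<cdot> (g \<cdot> f)"
  using assms by (auto simp: sg_comp_def sg_hom_def hom_def compose_def Pi_iff fun_eq_iff)

lemma sg_comp_id:
  assumes "f \<in> sg_hom M N"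
  shows "f \<cdot> sg_id M = f" "sg_id N \<cdot> f = f"
proof -
  have f: "f = \<lparr>sg_dom = M, sg_cod = N, map_e = map_e f, map_ee = map_ee f\<rparr>"
    using assms by (simp add: sg_hom_def)
  show "f \<cdot> sg_id M = f" "sg_id N \<cdot> f = f"
    using assms
    by (subst (2) f, auto simp: sg_comp_def sg_id_def sg_hom_def hom_def compose_def Pi_iff
        fun_eq_iff extensional_def)+
qed

inductive_set bilinear_relators :: "'a monoid \<Rightarrow> 'b monoid \<Rightarrow> ('a \<times> 'b \<Rightarrow>\<^sub>0 int) set"
  for A :: "'a monoid" and B :: "'b monoid" where
  "\<lbrakk>a \<in> carrier A; a' \<in> carrier A; b \<in> carrier B\<rbrakk>
    \<Longrightarrow> frag_of (a \<otimes>\<^bsub>A\<^esub> a', b) - frag_of (a, b) - frag_of (a', b) \<in> bilinear_relators A B"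
| "\<lbrakk>a \<in> carrier A; b \<in> carrier B; b' \<in> carrier B\<rbrakk>
    \<Longrightarrow> frag_of (a, b \<otimes>\<^bsub>B\<^esub> b') - frag_of (a, b) - frag_of (a, b') \<in> bilinear_relators A B"

definition bilinear_subgroup :: "'a monoid \<Rightarrow> 'b monoid \<Rightarrow> ('a \<times> 'b \<Rightarrow>\<^sub>0 int) set"
  where "bilinear_subgroup A B =
    generate (free_Abelian_group (carrier A \<times> carrier B)) (bilinear_relators A B)"

definition ab_tensor :: "'a monoid \<Rightarrow> 'b monoid \<Rightarrow> ('a \<times> 'b \<Rightarrow>\<^sub>0 int) set monoid"
    (infixl "\<bowtie>" 70)
  where "A \<bowtie> B = free_Abelian_group (carrier A \<times> carrier B) Mod bilinear_subgroup A B"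

definition pure_tensor :: "'a monoid \<Rightarrow> 'b monoid \<Rightarrow> 'a \<Rightarrow> 'b \<Rightarrow> ('a \<times> 'b \<Rightarrow>\<^sub>0 int) set"
  where "pure_tensor A B a b =
    bilinear_subgroup A B #>\<^bsub>free_Abelian_group (carrier A \<times> carrier B)\<^esub> frag_of (a, b)"

text \<open>
  A word is a list of signed generators, \<open>(True, g)\<close> standing for \<open>g\<close> and \<open>(False, g)\<close> for its
  inverse. A pair \<open>(u, v) \<in> R\<close> is the relation \<open>u = v\<close>.
\<close>

type_synonym 'g word = "(bool \<times> 'g) list"

inductive pres_eq :: "'g set \<Rightarrow> ('g word \<times> 'g word) set \<Rightarrow> 'g word \<Rightarrow> 'g word \<Rightarrow> bool"
  for X :: "'g set" and R :: "('g word \<times> 'g word) set" where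
  refl: "w \<in> lists (UNIV \<times> X) \<Longrightarrow> pres_eq X R w w"
| sym: "pres_eq X R u v \<Longrightarrow> pres_eq X R v u"
| trans: "\<lbrakk>pres_eq X R u v; pres_eq X R v w\<rbrakk> \<Longrightarrow> pres_eq X R u w"
| append: "\<lbrakk>pres_eq X R u v; pres_eq X R u' v'\<rbrakk> \<Longrightarrow> pres_eq X R (u @ u') (v @ v')"
| cancel: "g \<in> X \<Longrightarrow> pres_eq X R [(s, g), (\<not> s, g)] []"
| rel: "\<lbrakk>(u, v) \<in> R; u \<in> lists (UNIV \<times> X); v \<in> lists (UNIV \<times> X)\<rbrakk> \<Longrightarrow> pres_eq X R u v"

definition pres_class :: "'g set \<Rightarrow> ('g word \<times> 'g word) set \<Rightarrow> 'g word \<Rightarrow> 'g word set"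
  where "pres_class X R w = {v. pres_eq X R w v}"

definition presented_group :: "'g set \<Rightarrow> ('g word \<times> 'g word) set \<Rightarrow> 'g word set monoid"
  where "presented_group X R =
    \<lparr>carrier = pres_class X R ` lists (UNIV \<times> X),
     monoid.mult = (\<lambda>U V. \<Union>u \<in> U. \<Union>v \<in> V. pres_class X R (u @ v)),
     one = pres_class X R []\<rparr>"

text \<open>
  The maps of the tensor product (and the structure isomorphisms below) are specified by their
  values on generators. Each specification is a predicate \<open>is_...\<close>, and the map is chosen by
  \<^const>\<open>The\<close>; it is meaningful only once the predicate is shown to have exactly one solution.
  Requiring \<^const>\<open>extensional\<close> maps makes this uniqueness literal.
\<close>

datatype ('a, 'b, 'c, 'd) tgen = Circ 'a 'c | Bar 'b 'd

definition tensor_gens :: "('a, 'b) sq_grp \<Rightarrow> ('c, 'd) sq_grp \<Rightarrow> ('a, 'b, 'c, 'd) tgen set"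
  where "tensor_gens M N =
    {Circ x y |x y. x \<in> carrier (sq_e M) \<and> y \<in> carrier (sq_e N)} \<union>
    {Bar a b |a b. a \<in> carrier (sq_ee M) \<and> b \<in> carrier (sq_ee N)}"

abbreviation pos_word :: "'g list \<Rightarrow> 'g word"
  where "pos_word \<equiv> map (Pair True)"

inductive_set tensor_rels :: "('a, 'b) sq_grp \<Rightarrow> ('c, 'd) sq_grp
    \<Rightarrow> (('a, 'b, 'c, 'd) tgen word \<times> ('a, 'b, 'c, 'd) tgen word) set"
  for M :: "('a, 'b) sq_grp" and N :: "('c, 'd) sq_grp" where
  bar_left: "\<lbrakk>a \<in> carrier (sq_ee M); a' \<in> carrier (sq_ee M); b \<in> carrier (sq_ee N)\<rbrakk>
    \<Longrightarrow> (pos_word [Bar (a \<otimes>\<^bsub>sq_ee M\<^esub> a') b], pos_word [Bar a b, Bar a' b]) \<in> tensor_rels M N"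
| bar_right: "\<lbrakk>a \<in> carrier (sq_ee M); b \<in> carrier (sq_ee N); b' \<in> carrier (sq_ee N)\<rbrakk>
    \<Longrightarrow> (pos_word [Bar a (b \<otimes>\<^bsub>sq_ee N\<^esub> b')], pos_word [Bar a b, Bar a b']) \<in> tensor_rels M N"
| bar_central: "\<lbrakk>a \<in> carrier (sq_ee M); b \<in> carrier (sq_ee N); g \<in> tensor_gens M N\<rbrakk>
    \<Longrightarrow> (pos_word [Bar a b, g], pos_word [g, Bar a b]) \<in> tensor_rels M N"
| circ_right: "\<lbrakk>x \<in> carrier (sq_e M); y1 \<in> carrier (sq_e N); y2 \<in> carrier (sq_e N)\<rbrakk>
    \<Longrightarrow> (pos_word [Circ x (y1 \<otimes>\<^bsub>sq_e N\<^esub> y2)], pos_word [Circ x y1, Circ x y2]) \<in> tensor_rels M N"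
| circ_left: "\<lbrakk>x1 \<in> carrier (sq_e M); x2 \<in> carrier (sq_e M); y \<in> carrier (sq_e N)\<rbrakk>
    \<Longrightarrow> (pos_word [Circ (x1 \<otimes>\<^bsub>sq_e M\<^esub> x2) y],
         pos_word [Circ x1 y, Circ x2 y, Bar (sq_cross M x2 x1) (sq_H N y)]) \<in> tensor_rels M N"
| circ_P: "\<lbrakk>x \<in> carrier (sq_e M); b \<in> carrier (sq_ee N)\<rbrakk>
    \<Longrightarrow> (pos_word [Circ x (sq_P N b)], pos_word [Bar (sq_cross M x x) b]) \<in> tensor_rels M N"
| P_circ: "\<lbrakk>a \<in> carrier (sq_ee M); y \<in> carrier (sq_e N)\<rbrakk>
    \<Longrightarrow> (pos_word [Circ (sq_P M a) y], pos_word [Bar a (sq_Delta N y)]) \<in> tensor_rels M N"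
| T_bar_T: "\<lbrakk>a \<in> carrier (sq_ee M); b \<in> carrier (sq_ee N)\<rbrakk>
    \<Longrightarrow> (pos_word [Bar (sq_T M a) (sq_T N b)], [(False, Bar a b)]) \<in> tensor_rels M N"

definition tensor_e ::
    "('a, 'b) sq_grp \<Rightarrow> ('c, 'd) sq_grp \<Rightarrow> ('a, 'b, 'c, 'd) tgen word set monoid"
  where "tensor_e M N = presented_group (tensor_gens M N) (tensor_rels M N)"

definition circ ::
    "('a, 'b) sq_grp \<Rightarrow> ('c, 'd) sq_grp \<Rightarrow> 'a \<Rightarrow> 'c \<Rightarrow> ('a, 'b, 'c, 'd) tgen word set"
  where "circ M N x y = pres_class (tensor_gens M N) (tensor_rels M N) (pos_word [Circ x y])"

definition bar ::
    "('a, 'b) sq_grp \<Rightarrow> ('c, 'd) sq_grp \<Rightarrow> 'b \<Rightarrow> 'd \<Rightarrow> ('a, 'b, 'c, 'd) tgen word set"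
  where "bar M N a b = pres_class (tensor_gens M N) (tensor_rels M N) (pos_word [Bar a b])"

abbreviation tensor_ee :: "('a, 'b) sq_grp \<Rightarrow> ('c, 'd) sq_grp \<Rightarrow> ('b \<times> 'd \<Rightarrow>\<^sub>0 int) set monoid"
  where "tensor_ee M N \<equiv> sq_ee M \<bowtie> sq_ee N"

abbreviation pure_ee ::
    "('a, 'b) sq_grp \<Rightarrow> ('c, 'd) sq_grp \<Rightarrow> 'b \<Rightarrow> 'd \<Rightarrow> ('b \<times> 'd \<Rightarrow>\<^sub>0 int) set"
  where "pure_ee M N \<equiv> pure_tensor (sq_ee M) (sq_ee N)"

definition is_tensor_P :: "('a, 'b) sq_grp \<Rightarrow> ('c, 'd) sq_grp
    \<Rightarrow> (('b \<times> 'd \<Rightarrow>\<^sub>0 int) set \<Rightarrow> ('a, 'b, 'c, 'd) tgen word set) \<Rightarrow> bool"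
  where "is_tensor_P M N p \<longleftrightarrow>
    p \<in> hom (tensor_ee M N) (tensor_e M N) \<inter> extensional (carrier (tensor_ee M N)) \<and>
    (\<forall>a \<in> carrier (sq_ee M). \<forall>b \<in> carrier (sq_ee N). p (pure_ee M N a b) = bar M N a b)"

definition tensor_P :: "('a, 'b) sq_grp \<Rightarrow> ('c, 'd) sq_grp
    \<Rightarrow> ('b \<times> 'd \<Rightarrow>\<^sub>0 int) set \<Rightarrow> ('a, 'b, 'c, 'd) tgen word set"
  where "tensor_P M N = (THE p. is_tensor_P M N p)"

text \<open>The identification of \<open>Coker P\<close> of the tensor product with \<open>Coker P\<^sup>M \<otimes> Coker P\<^sup>N\<close>.\<close>

definition is_coker_iso :: "('a, 'b) sq_grp \<Rightarrow> ('c, 'd) sq_grp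
    \<Rightarrow> (('a, 'b, 'c, 'd) tgen word set set \<Rightarrow> ('a set \<times> 'c set \<Rightarrow>\<^sub>0 int) set) \<Rightarrow> bool"
  where "is_coker_iso M N \<theta> \<longleftrightarrow>
    \<theta> \<in> iso (coker (tensor_ee M N) (tensor_e M N) (tensor_P M N)) (sq_coker M \<bowtie> sq_coker N) \<and>
    (\<forall>x \<in> carrier (sq_e M). \<forall>y \<in> carrier (sq_e N).
      \<theta> (coker_class (tensor_ee M N) (tensor_e M N) (tensor_P M N) (circ M N x y)) =
        pure_tensor (sq_coker M) (sq_coker N) (sq_coker_class M x) (sq_coker_class N y))"

text \<open>The linear map on \<open>(Coker P\<^sup>M \<otimes> Coker P\<^sup>N) \<otimes> (Coker P\<^sup>M \<otimes> Coker P\<^sup>N)\<close> inducing the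
  cross-effect of \<open>H\<close>.\<close>

definition is_tensor_form :: "('a, 'b) sq_grp \<Rightarrow> ('c, 'd) sq_grp
    \<Rightarrow> ((('a set \<times> 'c set \<Rightarrow>\<^sub>0 int) set \<times> ('a set \<times> 'c set \<Rightarrow>\<^sub>0 int) set \<Rightarrow>\<^sub>0 int) set
        \<Rightarrow> ('b \<times> 'd \<Rightarrow>\<^sub>0 int) set) \<Rightarrow> bool"
  where "is_tensor_form M N \<Phi> \<longleftrightarrow>
    \<Phi> \<in> hom ((sq_coker M \<bowtie> sq_coker N) \<bowtie> (sq_coker M \<bowtie> sq_coker N)) (tensor_ee M N) \<and>
    (\<forall>x \<in> carrier (sq_e M). \<forall>y \<in> carrier (sq_e N).
     \<forall>x' \<in> carrier (sq_e M). \<forall>y' \<in> carrier (sq_e N).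
      \<Phi> (pure_tensor (sq_coker M \<bowtie> sq_coker N) (sq_coker M \<bowtie> sq_coker N)
          (pure_tensor (sq_coker M) (sq_coker N) (sq_coker_class M x) (sq_coker_class N y))
          (pure_tensor (sq_coker M) (sq_coker N) (sq_coker_class M x') (sq_coker_class N y'))) =
        pure_ee M N (sq_cross M x x') (sq_cross N y y'))"

definition is_tensor_H :: "('a, 'b) sq_grp \<Rightarrow> ('c, 'd) sq_grp
    \<Rightarrow> (('a, 'b, 'c, 'd) tgen word set \<Rightarrow> ('b \<times> 'd \<Rightarrow>\<^sub>0 int) set) \<Rightarrow> bool"
  where "is_tensor_H M N h \<longleftrightarrow>
    quadratic_map (tensor_e M N) (tensor_ee M N) h \<and>
    h \<in> extensional (carrier (tensor_e M N)) \<and>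
    (\<exists>\<theta> \<Phi>. is_coker_iso M N \<theta> \<and> is_tensor_form M N \<Phi> \<and>
      (\<forall>u \<in> carrier (tensor_e M N). \<forall>v \<in> carrier (tensor_e M N).
        cross_effect (tensor_e M N) (tensor_ee M N) h u v =
          \<Phi> (pure_tensor (sq_coker M \<bowtie> sq_coker N) (sq_coker M \<bowtie> sq_coker N)
            (\<theta> (coker_class (tensor_ee M N) (tensor_e M N) (tensor_P M N) u))
            (\<theta> (coker_class (tensor_ee M N) (tensor_e M N) (tensor_P M N) v))))) \<and>
    (\<forall>x \<in> carrier (sq_e M). \<forall>y \<in> carrier (sq_e N).
      h (circ M N x y) =
        pure_ee M N (sq_cross M x x) (sq_H N y)
          \<otimes>\<^bsub>tensor_ee M N\<^esub> pure_ee M N (sq_H M x) (sq_Delta N y)) \<and>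
    (\<forall>a \<in> carrier (sq_ee M). \<forall>b \<in> carrier (sq_ee N).
      h (bar M N a b) =
        pure_ee M N a b \<otimes>\<^bsub>tensor_ee M N\<^esub> inv\<^bsub>tensor_ee M N\<^esub> pure_ee M N (sq_T M a) (sq_T N b))"

definition tensor_H :: "('a, 'b) sq_grp \<Rightarrow> ('c, 'd) sq_grp
    \<Rightarrow> ('a, 'b, 'c, 'd) tgen word set \<Rightarrow> ('b \<times> 'd \<Rightarrow>\<^sub>0 int) set"
  where "tensor_H M N = (THE h. is_tensor_H M N h)"

definition sq_tensor :: "('a, 'b) sq_grp \<Rightarrow> ('c, 'd) sq_grp
    \<Rightarrow> (('a, 'b, 'c, 'd) tgen word set, ('b \<times> 'd \<Rightarrow>\<^sub>0 int) set) sq_grp" (infixl "\<diamond>" 70)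
  where "M \<diamond> N = \<lparr>sq_e = tensor_e M N, sq_ee = tensor_ee M N,
    sq_H = tensor_H M N, sq_P = tensor_P M N\<rparr>"

definition is_tensor_arr :: "('a, 'b, 'c, 'd) sg_arr \<Rightarrow> ('e, 'f, 'g, 'h) sg_arr
    \<Rightarrow> (('a, 'b, 'e, 'f) tgen word set, ('b \<times> 'f \<Rightarrow>\<^sub>0 int) set,
        ('c, 'd, 'g, 'h) tgen word set, ('d \<times> 'h \<Rightarrow>\<^sub>0 int) set) sg_arr \<Rightarrow> bool"
  where "is_tensor_arr f g t \<longleftrightarrow>
    t \<in> sg_hom (sg_dom f \<diamond> sg_dom g) (sg_cod f \<diamond> sg_cod g) \<and>
    (\<forall>x \<in> carrier (sq_e (sg_dom f)). \<forall>y \<in> carrier (sq_e (sg_dom g)).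
      map_e t (circ (sg_dom f) (sg_dom g) x y) =
        circ (sg_cod f) (sg_cod g) (map_e f x) (map_e g y)) \<and>
    (\<forall>a \<in> carrier (sq_ee (sg_dom f)). \<forall>b \<in> carrier (sq_ee (sg_dom g)).
      map_e t (bar (sg_dom f) (sg_dom g) a b) =
        bar (sg_cod f) (sg_cod g) (map_ee f a) (map_ee g b)) \<and>
    (\<forall>a \<in> carrier (sq_ee (sg_dom f)). \<forall>b \<in> carrier (sq_ee (sg_dom g)).
      map_ee t (pure_ee (sg_dom f) (sg_dom g) a b) =
        pure_ee (sg_cod f) (sg_cod g) (map_ee f a) (map_ee g b))"

definition tensor_arr :: "('a, 'b, 'c, 'd) sg_arr \<Rightarrow> ('e, 'f, 'g, 'h) sg_arr
    \<Rightarrow> (('a, 'b, 'e, 'f) tgen word set, ('b \<times> 'f \<Rightarrow>\<^sub>0 int) set,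
        ('c, 'd, 'g, 'h) tgen word set, ('d \<times> 'h \<Rightarrow>\<^sub>0 int) set) sg_arr"
    (infixl "\<diamond>\<^sub>m" 70)
  where "f \<diamond>\<^sub>m g = (THE t. is_tensor_arr f g t)"

definition is_associator where
  "is_associator M N K \<alpha> \<longleftrightarrow>
    \<alpha> \<in> sg_hom ((M \<diamond> N) \<diamond> K) (M \<diamond> (N \<diamond> K)) \<and>
    (\<forall>a \<in> carrier (sq_ee M). \<forall>b \<in> carrier (sq_ee N). \<forall>c \<in> carrier (sq_ee K).
      map_ee \<alpha> (pure_ee (M \<diamond> N) K (pure_ee M N a b) c) =
        pure_ee M (N \<diamond> K) a (pure_ee N K b c)) \<and>
    (\<forall>x \<in> carrier (sq_e M). \<forall>y \<in> carrier (sq_e N). \<forall>z \<in> carrier (sq_e K).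
      map_e \<alpha> (circ (M \<diamond> N) K (circ M N x y) z) = circ M (N \<diamond> K) x (circ N K y z)) \<and>
    (\<forall>a \<in> carrier (sq_ee M). \<forall>b \<in> carrier (sq_ee N). \<forall>z \<in> carrier (sq_e K).
      map_e \<alpha> (circ (M \<diamond> N) K (bar M N a b) z) =
        bar M (N \<diamond> K) a (pure_ee N K b (sq_Delta K z))) \<and>
    (\<forall>a \<in> carrier (sq_ee M). \<forall>b \<in> carrier (sq_ee N). \<forall>c \<in> carrier (sq_ee K).
      map_e \<alpha> (bar (M \<diamond> N) K (pure_ee M N a b) c) = bar M (N \<diamond> K) a (pure_ee N K b c))"

definition associator where
  "associator M N K = (THE \<alpha>. is_associator M N K \<alpha>)"

definition is_braiding where
  "is_braiding M N \<beta> \<longleftrightarrow>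
    \<beta> \<in> sg_hom (M \<diamond> N) (N \<diamond> M) \<and>
    (\<forall>a \<in> carrier (sq_ee M). \<forall>b \<in> carrier (sq_ee N).
      map_ee \<beta> (pure_ee M N a b) = pure_ee N M b a) \<and>
    (\<forall>x \<in> carrier (sq_e M). \<forall>y \<in> carrier (sq_e N).
      map_e \<beta> (circ M N x y) =
        circ N M y x \<otimes>\<^bsub>tensor_e N M\<^esub>
          inv\<^bsub>tensor_e N M\<^esub> bar N M (sq_H N y) (sq_T M (sq_H M x))) \<and>
    (\<forall>a \<in> carrier (sq_ee M). \<forall>b \<in> carrier (sq_ee N).
      map_e \<beta> (bar M N a b) = bar N M b a)"

definition braiding where
  "braiding M N = (THE \<beta>. is_braiding M N \<beta>)"

text \<open>The unit isomorphisms are the usual ones on the \<open>ee\<close>-level; on the \<open>e\<close>-level the generator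
  \<open>1\<close> of the integers acts as a unit. The generators \<open>circ\<close> of an arbitrary integer and the \<open>bar\<close>
  generators are then determined by the relations and compatibility with \<open>P\<close>.\<close>

definition is_left_unitor where
  "is_left_unitor M l \<longleftrightarrow>
    l \<in> sg_hom (Z_nil \<diamond> M) M \<and>
    (\<forall>n. \<forall>a \<in> carrier (sq_ee M). map_ee l (pure_ee Z_nil M n a) = a [^]\<^bsub>sq_ee M\<^esub> n) \<and>
    (\<forall>x \<in> carrier (sq_e M). map_e l (circ Z_nil M 1 x) = x)"

definition left_unitor where
  "left_unitor M = (THE l. is_left_unitor M l)"

definition is_right_unitor where
  "is_right_unitor M r \<longleftrightarrow>
    r \<in> sg_hom (M \<diamond> Z_nil) M \<and>
    (\<forall>a \<in> carrier (sq_ee M). \<forall>n. map_ee r (pure_ee M Z_nil a n) = a [^]\<^bsub>sq_ee M\<^esub> n) \<and>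
    (\<forall>x \<in> carrier (sq_e M). map_e r (circ M Z_nil x 1) = x)"

definition right_unitor where
  "right_unitor M = (THE r. is_right_unitor M r)"

end

theory Submission
  imports Defs
begin

text \<open>
  Maps out of \<open>(M \<diamond> N)\<^sub>e\<close> come from its presentation. The quadratic map \<open>H\<close> and the map
  \<open>u \<mapsto> u \<circ> z\<close> behind associativity fail to be additive by a central term that is bilinear and
  vanishes on the \<open>bar\<close> generators; such a map is a homomorphism into the central extension defined
  by that bilinear term, so the universal property still applies.

  Expanding \<open>(x\<^sub>1 + x\<^sub>2) \<circ> (y\<^sub>1 + y\<^sub>2)\<close> in two ways shows that the commutator of
  \<open>x \<circ> y\<close> and \<open>x' \<circ> y'\<close> is \<open>P ((x|x') \<otimes> (y|y'))\<close>. Hence the cokernel of \<open>P\<close> is abelian and is the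
  tensor product of the cokernels, which also provides the bilinear form for \<open>H\<close>.

  Up to the image of \<open>P\<close> an iterated tensor product is generated by the elements
  \<open>(x \<circ> y) \<circ> z\<close>, so arrows agree as soon as they agree on these and on the \<open>ee\<close>-level. The
  remaining identities follow from \<open>\<Delta>(x) = T H(x) - H(x) + (x|x)\<close>, \<open>T(x|y) = - (y|x)\<close>,
  \<open>T \<Delta> = - \<Delta>\<close> and relation (6) in the form \<open>P(T a \<otimes> b) = - P(a \<otimes> T b)\<close>.
\<close>


section \<open>Presented groups\<close>

text \<open>Relation (2) makes \<open>x \<circ> y\<close> additive in \<open>y\<close>; relation (3)
  makes it only quadratic in \<open>x\<close>. Hence \<open>u \<mapsto> u \<circ> z\<close> needs
  the twisted universal property, whereas for the inverse of associativity
  \<open>v \<mapsto> x \<circ> v\<close> is a plain homomorphism and the defect in \<open>x\<close>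
  is checked afterwards; the left unit isomorphism carries a binomial correction and the right one
  none; and the braiding, which exchanges the two variables, must carry the term
  \<open>H(y) \<otimes> T H(x)\<close>. A second obstacle is circularity: the cross-effect of
  \<open>H\<close> is prescribed through the cokernel of \<open>P\<close>, so \<open>P\<close>, that
  cokernel and the bilinear form have to be obtained from the presentation alone, before the tensor
  product is known to be a square group. The same form describes the commutators and so yields the
  axiom on \<open>P (x|y)\<close>. Compatibility of an arrow with \<open>H\<close> is checked on
  generators: quadratic maps with one cross-effect agree once they agree there, and on the image of
  \<open>P\<close> the equation \<open>H P = T + 1\<close> reduces it to compatibility with
  \<open>T\<close>.\<close>

definition word_val :: "('b, 'm) monoid_scheme \<Rightarrow> ('g \<Rightarrow> 'b) \<Rightarrow> 'g word \<Rightarrow> 'b"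
  where "word_val L f w =
    foldr (\<lambda>(s, g) z. (if s then f g else inv\<^bsub>L\<^esub> f g) \<otimes>\<^bsub>L\<^esub> z) w \<one>\<^bsub>L\<^esub>"

definition word_inv :: "'g word \<Rightarrow> 'g word"
  where "word_inv w = map (\<lambda>(s, g). (\<not> s, g)) (rev w)"

lemma word_val_simps [simp]:
  "word_val L f [] = \<one>\<^bsub>L\<^esub>"
  "word_val L f ((s, g) # w) = (if s then f g else inv\<^bsub>L\<^esub> f g) \<otimes>\<^bsub>L\<^esub> word_val L f w"
  by (simp_all add: word_val_def)

lemma (in group) word_val_closed:
  assumes "f \<in> X \<rightarrow> carrier G" "w \<in> lists (UNIV \<times> X)"
  shows "word_val G f w \<in> carrier G"
  using assms(2)
proof (induction w)
  case (Cons l w)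
  then show ?case using assms(1) by (cases l) (auto simp: Pi_iff)
qed simp

lemma (in group) word_val_append:
  assumes "f \<in> X \<rightarrow> carrier G" "u \<in> lists (UNIV \<times> X)" "v \<in> lists (UNIV \<times> X)"
  shows "word_val G f (u @ v) = word_val G f u \<otimes> word_val G f v"
  using assms(2)
proof (induction u)
  case Nil
  then show ?case using assms by (simp add: word_val_closed)
next
  case (Cons l u)
  obtain s g where l: "l = (s, g)" by (cases l)
  have "f g \<in> carrier G" "word_val G f u \<in> carrier G" "word_val G f v \<in> carrier G"
    using Cons l assms by (auto simp: Pi_iff intro: word_val_closed)
  then show ?case using Cons l by (simp add: m_assoc)
qed

lemma pres_eq_words:
  assumes "pres_eq X R u v"
  shows "u \<in> lists (UNIV \<times> X)" "v \<in> lists (UNIV \<times> X)"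
  using assms by induction auto

lemma pres_class_eq_iff:
  assumes "u \<in> lists (UNIV \<times> X)"
  shows "pres_class X R u = pres_class X R v \<longleftrightarrow> pres_eq X R u v"
proof
  assume "pres_class X R u = pres_class X R v"
  moreover have "u \<in> pres_class X R u"
    using assms by (simp add: pres_class_def pres_eq.refl)
  ultimately show "pres_eq X R u v"
    by (simp add: pres_class_def pres_eq.sym)
next
  assume "pres_eq X R u v"
  then show "pres_class X R u = pres_class X R v"
    unfolding pres_class_def by (blast intro: pres_eq.sym pres_eq.trans)
qed

lemma carrier_presented_group:
  "carrier (presented_group X R) = pres_class X R ` lists (UNIV \<times> X)"
  by (simp add: presented_group_def)

lemma one_presented_group: "\<one>\<^bsub>presented_group X R\<^esub> = pres_class X R []"
  by (simp add: presented_group_def)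

lemma mult_presented_group:
  assumes u: "u \<in> lists (UNIV \<times> X)" and v: "v \<in> lists (UNIV \<times> X)"
  shows "pres_class X R u \<otimes>\<^bsub>presented_group X R\<^esub> pres_class X R v = pres_class X R (u @ v)"
proof -
  \<comment> \<open>Multiplication is defined as a union over all representatives. Every member of
    that union is the same class, so the union collapses.\<close>
  have "pres_class X R (u' @ v') = pres_class X R (u @ v)"
    if "pres_eq X R u u'" "pres_eq X R v v'" for u' v'
  proof -
    have "pres_eq X R (u @ v) (u' @ v')" using that by (rule pres_eq.append)
    moreover have "u @ v \<in> lists (UNIV \<times> X)" using u v by simp
    ultimately show ?thesis using pres_class_eq_iff by metis
  qed
  then have "(\<Union>u' \<in> pres_class X R u. \<Union>v' \<in> pres_class X R v. pres_class X R (u' @ v')) =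
      (\<Union>u' \<in> pres_class X R u. \<Union>v' \<in> pres_class X R v. pres_class X R (u @ v))"
    by (intro SUP_cong refl) (simp_all add: pres_class_def)
  moreover have "u \<in> pres_class X R u" "v \<in> pres_class X R v"
    using u v by (simp_all add: pres_class_def pres_eq.refl del: in_lists_conv_set)
  ultimately show ?thesis
    by (simp only: presented_group_def monoid.simps) blast
qed

lemma word_inv_words: "w \<in> lists (UNIV \<times> X) \<Longrightarrow> word_inv w \<in> lists (UNIV \<times> X)"
  by (auto simp: word_inv_def)

lemma pres_eq_word_inv:
  assumes "w \<in> lists (UNIV \<times> X)"
  shows "pres_eq X R (word_inv w @ w) []"
  using assms
proof (induction w)
  case Nil
  then show ?case by (simp add: word_inv_def pres_eq.refl)
next
  case (Cons l w)
  obtain s g where l: "l = (s, g)" by (cases l)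
  have g: "g \<in> X" and w: "w \<in> lists (UNIV \<times> X)" using Cons l by auto
  have "pres_eq X R [(\<not> s, g), (s, g)] []"
    using pres_eq.cancel[OF g, of R "\<not> s"] by simp
  then have "pres_eq X R ([(\<not> s, g), (s, g)] @ w) ([] @ w)"
    by (rule pres_eq.append[OF _ pres_eq.refl[OF w]])
  then have "pres_eq X R (word_inv w @ ([(\<not> s, g), (s, g)] @ w)) (word_inv w @ ([] @ w))"
    by (rule pres_eq.append[OF pres_eq.refl[OF word_inv_words[OF w]]])
  then have "pres_eq X R (word_inv w @ ([(\<not> s, g), (s, g)] @ w)) (word_inv w @ w)"
    by simp
  then have "pres_eq X R (word_inv w @ ([(\<not> s, g), (s, g)] @ w)) []"
    using Cons.IH w by (blast intro: pres_eq.trans)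
  then show ?case by (simp add: l word_inv_def)
qed

lemma presented_group_cases:
  assumes "x \<in> carrier (presented_group X R)"
  obtains w where "w \<in> lists (UNIV \<times> X)" "x = pres_class X R w"
  using assms by (auto simp: carrier_presented_group simp del: in_lists_conv_set)

lemma pres_class_closed:
  "w \<in> lists (UNIV \<times> X) \<Longrightarrow> pres_class X R w \<in> carrier (presented_group X R)"
  by (simp add: carrier_presented_group del: in_lists_conv_set)

lemma group_presented_group: "group (presented_group X R)"
proof (rule groupI)
  show "\<one>\<^bsub>presented_group X R\<^esub> \<in> carrier (presented_group X R)"
    unfolding one_presented_group by (rule pres_class_closed) simp
next
  fix x y assume "x \<in> carrier (presented_group X R)" "y \<in> carrier (presented_group X R)"
  then show "x \<otimes>\<^bsub>presented_group X R\<^esub> y \<in> carrier (presented_group X R)"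
    by (elim presented_group_cases) (simp add: mult_presented_group pres_class_closed)
next
  fix x y z assume "x \<in> carrier (presented_group X R)" "y \<in> carrier (presented_group X R)"
    "z \<in> carrier (presented_group X R)"
  then show "x \<otimes>\<^bsub>presented_group X R\<^esub> y \<otimes>\<^bsub>presented_group X R\<^esub> z =
    x \<otimes>\<^bsub>presented_group X R\<^esub> (y \<otimes>\<^bsub>presented_group X R\<^esub> z)"
    by (elim presented_group_cases) (simp add: mult_presented_group)
next
  fix x assume "x \<in> carrier (presented_group X R)"
  then show "\<one>\<^bsub>presented_group X R\<^esub> \<otimes>\<^bsub>presented_group X R\<^esub> x = x"
    by (elim presented_group_cases) (simp add: mult_presented_group one_presented_group)
next
  fix x assume "x \<in> carrier (presented_group X R)"
  then obtain w where w: "w \<in> lists (UNIV \<times> X)" "x = pres_class X R w"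
    by (rule presented_group_cases)
  have "word_inv w @ w \<in> lists (UNIV \<times> X)"
    using word_inv_words[OF w(1)] w(1) by simp
  then have "pres_class X R (word_inv w) \<otimes>\<^bsub>presented_group X R\<^esub> x = \<one>\<^bsub>presented_group X R\<^esub>"
    using w pres_eq_word_inv[OF w(1)]
    by (simp only: mult_presented_group[OF word_inv_words[OF w(1)] w(1)]
        one_presented_group pres_class_eq_iff)
  then show "\<exists>y \<in> carrier (presented_group X R).
      y \<otimes>\<^bsub>presented_group X R\<^esub> x = \<one>\<^bsub>presented_group X R\<^esub>"
    using pres_class_closed[OF word_inv_words[OF w(1)]] by blast
qed

text \<open>Evaluation of words respects \<open>pres_eq\<close> by induction on its rules, so it
  descends to classes; \<open>h\<close> evaluates an arbitrary representative. The hypothesis on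
  \<open>R\<close> is restricted to words over \<open>X\<close> because the rule \<open>rel\<close>
  applies a pair of \<open>R\<close> only under that condition.\<close>

lemma presented_group_universal:
  assumes "group L" and f: "f \<in> X \<rightarrow> carrier L"
    and R: "\<And>u v. \<lbrakk>(u, v) \<in> R; u \<in> lists (UNIV \<times> X); v \<in> lists (UNIV \<times> X)\<rbrakk>
      \<Longrightarrow> word_val L f u = word_val L f v"
  obtains h where "h \<in> hom (presented_group X R) L"
    "\<And>g. g \<in> X \<Longrightarrow> h (pres_class X R (pos_word [g])) = f g"
proof -
  interpret L: group L by fact
  have eq: "word_val L f u = word_val L f v" if "pres_eq X R u v" for u v
    using that
  proof induction
    case (append u v u' v')
    show ?case
      unfolding L.word_val_append[OF f pres_eq_words(1)[OF append(1)] pres_eq_words(1)[OF append(2)]]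
        L.word_val_append[OF f pres_eq_words(2)[OF append(1)] pres_eq_words(2)[OF append(2)]]
      using append by simp
  next
    case (cancel g s)
    then have "f g \<in> carrier L" using f by auto
    then show ?case by (simp)
  next
    case (rel u v)
    then show ?case by (rule R)
  qed auto
  define h where "h U = word_val L f (SOME w. w \<in> U)" for U
  have h: "h (pres_class X R w) = word_val L f w" if "w \<in> lists (UNIV \<times> X)" for w
  proof -
    have "w \<in> pres_class X R w" using that by (simp add: pres_class_def pres_eq.refl)
    then have "(SOME v. v \<in> pres_class X R w) \<in> pres_class X R w" by (rule someI)
    then show ?thesis using eq by (simp add: h_def pres_class_def)
  qed
  show thesis
  proof
    show "h \<in> hom (presented_group X R) L"
      by (rule homI; elim presented_group_cases)
        (simp_all add: mult_presented_group h L.word_val_append[OF f] L.word_val_closed[OF f])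
    fix g assume "g \<in> X"
    then show "h (pres_class X R (pos_word [g])) = f g"
      using f by (simp add: h Pi_iff)
  qed
qed

lemma presented_group_generated:
  "carrier (presented_group X R) =
    generate (presented_group X R) ((\<lambda>g. pres_class X R (pos_word [g])) ` X)"
    (is "_ = generate ?G ?S")
proof
  interpret group ?G by (rule group_presented_group)
  have S: "?S \<subseteq> carrier ?G" by (auto simp: carrier_presented_group)
  have "pres_class X R w \<in> generate ?G ?S" if "w \<in> lists (UNIV \<times> X)" for w
    using that
  proof (induction w)
    case Nil
    then show ?case by (metis generate.one one_presented_group)
  next
    case (Cons l w)
    obtain s g where l: "l = (s, g)" by (cases l)
    have g: "g \<in> X" and w: "w \<in> lists (UNIV \<times> X)" using Cons l by auto
    have gen: "pres_class X R [(True, g)] \<in> generate ?G ?S"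
      using g by (auto intro: generate.incl)
    have "pres_class X R [(False, g)] = inv\<^bsub>?G\<^esub> pres_class X R [(True, g)]"
    proof (rule inv_equality[symmetric])
      show "pres_class X R [(False, g)] \<otimes>\<^bsub>?G\<^esub> pres_class X R [(True, g)] = \<one>\<^bsub>?G\<^esub>"
        using g pres_eq.cancel[OF g, of R False]
        by (simp add: mult_presented_group one_presented_group pres_class_eq_iff)
    qed (use g in \<open>auto simp: carrier_presented_group\<close>)
    then have "pres_class X R [l] \<in> generate ?G ?S"
      using gen generate_m_inv_closed[OF S gen] l by (cases s) auto
    moreover have "pres_class X R (l # w) = pres_class X R [l] \<otimes>\<^bsub>?G\<^esub> pres_class X R w"
      using g w l by (subst mult_presented_group) auto
    ultimately show ?case using Cons.IH w by (simp add: generate.eng)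
  qed
  then show "carrier ?G \<subseteq> generate ?G ?S" by (auto simp: carrier_presented_group)
  show "generate ?G ?S \<subseteq> carrier ?G" using S by (rule generate_incl)
qed

lemma presented_group_rel:
  assumes "(u, v) \<in> R" "u \<in> lists (UNIV \<times> X)" "v \<in> lists (UNIV \<times> X)"
  shows "pres_class X R u = pres_class X R v"
  using assms by (simp add: pres_class_eq_iff pres_eq.rel)

section \<open>Homomorphisms and bihomomorphisms\<close>

lemma (in group) generate_hom_eq:
  assumes "group L" "f \<in> hom G L" "h \<in> hom G L" "S \<subseteq> carrier G"
    and "\<And>s. s \<in> S \<Longrightarrow> f s = h s" "x \<in> generate G S"
  shows "f x = h x"
proof -
  interpret L: group L by fact
  interpret f: group_hom G L f using assms by (simp add: group_hom_def group_hom_axioms_def is_group)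
  interpret h: group_hom G L h using assms by (simp add: group_hom_def group_hom_axioms_def is_group)
  show ?thesis
    using assms(6)
  proof induction
    case (inv s)
    then show ?case using assms(4,5) by (metis f.hom_inv h.hom_inv subsetD)
  next
    case (eng x y)
    then show ?case using assms(4) by (simp add: generate_in_carrier)
  next
    case one
    show ?case by simp
  next
    case (incl s)
    then show ?case by (rule assms(5))
  qed
qed

definition central :: "('b, 'm) monoid_scheme \<Rightarrow> 'b \<Rightarrow> bool"
  where "central G z \<longleftrightarrow> z \<in> carrier G \<and> (\<forall>x \<in> carrier G. x \<otimes>\<^bsub>G\<^esub> z = z \<otimes>\<^bsub>G\<^esub> x)"

text \<open>The target is an arbitrary group because \<open>bar\<close> and composites with
  \<open>P\<close> are bilinear maps into e-levels, which are in general noncommutative.\<close>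

definition bihom :: "('a, 'l) monoid_scheme \<Rightarrow> ('b, 'm) monoid_scheme
    \<Rightarrow> ('c, 'n) monoid_scheme \<Rightarrow> ('a \<Rightarrow> 'b \<Rightarrow> 'c) \<Rightarrow> bool"
  where "bihom A B C f \<longleftrightarrow> (\<forall>a \<in> carrier A. f a \<in> hom B C) \<and>
    (\<forall>b \<in> carrier B. (\<lambda>a. f a b) \<in> hom A C)"

lemma bihomI:
  assumes "\<And>a b. \<lbrakk>a \<in> carrier A; b \<in> carrier B\<rbrakk> \<Longrightarrow> f a b \<in> carrier C"
    and "\<And>a a' b. \<lbrakk>a \<in> carrier A; a' \<in> carrier A; b \<in> carrier B\<rbrakk>
      \<Longrightarrow> f (a \<otimes>\<^bsub>A\<^esub> a') b = f a b \<otimes>\<^bsub>C\<^esub> f a' b"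
    and "\<And>a b b'. \<lbrakk>a \<in> carrier A; b \<in> carrier B; b' \<in> carrier B\<rbrakk>
      \<Longrightarrow> f a (b \<otimes>\<^bsub>B\<^esub> b') = f a b \<otimes>\<^bsub>C\<^esub> f a b'"
  shows "bihom A B C f"
  unfolding bihom_def by (intro conjI ballI homI assms)

lemma
  assumes "bihom A B C f"
  shows bihom_hom_right: "a \<in> carrier A \<Longrightarrow> f a \<in> hom B C"
    and bihom_hom_left: "b \<in> carrier B \<Longrightarrow> (\<lambda>a. f a b) \<in> hom A C"
  using assms by (simp_all add: bihom_def)

lemma
  assumes "bihom A B C f"
  shows bihom_closed: "\<lbrakk>a \<in> carrier A; b \<in> carrier B\<rbrakk> \<Longrightarrow> f a b \<in> carrier C"
    and bihom_left: "\<lbrakk>a \<in> carrier A; a' \<in> carrier A; b \<in> carrier B\<rbrakk>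
      \<Longrightarrow> f (a \<otimes>\<^bsub>A\<^esub> a') b = f a b \<otimes>\<^bsub>C\<^esub> f a' b"
    and bihom_right: "\<lbrakk>a \<in> carrier A; b \<in> carrier B; b' \<in> carrier B\<rbrakk>
      \<Longrightarrow> f a (b \<otimes>\<^bsub>B\<^esub> b') = f a b \<otimes>\<^bsub>C\<^esub> f a b'"
  using hom_mult[OF bihom_hom_left[OF assms]] hom_mult[OF bihom_hom_right[OF assms]]
    hom_in_carrier[OF bihom_hom_right[OF assms]] by blast+

lemma bihom_one_inv:
  assumes "bihom A B C f" "group A" "group B" "group C"
  shows bihom_one_left: "b \<in> carrier B \<Longrightarrow> f \<one>\<^bsub>A\<^esub> b = \<one>\<^bsub>C\<^esub>"
    and bihom_one_right: "a \<in> carrier A \<Longrightarrow> f a \<one>\<^bsub>B\<^esub> = \<one>\<^bsub>C\<^esub>"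
    and bihom_inv_left: "\<lbrakk>a \<in> carrier A; b \<in> carrier B\<rbrakk> \<Longrightarrow> f (inv\<^bsub>A\<^esub> a) b = inv\<^bsub>C\<^esub> f a b"
    and bihom_inv_right: "\<lbrakk>a \<in> carrier A; b \<in> carrier B\<rbrakk> \<Longrightarrow> f a (inv\<^bsub>B\<^esub> b) = inv\<^bsub>C\<^esub> f a b"
proof -
  have l: "group_hom A C (\<lambda>a. f a b)" if "b \<in> carrier B" for b
    using assms that by (auto simp: bihom_def group_hom_def group_hom_axioms_def)
  have r: "group_hom B C (f a)" if "a \<in> carrier A" for a
    using assms that by (auto simp: bihom_def group_hom_def group_hom_axioms_def)
  show "b \<in> carrier B \<Longrightarrow> f \<one>\<^bsub>A\<^esub> b = \<one>\<^bsub>C\<^esub>" using group_hom.hom_one[OF l] .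
  show "a \<in> carrier A \<Longrightarrow> f a \<one>\<^bsub>B\<^esub> = \<one>\<^bsub>C\<^esub>" using group_hom.hom_one[OF r] .
  show "\<lbrakk>a \<in> carrier A; b \<in> carrier B\<rbrakk> \<Longrightarrow> f (inv\<^bsub>A\<^esub> a) b = inv\<^bsub>C\<^esub> f a b"
    using group_hom.hom_inv[OF l] .
  show "\<lbrakk>a \<in> carrier A; b \<in> carrier B\<rbrakk> \<Longrightarrow> f a (inv\<^bsub>B\<^esub> b) = inv\<^bsub>C\<^esub> f a b"
    using group_hom.hom_inv[OF r] .
qed

lemma bihom_eq_on_generators:
  assumes "group A" "group B" "group C" "bihom A B C f" "bihom A B C g"
    and S: "S \<subseteq> carrier A" "carrier A = generate A S"
    and T: "T \<subseteq> carrier B" "carrier B = generate B T"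
    and eq: "\<And>s t. \<lbrakk>s \<in> S; t \<in> T\<rbrakk> \<Longrightarrow> f s t = g s t"
    and "a \<in> carrier A" "b \<in> carrier B"
  shows "f a b = g a b"
proof -
  interpret A: group A by fact
  interpret B: group B by fact
  have *: "f s b = g s b" if "s \<in> S" for s
  proof (rule B.generate_hom_eq[OF \<open>group C\<close> _ _ T(1)])
    show "f s \<in> hom B C" "g s \<in> hom B C" using assms that by (auto simp: bihom_def)
    show "b \<in> generate B T" using assms by auto
  qed (use that eq in auto)
  show ?thesis
  proof (rule A.generate_hom_eq[OF \<open>group C\<close> _ _ S(1)])
    show "(\<lambda>a. f a b) \<in> hom A C" "(\<lambda>a. g a b) \<in> hom A C" using assms by (auto simp: bihom_def)
    show "a \<in> generate A S" using assms by auto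
  qed (use * in auto)
qed

text \<open>At the unit both functions are forced to be trivial, and the common defect
  \<open>\<beta>\<close> then determines the values on inverses and products from those on
  \<open>S\<close>. With values in an ee-level this gives uniqueness of \<open>H\<close>; with
  values in an e-level it gives identities for the associativity map.\<close>

lemma quadratic_eq_on_generators:
  assumes "group A" "group C" and \<beta>: "bihom A A C \<beta>"
    and f: "\<And>x. x \<in> carrier A \<Longrightarrow> f x \<in> carrier C"
      "\<And>x y. \<lbrakk>x \<in> carrier A; y \<in> carrier A\<rbrakk> \<Longrightarrow> f (x \<otimes>\<^bsub>A\<^esub> y) = f x \<otimes>\<^bsub>C\<^esub> f y \<otimes>\<^bsub>C\<^esub> \<beta> x y"
    and g: "\<And>x. x \<in> carrier A \<Longrightarrow> g x \<in> carrier C"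
      "\<And>x y. \<lbrakk>x \<in> carrier A; y \<in> carrier A\<rbrakk> \<Longrightarrow> g (x \<otimes>\<^bsub>A\<^esub> y) = g x \<otimes>\<^bsub>C\<^esub> g y \<otimes>\<^bsub>C\<^esub> \<beta> x y"
    and S: "S \<subseteq> carrier A" "carrier A = generate A S"
    and eq: "\<And>s. s \<in> S \<Longrightarrow> f s = g s" and x: "x \<in> carrier A"
  shows "f x = g x"
proof -
  interpret A: group A by fact
  interpret C: group C by fact
  have \<beta>c: "\<beta> x y \<in> carrier C" if "x \<in> carrier A" "y \<in> carrier A" for x y
    using bihom_closed[OF \<beta>] that .
  have \<beta>1: "\<beta> \<one>\<^bsub>A\<^esub> \<one>\<^bsub>A\<^esub> = \<one>\<^bsub>C\<^esub>"
    by (rule bihom_one_left[OF \<beta> \<open>group A\<close> \<open>group A\<close> \<open>group C\<close> A.one_closed])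
  have f1: "f \<one>\<^bsub>A\<^esub> = \<one>\<^bsub>C\<^esub>" using f(1)[of "\<one>\<^bsub>A\<^esub>"] f(2)[of "\<one>\<^bsub>A\<^esub>" "\<one>\<^bsub>A\<^esub>"] \<beta>1 by simp
  have g1: "g \<one>\<^bsub>A\<^esub> = \<one>\<^bsub>C\<^esub>" using g(1)[of "\<one>\<^bsub>A\<^esub>"] g(2)[of "\<one>\<^bsub>A\<^esub>" "\<one>\<^bsub>A\<^esub>"] \<beta>1 by simp
  have "x \<in> generate A S" using x S by simp
  then show ?thesis
  proof induction
    case one
    show ?case by (simp add: f1 g1)
  next
    case (incl s)
    then show ?case by (rule eq)
  next
    case (inv s)
    have s: "s \<in> carrier A" using inv S by auto
    \<comment> \<open>The product rule for \<open>s\<close> and its inverse expresses the value at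
      the unit; cancelling recovers the value at the inverse.\<close>
    have "f s \<otimes>\<^bsub>C\<^esub> f (inv\<^bsub>A\<^esub> s) \<otimes>\<^bsub>C\<^esub> \<beta> s (inv\<^bsub>A\<^esub> s) = g s \<otimes>\<^bsub>C\<^esub> g (inv\<^bsub>A\<^esub> s) \<otimes>\<^bsub>C\<^esub> \<beta> s (inv\<^bsub>A\<^esub> s)"
      using f(2)[of s "inv\<^bsub>A\<^esub> s"] g(2)[of s "inv\<^bsub>A\<^esub> s"] s f1 g1 by simp
    then show ?case using s f(1) g(1) \<beta>c eq[OF inv] by simp
  next
    case (eng x y)
    then have "x \<in> carrier A" "y \<in> carrier A" using S by auto
    then show ?case using eng f g by simp
  qed
qed

lemma (in group) central_commute: "\<lbrakk>central G z; x \<in> carrier G\<rbrakk> \<Longrightarrow> z \<otimes> x = x \<otimes> z"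
  by (simp add: central_def)

lemma (in group) central_closed: "central G z \<Longrightarrow> z \<in> carrier G"
  by (simp add: central_def)

lemma (in group) central_one: "central G \<one>"
  by (simp add: central_def)

lemma (in group) central_mult:
  assumes "central G y" "central G z"
  shows "central G (y \<otimes> z)"
  using assms unfolding central_def by (metis m_assoc m_closed)

lemma (in group) central_inv:
  assumes "central G z"
  shows "central G (inv z)"
proof -
  have "x \<otimes> inv z = inv z \<otimes> x" if "x \<in> carrier G" for x
  proof -
    have "z \<otimes> x = x \<otimes> z" using assms that by (simp add: central_def)
    then have "inv z \<otimes> (z \<otimes> x) \<otimes> inv z = inv z \<otimes> (x \<otimes> z) \<otimes> inv z" by simp
    then show ?thesis
      using that central_closed[OF assms] by (simp add: m_assoc flip: m_assoc[of "inv z" z])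
  qed
  then show ?thesis using assms by (simp add: central_def)
qed

text \<open>As a commutative group in its own right, the centre lets results for commutative targets
  apply to central-valued maps into a nonabelian group. It also carries the central coefficients in
  \<open>prep\<close>.\<close>

definition center :: "('b, 'm) monoid_scheme \<Rightarrow> 'b monoid"
  where "center G = \<lparr>carrier = {z. central G z}, monoid.mult = monoid.mult G, one = \<one>\<^bsub>G\<^esub>\<rparr>"

lemma (in group) comm_group_center: "comm_group (center G)"
proof (rule comm_groupI)
  fix x assume "x \<in> carrier (center G)"
  then have x: "central G x" by (simp add: center_def)
  show "\<exists>y \<in> carrier (center G). y \<otimes>\<^bsub>center G\<^esub> x = \<one>\<^bsub>center G\<^esub>"
    using central_inv[OF x] central_closed[OF x]
    by (intro bexI[of _ "inv x"]) (simp_all add: center_def)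
qed (auto simp: center_def central_mult central_one central_closed m_assoc intro: central_commute)

lemma center_hom: "h \<in> hom A (center C) \<Longrightarrow> h \<in> hom A C"
  by (auto simp: hom_def center_def central_def)

section \<open>Tensor products of abelian groups\<close>

lemma bilinear_relators_carrier:
  assumes "group A" "group B"
  shows "bilinear_relators A B \<subseteq> carrier (free_Abelian_group (carrier A \<times> carrier B))"
proof -
  interpret A: group A by fact
  interpret B: group B by fact
  have *: "Poly_Mapping.keys (frag_of p - frag_of q - frag_of r) \<subseteq> {p, q, r}" for p q r :: "'a \<times> 'b"
    using keys_diff[of "frag_of p - frag_of q" "frag_of r"] keys_diff[of "frag_of p" "frag_of q"]
    by auto
  show ?thesis
  proof
    fix r assume "r \<in> bilinear_relators A B"
    then show "r \<in> carrier (free_Abelian_group (carrier A \<times> carrier B))"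
      by cases (use * in \<open>fastforce dest: subsetD[OF *]\<close>)+
  qed
qed

locale group_pair = A: group A + B: group B
  for A :: "'a monoid" and B :: "'b monoid"
begin

abbreviation "freeAB \<equiv> free_Abelian_group (carrier A \<times> carrier B)"

sublocale F: comm_group freeAB by (rule abelian_free_Abelian_group)

lemma bilinear_subgroup: "subgroup (bilinear_subgroup A B) freeAB"
  unfolding bilinear_subgroup_def
  by (rule F.generate_is_subgroup)
    (rule bilinear_relators_carrier[OF A.group_axioms B.group_axioms])

sublocale N: normal "bilinear_subgroup A B" freeAB
  by (rule F.subgroup_imp_normal[OF bilinear_subgroup])

lemma tensor_comm_group: "comm_group (A \<bowtie> B)"
  unfolding ab_tensor_def by (rule F.abelian_FactGroup[OF bilinear_subgroup])

sublocale T: comm_group "A \<bowtie> B" by (rule tensor_comm_group)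

lemma class_hom: "(\<lambda>p. bilinear_subgroup A B #>\<^bsub>freeAB\<^esub> p) \<in> hom freeAB (A \<bowtie> B)"
  unfolding ab_tensor_def by (rule N.r_coset_hom_Mod)

interpretation cls: group_hom freeAB "A \<bowtie> B" "\<lambda>p. bilinear_subgroup A B #>\<^bsub>freeAB\<^esub> p"
  using class_hom by (simp add: group_hom_def group_hom_axioms_def F.is_group T.is_group)

lemma class_relator:
  assumes "r \<in> bilinear_relators A B"
  shows "bilinear_subgroup A B #>\<^bsub>freeAB\<^esub> r = \<one>\<^bsub>A \<bowtie> B\<^esub>"
proof -
  have "r \<in> bilinear_subgroup A B"
    unfolding bilinear_subgroup_def using assms by (rule generate.incl)
  then show ?thesis
    using F.coset_join2[OF _ bilinear_subgroup] N.subset by (auto simp: ab_tensor_def)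
qed

lemma pure_closed: "\<lbrakk>a \<in> carrier A; b \<in> carrier B\<rbrakk> \<Longrightarrow> pure_tensor A B a b \<in> carrier (A \<bowtie> B)"
  unfolding pure_tensor_def by (rule cls.hom_closed) simp

text \<open>Both kinds of bilinear relator have the shape \<open>p - q - r\<close>, so this single
  computation gives additivity in either variable.\<close>

lemma class_diff:
  assumes "p \<in> carrier A \<times> carrier B" "q \<in> carrier A \<times> carrier B" "r \<in> carrier A \<times> carrier B"
    and "frag_of p - frag_of q - frag_of r \<in> bilinear_relators A B"
  shows "bilinear_subgroup A B #>\<^bsub>freeAB\<^esub> frag_of p =
    (bilinear_subgroup A B #>\<^bsub>freeAB\<^esub> frag_of q) \<otimes>\<^bsub>A \<bowtie> B\<^esub> (bilinear_subgroup A B #>\<^bsub>freeAB\<^esub> frag_of r)"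
    (is "?c (frag_of p) = _")
proof -
  define x where "x = frag_of p - frag_of q - frag_of r"
  have x: "x \<in> carrier freeAB" "?c x = \<one>\<^bsub>A \<bowtie> B\<^esub>"
    using subsetD[OF bilinear_relators_carrier[OF A.group_axioms B.group_axioms] assms(4)]
      class_relator[OF assms(4)] unfolding x_def by blast+
  have "frag_of p = x \<otimes>\<^bsub>freeAB\<^esub> (frag_of q \<otimes>\<^bsub>freeAB\<^esub> frag_of r)" by (simp add: x_def)
  then have "?c (frag_of p) = ?c (x \<otimes>\<^bsub>freeAB\<^esub> (frag_of q \<otimes>\<^bsub>freeAB\<^esub> frag_of r))"
    by simp
  also have "\<dots> = ?c x \<otimes>\<^bsub>A \<bowtie> B\<^esub> (?c (frag_of q) \<otimes>\<^bsub>A \<bowtie> B\<^esub> ?c (frag_of r))"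
    using assms x(1) frag_of_in_free_Abelian_group
    by (metis F.m_closed cls.hom_mult)
  finally show ?thesis using x assms by (simp add: cls.hom_closed)
qed

lemma pure_bihom: "bihom A B (A \<bowtie> B) (pure_tensor A B)"
proof (rule bihomI)
  fix a a' b assume "a \<in> carrier A" "a' \<in> carrier A" "b \<in> carrier B"
  then show "pure_tensor A B (a \<otimes>\<^bsub>A\<^esub> a') b = pure_tensor A B a b \<otimes>\<^bsub>A \<bowtie> B\<^esub> pure_tensor A B a' b"
    unfolding pure_tensor_def by (intro class_diff) (auto intro: bilinear_relators.intros)
next
  fix a b b' assume "a \<in> carrier A" "b \<in> carrier B" "b' \<in> carrier B"
  then show "pure_tensor A B a (b \<otimes>\<^bsub>B\<^esub> b') = pure_tensor A B a b \<otimes>\<^bsub>A \<bowtie> B\<^esub> pure_tensor A B a b'"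
    unfolding pure_tensor_def by (intro class_diff) (auto intro: bilinear_relators.intros)
qed (rule pure_closed)

lemmas pure_left = bihom_left[OF pure_bihom]
  and pure_right = bihom_right[OF pure_bihom]
  and pure_one_left = bihom_one_left[OF pure_bihom A.group_axioms B.group_axioms T.group_axioms]
  and pure_one_right = bihom_one_right[OF pure_bihom A.group_axioms B.group_axioms T.group_axioms]
  and pure_inv_left = bihom_inv_left[OF pure_bihom A.group_axioms B.group_axioms T.group_axioms]
  and pure_inv_right = bihom_inv_right[OF pure_bihom A.group_axioms B.group_axioms T.group_axioms]

text \<open>No cases for the unit and for inverses occur: the unit is the pure tensor of the units,
  and the inverse of a pure tensor is again pure, by inverting its left factor.\<close>

lemma tensor_induct [consumes 1, case_names pure mult]:
  assumes w: "w \<in> carrier (A \<bowtie> B)"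
    and pure: "\<And>a b. \<lbrakk>a \<in> carrier A; b \<in> carrier B\<rbrakk> \<Longrightarrow> P (pure_tensor A B a b)"
    and mult: "\<And>u v. \<lbrakk>u \<in> carrier (A \<bowtie> B); v \<in> carrier (A \<bowtie> B); P u; P v\<rbrakk> \<Longrightarrow> P (u \<otimes>\<^bsub>A \<bowtie> B\<^esub> v)"
  shows "P w"
proof -
  let ?c = "\<lambda>p. bilinear_subgroup A B #>\<^bsub>freeAB\<^esub> p"
  \<comment> \<open>Induction on the free abelian group produces differences \<open>x - y\<close>,
    so the claim is strengthened to an element together with its inverse.\<close>
  have *: "P (?c p) \<and> P (inv\<^bsub>A \<bowtie> B\<^esub> ?c p)" if "Poly_Mapping.keys p \<subseteq> carrier A \<times> carrier B" for p
    using that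
  proof (induction p rule: free_Abelian_group_induct[consumes 1])
    case 1
    have "?c 0 = \<one>\<^bsub>A \<bowtie> B\<^esub>" using cls.hom_one by simp
    moreover have "P \<one>\<^bsub>A \<bowtie> B\<^esub>"
      using pure[OF A.one_closed B.one_closed] by (simp add: pure_one_left)
    ultimately show ?case by simp
  next
    case (2 x y)
    have "x - y = x \<otimes>\<^bsub>freeAB\<^esub> inv\<^bsub>freeAB\<^esub> y" using 2 by simp
    then have c: "?c (x - y) = ?c x \<otimes>\<^bsub>A \<bowtie> B\<^esub> inv\<^bsub>A \<bowtie> B\<^esub> ?c y"
      using 2(1,2) cls.hom_inv[of y] cls.hom_mult[of x "inv\<^bsub>freeAB\<^esub> y"] F.inv_closed[of y] by auto
    have cl: "?c x \<in> carrier (A \<bowtie> B)" "?c y \<in> carrier (A \<bowtie> B)"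
      using 2(1,2) by (auto intro!: cls.hom_closed)
    then have "inv\<^bsub>A \<bowtie> B\<^esub> ?c (x - y) = inv\<^bsub>A \<bowtie> B\<^esub> ?c x \<otimes>\<^bsub>A \<bowtie> B\<^esub> ?c y"
      by (simp add: c T.inv_mult)
    then show ?case using 2 c cl mult by simp
  next
    case (3 q)
    then obtain a b where q: "q = (a, b)" "a \<in> carrier A" "b \<in> carrier B" by auto
    have "inv\<^bsub>A \<bowtie> B\<^esub> ?c (frag_of q) = pure_tensor A B (inv\<^bsub>A\<^esub> a) b"
      using q by (simp add: pure_inv_left) (simp add: pure_tensor_def)
    then show ?case using pure q A.inv_closed by (simp add: pure_tensor_def)
  qed
  obtain p where "Poly_Mapping.keys p \<subseteq> carrier A \<times> carrier B" "w = ?c p"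
    using w by (auto simp: ab_tensor_def carrier_FactGroup)
  then show ?thesis using * by simp
qed

lemma tensor_hom_eqI:
  assumes "f \<in> hom (A \<bowtie> B) C" "g \<in> hom (A \<bowtie> B) C"
    and "\<And>a b. \<lbrakk>a \<in> carrier A; b \<in> carrier B\<rbrakk> \<Longrightarrow> f (pure_tensor A B a b) = g (pure_tensor A B a b)"
    and "w \<in> carrier (A \<bowtie> B)"
  shows "f w = g w"
  using assms(4)
  by (induction rule: tensor_induct) (simp_all add: assms(3) hom_mult[OF assms(1)] hom_mult[OF assms(2)])

lemma tensor_lift_exists:
  assumes "comm_group C" "bihom A B C f"
  obtains h where "h \<in> hom (A \<bowtie> B) C"
    "\<And>a b. \<lbrakk>a \<in> carrier A; b \<in> carrier B\<rbrakk> \<Longrightarrow> h (pure_tensor A B a b) = f a b"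
proof -
  interpret C: comm_group C by fact
  note f = assms(2)
  have "(\<lambda>(a, b). f a b) ` (carrier A \<times> carrier B) \<subseteq> carrier C"
    using bihom_closed[OF f] by auto
  then obtain h0 where h0: "h0 \<in> hom freeAB C"
    "\<And>p. p \<in> carrier A \<times> carrier B \<Longrightarrow> h0 (frag_of p) = (\<lambda>(a, b). f a b) p"
    by (rule C.free_Abelian_group_universal) blast
  interpret h0: group_hom freeAB C h0
    using h0 by (simp add: group_hom_def group_hom_axioms_def F.is_group C.is_group)
  have diff: "h0 (frag_of p - frag_of q - frag_of r) = \<one>\<^bsub>C\<^esub>"
    if "p \<in> carrier A \<times> carrier B" "q \<in> carrier A \<times> carrier B" "r \<in> carrier A \<times> carrier B"
      "h0 (frag_of p) = h0 (frag_of q) \<otimes>\<^bsub>C\<^esub> h0 (frag_of r)" for p q r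
  proof -
    have "frag_of p - frag_of q - frag_of r =
      frag_of p \<otimes>\<^bsub>freeAB\<^esub> inv\<^bsub>freeAB\<^esub> (frag_of q \<otimes>\<^bsub>freeAB\<^esub> frag_of r)"
      using that by (subst F.inv_mult) auto
    then have "h0 (frag_of p - frag_of q - frag_of r) =
      h0 (frag_of p) \<otimes>\<^bsub>C\<^esub> inv\<^bsub>C\<^esub> (h0 (frag_of q) \<otimes>\<^bsub>C\<^esub> h0 (frag_of r))"
      using that by (metis F.inv_closed F.m_closed frag_of_in_free_Abelian_group h0.hom_inv h0.hom_mult)
    then show ?thesis using that h0.hom_closed by simp
  qed
  have "bilinear_relators A B \<subseteq> kernel freeAB C h0"
  proof
    fix r assume r: "r \<in> bilinear_relators A B"
    then have "h0 r = \<one>\<^bsub>C\<^esub>"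
      by cases (auto intro!: diff simp: h0(2) bihom_left[OF f] bihom_right[OF f])
    then show "r \<in> kernel freeAB C h0"
      using subsetD[OF bilinear_relators_carrier[OF A.group_axioms B.group_axioms] r]
      unfolding kernel_def by blast
  qed
  then have "bilinear_subgroup A B \<subseteq> kernel freeAB C h0"
    unfolding bilinear_subgroup_def
    by (rule F.generate_subgroup_incl[OF _ h0.subgroup_kernel])
  then obtain h where "h \<in> hom (A \<bowtie> B) C"
    "\<And>p. p \<in> carrier freeAB \<Longrightarrow> h (bilinear_subgroup A B #>\<^bsub>freeAB\<^esub> p) = h0 p"
    using h0.FactGroup_universal_kernel[OF N.normal_axioms] unfolding ab_tensor_def by metis
  then show thesis
    using that h0(2) by (simp add: pure_tensor_def)
qed

text \<open>The lift is taken into the centre of \<open>C\<close>, which is commutative. This is how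
  \<open>P\<close> of the tensor product arises from \<open>bar\<close>.\<close>

lemma tensor_lift_central:
  assumes "group C" "bihom A B C f" "\<And>a b. \<lbrakk>a \<in> carrier A; b \<in> carrier B\<rbrakk> \<Longrightarrow> central C (f a b)"
  obtains h where "h \<in> hom (A \<bowtie> B) C"
    "\<And>a b. \<lbrakk>a \<in> carrier A; b \<in> carrier B\<rbrakk> \<Longrightarrow> h (pure_tensor A B a b) = f a b"
    "\<And>w. w \<in> carrier (A \<bowtie> B) \<Longrightarrow> central C (h w)"
proof -
  interpret C: group C by fact
  have "bihom A B (center C) f"
    using bihom_closed[OF assms(2)] bihom_left[OF assms(2)] bihom_right[OF assms(2)] assms(3) by (intro bihomI) (simp_all add: center_def)
  then obtain h where h: "h \<in> hom (A \<bowtie> B) (center C)"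
    "\<And>a b. \<lbrakk>a \<in> carrier A; b \<in> carrier B\<rbrakk> \<Longrightarrow> h (pure_tensor A B a b) = f a b"
    by (rule tensor_lift_exists[OF C.comm_group_center]) blast
  show thesis
    using that[OF center_hom[OF h(1)] h(2)] hom_in_carrier[OF h(1)] by (simp add: center_def)
qed

end

text \<open>Choosing the lift as a function of \<open>f\<close> allows a lift that depends on
  parameters to be lifted again in those parameters.\<close>

definition tensor_lift :: "'a monoid \<Rightarrow> 'b monoid \<Rightarrow> 'c monoid \<Rightarrow> ('a \<Rightarrow> 'b \<Rightarrow> 'c)
    \<Rightarrow> ('a \<times> 'b \<Rightarrow>\<^sub>0 int) set \<Rightarrow> 'c"
  where "tensor_lift A B C f = (SOME h. h \<in> hom (A \<bowtie> B) C \<and>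
    (\<forall>a \<in> carrier A. \<forall>b \<in> carrier B. h (pure_tensor A B a b) = f a b))"

lemma
  assumes "group A" "group B" "comm_group C" "bihom A B C f"
  shows tensor_lift_hom: "tensor_lift A B C f \<in> hom (A \<bowtie> B) C"
    and tensor_lift_pure: "\<lbrakk>a \<in> carrier A; b \<in> carrier B\<rbrakk>
      \<Longrightarrow> tensor_lift A B C f (pure_tensor A B a b) = f a b"
proof -
  interpret group_pair A B using assms by (simp add: group_pair_def)
  have "\<exists>h. h \<in> hom (A \<bowtie> B) C \<and>
    (\<forall>a \<in> carrier A. \<forall>b \<in> carrier B. h (pure_tensor A B a b) = f a b)"
    using tensor_lift_exists[OF assms(3,4)] by metis
  from someI_ex[OF this] show "tensor_lift A B C f \<in> hom (A \<bowtie> B) C"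
    "\<lbrakk>a \<in> carrier A; b \<in> carrier B\<rbrakk> \<Longrightarrow> tensor_lift A B C f (pure_tensor A B a b) = f a b"
    unfolding tensor_lift_def by blast+
qed

text \<open>Linearity in the parameter \<open>d\<close> passes from pure tensors to the whole lift.
  Iterating this gives maps out of threefold and fourfold tensor products by currying.\<close>

lemma tensor_lift_bihom:
  assumes "group A" "group B" "group D" "comm_group C"
    and f: "\<And>d. d \<in> carrier D \<Longrightarrow> bihom A B C (f d)"
    and h: "\<And>a b. \<lbrakk>a \<in> carrier A; b \<in> carrier B\<rbrakk> \<Longrightarrow> (\<lambda>d. f d a b) \<in> hom D C"
  shows "bihom D (A \<bowtie> B) C (\<lambda>d. tensor_lift A B C (f d))"
proof -
  interpret group_pair A B using assms by (simp add: group_pair_def)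
  interpret C: comm_group C by fact
  interpret D: group D by fact
  note l = tensor_lift_hom[OF assms(1,2,4) f] tensor_lift_pure[OF assms(1,2,4) f]
  have *: "tensor_lift A B C (f (d \<otimes>\<^bsub>D\<^esub> d')) w = tensor_lift A B C (f d) w \<otimes>\<^bsub>C\<^esub> tensor_lift A B C (f d') w"
    if d: "d \<in> carrier D" "d' \<in> carrier D" and w: "w \<in> carrier (A \<bowtie> B)" for d d' w
    using w
  proof (induction rule: tensor_induct)
    case (pure a b)
    then show ?case using d hom_mult[OF h] by (simp add: l)
  next
    case (mult u v)
    then show ?case
      using d hom_in_carrier[OF l(1)] by (simp add: hom_mult[OF l(1)] C.m_ac)
  qed
  show ?thesis
    using * hom_in_carrier[OF l(1)] by (intro bihomI) (simp_all add: hom_mult[OF l(1)])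
qed

section \<open>Reification of abelian groups\<close>

definition lin :: "'a monoid \<Rightarrow> ('a \<Rightarrow>\<^sub>0 int) \<Rightarrow> 'a"
  where "lin G = (SOME h. h \<in> hom (free_Abelian_group (carrier G)) G \<and>
    (\<forall>x \<in> carrier G. h (frag_of x) = x))"

text \<open>Proving \<open>rep G x p\<close> by resolution reads off a formal linear combination \<open>p\<close>, so that the
  simplifier decides identities in a commutative group by arithmetic on \<^type>\<open>poly_mapping\<close>.\<close>

definition rep :: "'a monoid \<Rightarrow> 'a \<Rightarrow> ('a \<Rightarrow>\<^sub>0 int) \<Rightarrow> bool"
  where "rep G x p \<longleftrightarrow> Poly_Mapping.keys p \<subseteq> carrier G \<and> x = lin G p"

lemma lin_hom:
  assumes "comm_group G"
  shows "lin G \<in> hom (free_Abelian_group (carrier G)) G" "x \<in> carrier G \<Longrightarrow> lin G (frag_of x) = x"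
proof -
  interpret comm_group G by fact
  obtain h where "h \<in> hom (free_Abelian_group (carrier G)) G" "\<And>x. x \<in> carrier G \<Longrightarrow> h (frag_of x) = x"
    by (rule free_Abelian_group_universal[of "\<lambda>x. x" "carrier G"]) auto
  then have "\<exists>h. h \<in> hom (free_Abelian_group (carrier G)) G \<and> (\<forall>x \<in> carrier G. h (frag_of x) = x)"
    by blast
  from someI_ex[OF this] show "lin G \<in> hom (free_Abelian_group (carrier G)) G"
    "x \<in> carrier G \<Longrightarrow> lin G (frag_of x) = x"
    unfolding lin_def by blast+
qed

lemma rep_atom: "comm_group G \<Longrightarrow> x \<in> carrier G \<Longrightarrow> rep G x (frag_of x)"
  by (simp add: rep_def lin_hom)

lemma rep_mult:
  assumes "comm_group G" "rep G x p" "rep G y q"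
  shows "rep G (x \<otimes>\<^bsub>G\<^esub> y) (p + q)"
  using hom_mult[OF lin_hom(1)[OF assms(1)], of p q] assms(2,3) keys_add[of p q]
  by (auto simp: rep_def)

lemma rep_inv:
  assumes "comm_group G" "rep G x p"
  shows "rep G (inv\<^bsub>G\<^esub> x) (- p)"
proof -
  interpret comm_group G by fact
  interpret group_hom "free_Abelian_group (carrier G)" G "lin G"
    using lin_hom(1)[OF assms(1)] by (simp add: group_hom_def group_hom_axioms_def is_group)
  show ?thesis using assms(2) hom_inv[of p] by (auto simp: rep_def)
qed

lemma rep_one:
  assumes "comm_group G"
  shows "rep G \<one>\<^bsub>G\<^esub> 0"
proof -
  interpret comm_group G by fact
  interpret group_hom "free_Abelian_group (carrier G)" G "lin G"
    using lin_hom(1)[OF assms(1)] by (simp add: group_hom_def group_hom_axioms_def is_group)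
  show ?thesis using hom_one by (simp add: rep_def)
qed

lemma rep_eqI: "\<lbrakk>rep G x p; rep G y q; p = q\<rbrakk> \<Longrightarrow> x = y"
  by (simp add: rep_def)

section \<open>Square groups\<close>

context square_group
begin

sublocale e: group "sq_e M" by (rule group_e)
sublocale ee: comm_group "sq_ee M" by (rule comm_group_ee)

lemmas reps = rep_mult[OF comm_group_ee] rep_inv[OF comm_group_ee] rep_one[OF comm_group_ee]
lemmas rep_atom = rep_atom[OF comm_group_ee]

lemma H_closed [simp]: "x \<in> carrier (sq_e M) \<Longrightarrow> sq_H M x \<in> carrier (sq_ee M)"
  using H_quadratic by (auto simp: quadratic_map_def)

sublocale P: group_hom "sq_ee M" "sq_e M" "sq_P M"
  using P_hom by (simp add: group_hom_def group_hom_axioms_def e.is_group ee.is_group)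

lemmas P_mult = P.hom_mult and P_inv = P.hom_inv

lemma cross_bihom: "bihom (sq_e M) (sq_e M) (sq_ee M) (sq_cross M)"
  using H_quadratic by (simp add: quadratic_map_def bihom_def sq_cross_def)

lemmas cross_closed [simp] = bihom_closed[OF cross_bihom]
  and cross_left [simp] = bihom_left[OF cross_bihom]
  and cross_right [simp] = bihom_right[OF cross_bihom]
  and cross_inv_left [simp] = bihom_inv_left[OF cross_bihom e.is_group e.is_group ee.is_group]
  and cross_inv_right [simp] = bihom_inv_right[OF cross_bihom e.is_group e.is_group ee.is_group]

lemmas cross_P [simp] = cross_P_left cross_P_right

lemma H_mult:
  assumes "x \<in> carrier (sq_e M)" "y \<in> carrier (sq_e M)"
  shows "sq_H M (x \<otimes>\<^bsub>sq_e M\<^esub> y) = sq_H M x \<otimes>\<^bsub>sq_ee M\<^esub> sq_H M y \<otimes>\<^bsub>sq_ee M\<^esub> sq_cross M x y"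
  using assms unfolding sq_cross_def cross_effect_def
  by - (rule rep_eqI, (rule reps | rule rep_atom, simp; fail)+,
      simp add: algebra_simps)

lemma H_P_mult:
  assumes "x \<in> carrier (sq_e M)" "a \<in> carrier (sq_ee M)"
  shows "sq_H M (x \<otimes>\<^bsub>sq_e M\<^esub> sq_P M a) = sq_H M x \<otimes>\<^bsub>sq_ee M\<^esub> sq_H M (sq_P M a)"
  using assms by (simp add: H_mult)

lemma T_closed [simp]: "a \<in> carrier (sq_ee M) \<Longrightarrow> sq_T M a \<in> carrier (sq_ee M)"
  by (simp add: sq_T_def)

lemma H_P: "a \<in> carrier (sq_ee M) \<Longrightarrow> sq_H M (sq_P M a) = sq_T M a \<otimes>\<^bsub>sq_ee M\<^esub> a"
  by (simp add: sq_T_def ee.m_assoc)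

text \<open>\<open>H\<close> is additive on the image of \<open>P\<close>, since the cross-effect
  vanishes there.\<close>

lemma T_mult [simp]:
  assumes "a \<in> carrier (sq_ee M)" "b \<in> carrier (sq_ee M)"
  shows "sq_T M (a \<otimes>\<^bsub>sq_ee M\<^esub> b) = sq_T M a \<otimes>\<^bsub>sq_ee M\<^esub> sq_T M b"
  using assms unfolding sq_T_def
  by (simp add: H_P_mult)
    (rule rep_eqI, (rule reps | rule rep_atom, simp; fail)+, simp add: algebra_simps)

sublocale T: group_hom "sq_ee M" "sq_ee M" "sq_T M"
  by (simp add: group_hom_def group_hom_axioms_def ee.is_group homI)

text \<open>Immediate from \<open>P H P = 2 P\<close> and \<open>T = H P - 1\<close>.\<close>

lemma P_T [simp]:
  assumes "a \<in> carrier (sq_ee M)"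
  shows "sq_P M (sq_T M a) = sq_P M a"
proof -
  have "sq_P M (sq_T M a) = sq_P M a [^]\<^bsub>sq_e M\<^esub> (2::nat) \<otimes>\<^bsub>sq_e M\<^esub> inv\<^bsub>sq_e M\<^esub> sq_P M a"
    using assms by (simp add: sq_T_def PHP)
  then show ?thesis using assms by (simp add: numeral_2_eq_2 e.m_assoc)
qed

lemma T_T [simp]:
  assumes "a \<in> carrier (sq_ee M)"
  shows "sq_T M (sq_T M a) = a"
proof -
  have "sq_T M (sq_T M a) = sq_H M (sq_P M a) \<otimes>\<^bsub>sq_ee M\<^esub> inv\<^bsub>sq_ee M\<^esub> sq_T M a"
    using assms by (subst sq_T_def) simp
  also have "\<dots> = sq_T M a \<otimes>\<^bsub>sq_ee M\<^esub> a \<otimes>\<^bsub>sq_ee M\<^esub> inv\<^bsub>sq_ee M\<^esub> sq_T M a"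
    using assms by (simp add: H_P)
  also have "\<dots> = a"
    using assms
    by - (rule rep_eqI, (rule reps | rule rep_atom, simp; fail)+,
        simp add: algebra_simps)
  finally show ?thesis .
qed

text \<open>The axiom on \<open>P (x|y)\<close> solved for the product: exchanging two factors costs
  a central term. All later reorderings in an e-level use this form.\<close>

lemma commutation:
  assumes "x \<in> carrier (sq_e M)" "y \<in> carrier (sq_e M)"
  shows "x \<otimes>\<^bsub>sq_e M\<^esub> y = y \<otimes>\<^bsub>sq_e M\<^esub> x \<otimes>\<^bsub>sq_e M\<^esub> sq_P M (sq_cross M x y)"
proof -
  have "y \<otimes>\<^bsub>sq_e M\<^esub> x \<otimes>\<^bsub>sq_e M\<^esub> (inv\<^bsub>sq_e M\<^esub> x \<otimes>\<^bsub>sq_e M\<^esub> inv\<^bsub>sq_e M\<^esub> y \<otimes>\<^bsub>sq_e M\<^esub> x \<otimes>\<^bsub>sq_e M\<^esub> y) =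
      x \<otimes>\<^bsub>sq_e M\<^esub> y"
    using assms by (simp add: e.m_assoc e.inv_solve_left flip: e.m_assoc[of x "inv\<^bsub>sq_e M\<^esub> x"]
        e.m_assoc[of y "inv\<^bsub>sq_e M\<^esub> y"])
  then show ?thesis using P_cross[OF assms] by simp
qed

lemma P_central: "a \<in> carrier (sq_ee M) \<Longrightarrow> central (sq_e M) (sq_P M a)"
  by (simp add: central_def commutation[of _ "sq_P M a"])

text \<open>Apply \<open>H\<close> to both sides of \<open>commutation\<close>. As
  \<open>H P (x|y) = T (x|y) + (x|y)\<close>, comparing the two expansions leaves
  \<open>T (x|y) = - (y|x)\<close>.\<close>

lemma T_cross [simp]:
  assumes "x \<in> carrier (sq_e M)" "y \<in> carrier (sq_e M)"
  shows "sq_T M (sq_cross M x y) = inv\<^bsub>sq_ee M\<^esub> sq_cross M y x"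
proof -
  have "sq_H M (x \<otimes>\<^bsub>sq_e M\<^esub> y) =
    sq_H M (y \<otimes>\<^bsub>sq_e M\<^esub> x) \<otimes>\<^bsub>sq_ee M\<^esub> sq_H M (sq_P M (sq_cross M x y))"
    by (subst commutation[OF assms]) (simp add: assms H_P_mult)
  then have eq: "sq_H M x \<otimes>\<^bsub>sq_ee M\<^esub> sq_H M y \<otimes>\<^bsub>sq_ee M\<^esub> sq_cross M x y =
    sq_H M y \<otimes>\<^bsub>sq_ee M\<^esub> sq_H M x \<otimes>\<^bsub>sq_ee M\<^esub> sq_cross M y x \<otimes>\<^bsub>sq_ee M\<^esub>
      (sq_T M (sq_cross M x y) \<otimes>\<^bsub>sq_ee M\<^esub> sq_cross M x y)"
    using assms by (simp add: H_mult H_P)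
  have "inv\<^bsub>sq_ee M\<^esub> sq_cross M y x = inv\<^bsub>sq_ee M\<^esub> sq_cross M y x \<otimes>\<^bsub>sq_ee M\<^esub>
      ((sq_H M y \<otimes>\<^bsub>sq_ee M\<^esub> sq_H M x \<otimes>\<^bsub>sq_ee M\<^esub> sq_cross M y x \<otimes>\<^bsub>sq_ee M\<^esub>
      (sq_T M (sq_cross M x y) \<otimes>\<^bsub>sq_ee M\<^esub> sq_cross M x y)) \<otimes>\<^bsub>sq_ee M\<^esub> inv\<^bsub>sq_ee M\<^esub>
      (sq_H M x \<otimes>\<^bsub>sq_ee M\<^esub> sq_H M y \<otimes>\<^bsub>sq_ee M\<^esub> sq_cross M x y))"
    unfolding eq[symmetric] using assms by simp
  also have "\<dots> = sq_T M (sq_cross M x y)"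
    using assms
    by - (rule rep_eqI, (rule reps | rule rep_atom, simp; fail)+,
        simp add: algebra_simps)
  finally show ?thesis by simp
qed

lemma Delta_closed [simp]: "x \<in> carrier (sq_e M) \<Longrightarrow> sq_Delta M x \<in> carrier (sq_ee M)"
  by (simp add: sq_Delta_def)

text \<open>Substitute \<open>H P H = T H + H\<close> and \<open>H(x + x) = 2 H(x) + (x|x)\<close>
  into the definition.\<close>

lemma Delta_eq:
  assumes "x \<in> carrier (sq_e M)"
  shows "sq_Delta M x =
    sq_T M (sq_H M x) \<otimes>\<^bsub>sq_ee M\<^esub> inv\<^bsub>sq_ee M\<^esub> sq_H M x \<otimes>\<^bsub>sq_ee M\<^esub> sq_cross M x x"
  using assms unfolding sq_Delta_def
  by (simp add: H_P H_mult numeral_eq_Suc)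
    (rule rep_eqI, (rule reps | rule rep_atom, simp; fail)+, simp add: algebra_simps)

text \<open>The quadratic defects cancel: \<open>T H - H\<close> contributes
  \<open>- (y|x) - (x|y)\<close> by \<open>T_cross\<close>, and the diagonal term contributes
  \<open>(x|y) + (y|x)\<close>.\<close>

lemma Delta_mult [simp]:
  assumes "x \<in> carrier (sq_e M)" "y \<in> carrier (sq_e M)"
  shows "sq_Delta M (x \<otimes>\<^bsub>sq_e M\<^esub> y) = sq_Delta M x \<otimes>\<^bsub>sq_ee M\<^esub> sq_Delta M y"
  using assms
  by (simp add: Delta_eq H_mult)
    (rule rep_eqI, (rule reps | rule rep_atom, simp; fail)+, simp add: algebra_simps)

sublocale Delta: group_hom "sq_e M" "sq_ee M" "sq_Delta M"
  by (simp add: group_hom_def group_hom_axioms_def ee.is_group e.is_group homI)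

lemma Delta_P [simp]:
  assumes "a \<in> carrier (sq_ee M)"
  shows "sq_Delta M (sq_P M a) = \<one>\<^bsub>sq_ee M\<^esub>"
  using assms
  by (simp add: Delta_eq H_P)
    (rule rep_eqI, (rule reps | rule rep_atom, simp; fail)+, simp add: algebra_simps)

lemma T_Delta [simp]:
  assumes "x \<in> carrier (sq_e M)"
  shows "sq_T M (sq_Delta M x) = inv\<^bsub>sq_ee M\<^esub> sq_Delta M x"
  using assms
  by (simp add: Delta_eq)
    (rule rep_eqI, (rule reps | rule rep_atom, simp; fail)+, simp add: algebra_simps)

end

section \<open>Central twisted products\<close>

text \<open>The extension with cocycle \<open>\<psi>\<close>. A section
  \<open>u \<mapsto> (u, F u)\<close> is a homomorphism exactly when \<open>F\<close> is
  multiplicative up to \<open>\<psi>\<close>, so nonadditive maps \<open>F\<close> become accessible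
  to the universal property of a presentation.\<close>

definition twisted :: "'u monoid \<Rightarrow> 'l monoid \<Rightarrow> ('u \<Rightarrow> 'u \<Rightarrow> 'l) \<Rightarrow> ('u \<times> 'l) monoid"
  where "twisted U L \<psi> = \<lparr>carrier = carrier U \<times> carrier L,
    monoid.mult = (\<lambda>(u, g) (v, h). (u \<otimes>\<^bsub>U\<^esub> v, g \<otimes>\<^bsub>L\<^esub> h \<otimes>\<^bsub>L\<^esub> \<psi> u v)),
    one = (\<one>\<^bsub>U\<^esub>, \<one>\<^bsub>L\<^esub>)\<rparr>"

lemma twisted_simps [simp]:
  "carrier (twisted U L \<psi>) = carrier U \<times> carrier L"
  "(u, g) \<otimes>\<^bsub>twisted U L \<psi>\<^esub> (v, h) = (u \<otimes>\<^bsub>U\<^esub> v, g \<otimes>\<^bsub>L\<^esub> h \<otimes>\<^bsub>L\<^esub> \<psi> u v)"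
  "\<one>\<^bsub>twisted U L \<psi>\<^esub> = (\<one>\<^bsub>U\<^esub>, \<one>\<^bsub>L\<^esub>)"
  by (simp_all add: twisted_def)

text \<open>Associativity is the cocycle identity, which holds for every bilinear
  \<open>\<psi>\<close>; centrality lets the values of \<open>\<psi>\<close> move past elements of
  \<open>L\<close>.\<close>

lemma group_twisted:
  assumes "group U" "group L" and \<psi>: "bihom U U L \<psi>"
    and c: "\<And>u v. \<lbrakk>u \<in> carrier U; v \<in> carrier U\<rbrakk> \<Longrightarrow> central L (\<psi> u v)"
  shows "group (twisted U L \<psi>)"
proof -
  interpret U: group U by fact
  interpret L: group L by fact
  note [simp] = bihom_closed[OF \<psi>] bihom_left[OF \<psi>] bihom_right[OF \<psi>]
    bihom_one_left[OF \<psi> \<open>group U\<close> \<open>group U\<close> \<open>group L\<close>]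
    bihom_one_right[OF \<psi> \<open>group U\<close> \<open>group U\<close> \<open>group L\<close>]
  note com = L.central_commute[OF c]
  show ?thesis
  proof (rule groupI)
    fix x y z assume "x \<in> carrier (twisted U L \<psi>)" "y \<in> carrier (twisted U L \<psi>)"
      "z \<in> carrier (twisted U L \<psi>)"
    then obtain u g v h w k where xyz: "x = (u, g)" "y = (v, h)" "z = (w, k)"
      and mem: "u \<in> carrier U" "v \<in> carrier U" "w \<in> carrier U"
        "g \<in> carrier L" "h \<in> carrier L" "k \<in> carrier L"
      by auto
    have "g \<otimes>\<^bsub>L\<^esub> h \<otimes>\<^bsub>L\<^esub> \<psi> u v \<otimes>\<^bsub>L\<^esub> k \<otimes>\<^bsub>L\<^esub> (\<psi> u w \<otimes>\<^bsub>L\<^esub> \<psi> v w) =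
      g \<otimes>\<^bsub>L\<^esub> h \<otimes>\<^bsub>L\<^esub> (\<psi> u v \<otimes>\<^bsub>L\<^esub> (k \<otimes>\<^bsub>L\<^esub> (\<psi> u w \<otimes>\<^bsub>L\<^esub> \<psi> v w)))"
      using mem by (simp add: L.m_assoc)
    also have "\<dots> = g \<otimes>\<^bsub>L\<^esub> h \<otimes>\<^bsub>L\<^esub> (k \<otimes>\<^bsub>L\<^esub> (\<psi> u w \<otimes>\<^bsub>L\<^esub> \<psi> v w) \<otimes>\<^bsub>L\<^esub> \<psi> u v)"
      using mem by (subst com) simp_all
    also have "\<dots> = g \<otimes>\<^bsub>L\<^esub> (h \<otimes>\<^bsub>L\<^esub> k \<otimes>\<^bsub>L\<^esub> (\<psi> v w \<otimes>\<^bsub>L\<^esub> (\<psi> u v \<otimes>\<^bsub>L\<^esub> \<psi> u w)))"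
      using mem com[of u w "\<psi> v w \<otimes>\<^bsub>L\<^esub> \<psi> u v"] by (simp add: L.m_assoc)
    finally show "x \<otimes>\<^bsub>twisted U L \<psi>\<^esub> y \<otimes>\<^bsub>twisted U L \<psi>\<^esub> z =
        x \<otimes>\<^bsub>twisted U L \<psi>\<^esub> (y \<otimes>\<^bsub>twisted U L \<psi>\<^esub> z)"
      using mem by (simp add: xyz U.m_assoc L.m_assoc)
  next
    fix x assume "x \<in> carrier (twisted U L \<psi>)"
    then obtain u g where x: "x = (u, g)" and mem: "u \<in> carrier U" "g \<in> carrier L" by auto
    \<comment> \<open>The second component absorbs the twist \<open>\<psi>\<close> between the
      inverse of \<open>u\<close> and \<open>u\<close>.\<close>
    let ?y = "(inv\<^bsub>U\<^esub> u, inv\<^bsub>L\<^esub> (g \<otimes>\<^bsub>L\<^esub> \<psi> (inv\<^bsub>U\<^esub> u) u))"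
    have "?y \<otimes>\<^bsub>twisted U L \<psi>\<^esub> x = \<one>\<^bsub>twisted U L \<psi>\<^esub>"
      using mem L.l_inv[of "g \<otimes>\<^bsub>L\<^esub> \<psi> (inv\<^bsub>U\<^esub> u) u"] by (simp add: x L.m_assoc)
    then show "\<exists>y \<in> carrier (twisted U L \<psi>). y \<otimes>\<^bsub>twisted U L \<psi>\<^esub> x = \<one>\<^bsub>twisted U L \<psi>\<^esub>"
      using mem by (intro bexI[of _ ?y]) auto
  qed auto
qed

section \<open>The e-level of the tensor product\<close>

locale sq_pair = M: square_group M + N: square_group N
  for M :: "('a, 'b) sq_grp" and N :: "('c, 'd) sq_grp"
begin

sublocale te: group "tensor_e M N"
  unfolding tensor_e_def by (rule group_presented_group)

sublocale ab: group_pair "sq_ee M" "sq_ee N"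
  by (simp add: group_pair_def M.ee.is_group N.ee.is_group)

lemma gens_simps [simp]:
  "Circ x y \<in> tensor_gens M N \<longleftrightarrow> x \<in> carrier (sq_e M) \<and> y \<in> carrier (sq_e N)"
  "Bar a b \<in> tensor_gens M N \<longleftrightarrow> a \<in> carrier (sq_ee M) \<and> b \<in> carrier (sq_ee N)"
  by (auto simp: tensor_gens_def)

lemma circ_closed [simp]:
  "\<lbrakk>x \<in> carrier (sq_e M); y \<in> carrier (sq_e N)\<rbrakk> \<Longrightarrow> circ M N x y \<in> carrier (tensor_e M N)"
  unfolding circ_def tensor_e_def by (rule pres_class_closed) simp

lemma bar_closed [simp]:
  "\<lbrakk>a \<in> carrier (sq_ee M); b \<in> carrier (sq_ee N)\<rbrakk> \<Longrightarrow> bar M N a b \<in> carrier (tensor_e M N)"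
  unfolding bar_def tensor_e_def by (rule pres_class_closed) simp

abbreviation "te_gens \<equiv> {circ M N x y |x y. x \<in> carrier (sq_e M) \<and> y \<in> carrier (sq_e N)} \<union>
    {bar M N a b |a b. a \<in> carrier (sq_ee M) \<and> b \<in> carrier (sq_ee N)}"

lemma te_generated: "carrier (tensor_e M N) = generate (tensor_e M N) te_gens"
proof -
  have "(\<lambda>g. pres_class (tensor_gens M N) (tensor_rels M N) (pos_word [g])) ` tensor_gens M N = te_gens"
    by (auto simp: tensor_gens_def circ_def bar_def)
  then show ?thesis
    using presented_group_generated[of "tensor_gens M N" "tensor_rels M N"]
    unfolding tensor_e_def by simp
qed

lemma te_gens_closed: "te_gens \<subseteq> carrier (tensor_e M N)"
  by auto

lemma class_Cons:
  assumes "g \<in> tensor_gens M N" "l # w \<in> lists (UNIV \<times> tensor_gens M N)"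
  shows "pres_class (tensor_gens M N) (tensor_rels M N) ((True, g) # l # w) =
    pres_class (tensor_gens M N) (tensor_rels M N) [(True, g)] \<otimes>\<^bsub>tensor_e M N\<^esub>
    pres_class (tensor_gens M N) (tensor_rels M N) (l # w)"
proof -
  have "[(True, g)] \<in> lists (UNIV \<times> tensor_gens M N)" using assms(1) by simp
  from mult_presented_group[OF this assms(2)] show ?thesis by (simp add: tensor_e_def)
qed

lemmas class_rel = presented_group_rel[where X = "tensor_gens M N" and R = "tensor_rels M N"]

lemma bar_left:
  assumes "a \<in> carrier (sq_ee M)" "a' \<in> carrier (sq_ee M)" "b \<in> carrier (sq_ee N)"
  shows "bar M N (a \<otimes>\<^bsub>sq_ee M\<^esub> a') b = bar M N a b \<otimes>\<^bsub>tensor_e M N\<^esub> bar M N a' b"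
  using class_rel[OF tensor_rels.bar_left[OF assms]] assms
  by (simp add: bar_def class_Cons)

lemma bar_right:
  assumes "a \<in> carrier (sq_ee M)" "b \<in> carrier (sq_ee N)" "b' \<in> carrier (sq_ee N)"
  shows "bar M N a (b \<otimes>\<^bsub>sq_ee N\<^esub> b') = bar M N a b \<otimes>\<^bsub>tensor_e M N\<^esub> bar M N a b'"
  using class_rel[OF tensor_rels.bar_right[OF assms]] assms
  by (simp add: bar_def class_Cons)

lemma circ_right:
  assumes "x \<in> carrier (sq_e M)" "y1 \<in> carrier (sq_e N)" "y2 \<in> carrier (sq_e N)"
  shows "circ M N x (y1 \<otimes>\<^bsub>sq_e N\<^esub> y2) = circ M N x y1 \<otimes>\<^bsub>tensor_e M N\<^esub> circ M N x y2"
  using class_rel[OF tensor_rels.circ_right[OF assms]] assms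
  by (simp add: circ_def class_Cons)

lemma circ_left:
  assumes "x1 \<in> carrier (sq_e M)" "x2 \<in> carrier (sq_e M)" "y \<in> carrier (sq_e N)"
  shows "circ M N (x1 \<otimes>\<^bsub>sq_e M\<^esub> x2) y = circ M N x1 y \<otimes>\<^bsub>tensor_e M N\<^esub> circ M N x2 y
    \<otimes>\<^bsub>tensor_e M N\<^esub> bar M N (sq_cross M x2 x1) (sq_H N y)"
proof -
  have "circ M N (x1 \<otimes>\<^bsub>sq_e M\<^esub> x2) y = circ M N x1 y \<otimes>\<^bsub>tensor_e M N\<^esub> (circ M N x2 y
    \<otimes>\<^bsub>tensor_e M N\<^esub> bar M N (sq_cross M x2 x1) (sq_H N y))"
    using class_rel[OF tensor_rels.circ_left[OF assms]] assms
    by (simp add: circ_def bar_def class_Cons)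
  then show ?thesis using assms by (simp add: te.m_assoc)
qed

lemma circ_P:
  assumes "x \<in> carrier (sq_e M)" "b \<in> carrier (sq_ee N)"
  shows "circ M N x (sq_P N b) = bar M N (sq_cross M x x) b"
  using class_rel[OF tensor_rels.circ_P[OF assms]] assms by (simp add: circ_def bar_def)

lemma P_circ:
  assumes "a \<in> carrier (sq_ee M)" "y \<in> carrier (sq_e N)"
  shows "circ M N (sq_P M a) y = bar M N a (sq_Delta N y)"
  using class_rel[OF tensor_rels.P_circ[OF assms]] assms by (simp add: circ_def bar_def)

lemma T_bar_T:
  assumes "a \<in> carrier (sq_ee M)" "b \<in> carrier (sq_ee N)"
  shows "bar M N (sq_T M a) (sq_T N b) = inv\<^bsub>tensor_e M N\<^esub> bar M N a b"
proof -
  have "bar M N (sq_T M a) (sq_T N b) =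
      pres_class (tensor_gens M N) (tensor_rels M N) [(False, Bar a b)]"
    using class_rel[OF tensor_rels.T_bar_T[OF assms]] assms by (simp add: bar_def)
  moreover have "pres_class (tensor_gens M N) (tensor_rels M N) [(False, Bar a b)]
      \<otimes>\<^bsub>tensor_e M N\<^esub> bar M N a b = \<one>\<^bsub>tensor_e M N\<^esub>"
    using pres_eq.cancel[of "Bar a b" "tensor_gens M N" "tensor_rels M N" False] assms
    unfolding bar_def tensor_e_def
    by (simp add: mult_presented_group one_presented_group pres_class_eq_iff)
  moreover have "pres_class (tensor_gens M N) (tensor_rels M N) [(False, Bar a b)]
      \<in> carrier (tensor_e M N)"
    unfolding tensor_e_def using assms by (intro pres_class_closed) simp
  ultimately show ?thesis using assms by (metis te.inv_equality bar_closed)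
qed

lemma bar_bihom: "bihom (sq_ee M) (sq_ee N) (tensor_e M N) (bar M N)"
  by (rule bihomI) (simp_all add: bar_left bar_right)

text \<open>The presentation only imposes commutation with generators; it extends to inverses by
  conjugation and to products step by step.\<close>

lemma bar_central:
  assumes "a \<in> carrier (sq_ee M)" "b \<in> carrier (sq_ee N)"
  shows "central (tensor_e M N) (bar M N a b)"
proof -
  have gen: "bar M N a b \<otimes>\<^bsub>tensor_e M N\<^esub> s = s \<otimes>\<^bsub>tensor_e M N\<^esub> bar M N a b" if "s \<in> te_gens" for s
  proof -
    obtain g where g: "g \<in> tensor_gens M N"
      "s = pres_class (tensor_gens M N) (tensor_rels M N) (pos_word [g])"
    proof -
      from \<open>s \<in> te_gens\<close> consider
        (c) x y where "x \<in> carrier (sq_e M)" "y \<in> carrier (sq_e N)" "s = circ M N x y"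
        | (b) a b where "a \<in> carrier (sq_ee M)" "b \<in> carrier (sq_ee N)" "s = bar M N a b"
        by blast
      then show thesis
      proof cases
        case c
        then show ?thesis using that[of "Circ x y"] by (simp add: circ_def)
      next
        case b
        then show ?thesis using that[of "Bar a b"] by (simp add: bar_def)
      qed
    qed
    show ?thesis
      using class_rel[OF tensor_rels.bar_central[OF assms g(1)]] assms g
      by (simp add: bar_def class_Cons)
  qed
  have "u \<otimes>\<^bsub>tensor_e M N\<^esub> bar M N a b = bar M N a b \<otimes>\<^bsub>tensor_e M N\<^esub> u"
    if "u \<in> generate (tensor_e M N) te_gens" for u
    using that
  proof induction
    case (inv s)
    have s: "s \<in> carrier (tensor_e M N)" using inv te_gens_closed by blast
    have "inv\<^bsub>tensor_e M N\<^esub> s \<otimes>\<^bsub>tensor_e M N\<^esub> (bar M N a b \<otimes>\<^bsub>tensor_e M N\<^esub> s)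
        \<otimes>\<^bsub>tensor_e M N\<^esub> inv\<^bsub>tensor_e M N\<^esub> s =
      inv\<^bsub>tensor_e M N\<^esub> s \<otimes>\<^bsub>tensor_e M N\<^esub> (s \<otimes>\<^bsub>tensor_e M N\<^esub> bar M N a b)
        \<otimes>\<^bsub>tensor_e M N\<^esub> inv\<^bsub>tensor_e M N\<^esub> s"
      using gen[OF inv] by simp
    then show ?case
      using s assms by (simp add: te.m_assoc te.inv_solve_left')
  next
    case (eng u v)
    then have uv: "u \<in> carrier (tensor_e M N)" "v \<in> carrier (tensor_e M N)"
      unfolding te_generated by auto
    have "u \<otimes>\<^bsub>tensor_e M N\<^esub> v \<otimes>\<^bsub>tensor_e M N\<^esub> bar M N a b = u \<otimes>\<^bsub>tensor_e M N\<^esub> bar M N a b \<otimes>\<^bsub>tensor_e M N\<^esub> v"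
      using eng.IH(2) uv assms by (simp add: te.m_assoc)
    then show ?case using eng.IH(1) uv assms by (simp add: te.m_assoc)
  qed (use assms gen in auto)
  then show ?thesis using assms te_generated by (auto simp: central_def)
qed

text \<open>The relations are verified in the twisted product of \<open>tensor_e M N\<close> with
  \<open>L\<close>. Since \<open>\<psi>\<close> vanishes against \<open>bar\<close> elements,
  relations (1), (4), (5), (6) keep their form, and only (2) and (3) acquire a factor
  \<open>\<psi>\<close>.\<close>

lemma tensor_e_twisted:
  fixes L :: "'l monoid"
  assumes "group L"
    and \<psi>: "bihom (tensor_e M N) (tensor_e M N) L \<psi>"
    and \<psi>_central: "\<And>u v. \<lbrakk>u \<in> carrier (tensor_e M N); v \<in> carrier (tensor_e M N)\<rbrakk>
      \<Longrightarrow> central L (\<psi> u v)"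
    and \<psi>_bar: "\<And>a b u. \<lbrakk>a \<in> carrier (sq_ee M); b \<in> carrier (sq_ee N); u \<in> carrier (tensor_e M N)\<rbrakk>
      \<Longrightarrow> \<psi> (bar M N a b) u = \<one>\<^bsub>L\<^esub> \<and> \<psi> u (bar M N a b) = \<one>\<^bsub>L\<^esub>"
    and f: "\<And>x y. \<lbrakk>x \<in> carrier (sq_e M); y \<in> carrier (sq_e N)\<rbrakk> \<Longrightarrow> f x y \<in> carrier L"
    and g: "bihom (sq_ee M) (sq_ee N) L g"
    and g_central: "\<And>a b. \<lbrakk>a \<in> carrier (sq_ee M); b \<in> carrier (sq_ee N)\<rbrakk> \<Longrightarrow> central L (g a b)"
    and f_right: "\<And>x y1 y2. \<lbrakk>x \<in> carrier (sq_e M); y1 \<in> carrier (sq_e N); y2 \<in> carrier (sq_e N)\<rbrakk>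
      \<Longrightarrow> f x (y1 \<otimes>\<^bsub>sq_e N\<^esub> y2) =
        f x y1 \<otimes>\<^bsub>L\<^esub> f x y2 \<otimes>\<^bsub>L\<^esub> \<psi> (circ M N x y1) (circ M N x y2)"
    and f_left: "\<And>x1 x2 y. \<lbrakk>x1 \<in> carrier (sq_e M); x2 \<in> carrier (sq_e M); y \<in> carrier (sq_e N)\<rbrakk>
      \<Longrightarrow> f (x1 \<otimes>\<^bsub>sq_e M\<^esub> x2) y = f x1 y \<otimes>\<^bsub>L\<^esub> f x2 y
        \<otimes>\<^bsub>L\<^esub> \<psi> (circ M N x1 y) (circ M N x2 y) \<otimes>\<^bsub>L\<^esub> g (sq_cross M x2 x1) (sq_H N y)"
    and f_P: "\<And>x b. \<lbrakk>x \<in> carrier (sq_e M); b \<in> carrier (sq_ee N)\<rbrakk>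
      \<Longrightarrow> f x (sq_P N b) = g (sq_cross M x x) b"
    and P_f: "\<And>a y. \<lbrakk>a \<in> carrier (sq_ee M); y \<in> carrier (sq_e N)\<rbrakk>
      \<Longrightarrow> f (sq_P M a) y = g a (sq_Delta N y)"
    and T_g_T: "\<And>a b. \<lbrakk>a \<in> carrier (sq_ee M); b \<in> carrier (sq_ee N)\<rbrakk>
      \<Longrightarrow> g (sq_T M a) (sq_T N b) = inv\<^bsub>L\<^esub> g a b"
  obtains F where "\<And>u. u \<in> carrier (tensor_e M N) \<Longrightarrow> F u \<in> carrier L"
    "\<And>u v. \<lbrakk>u \<in> carrier (tensor_e M N); v \<in> carrier (tensor_e M N)\<rbrakk>
      \<Longrightarrow> F (u \<otimes>\<^bsub>tensor_e M N\<^esub> v) = F u \<otimes>\<^bsub>L\<^esub> F v \<otimes>\<^bsub>L\<^esub> \<psi> u v"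
    "\<And>x y. \<lbrakk>x \<in> carrier (sq_e M); y \<in> carrier (sq_e N)\<rbrakk> \<Longrightarrow> F (circ M N x y) = f x y"
    "\<And>a b. \<lbrakk>a \<in> carrier (sq_ee M); b \<in> carrier (sq_ee N)\<rbrakk> \<Longrightarrow> F (bar M N a b) = g a b"
proof -
  interpret L: group L by fact
  note rels = bar_left bar_right circ_right circ_left circ_P P_circ T_bar_T
    and bars_central = bar_central
  define W where "W = twisted (tensor_e M N) L \<psi>"
  interpret W: group W
    unfolding W_def by (rule group_twisted[OF te.is_group \<open>group L\<close> \<psi> \<psi>_central])
  note [simp] = bihom_closed[OF \<psi>] bihom_left[OF \<psi>] bihom_right[OF \<psi>]
    bihom_one_left[OF \<psi> te.is_group te.is_group \<open>group L\<close>]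
    bihom_one_right[OF \<psi> te.is_group te.is_group \<open>group L\<close>]
    \<psi>_bar f bihom_closed[OF g]
  have W_simps [simp]: "carrier W = carrier (tensor_e M N) \<times> carrier L"
    "\<one>\<^bsub>W\<^esub> = (\<one>\<^bsub>tensor_e M N\<^esub>, \<one>\<^bsub>L\<^esub>)"
    "\<And>u g v h. (u, g) \<otimes>\<^bsub>W\<^esub> (v, h) = (u \<otimes>\<^bsub>tensor_e M N\<^esub> v, g \<otimes>\<^bsub>L\<^esub> h \<otimes>\<^bsub>L\<^esub> \<psi> u v)"
    by (simp_all add: W_def)
  \<comment> \<open>Each generator is paired with its own class, so that the induced homomorphism is
    a section of the first projection.\<close>
  define \<phi> where "\<phi> s = (case s of Circ x y \<Rightarrow> (circ M N x y, f x y) | Bar a b \<Rightarrow> (bar M N a b, g a b))"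
    for s
  have \<phi>_simps [simp]: "\<phi> (Circ x y) = (circ M N x y, f x y)" "\<phi> (Bar a b) = (bar M N a b, g a b)"
    for x y a b by (simp_all add: \<phi>_def)
  have inv_bar: "inv\<^bsub>W\<^esub> (bar M N a b, g a b) = (inv\<^bsub>tensor_e M N\<^esub> bar M N a b, inv\<^bsub>L\<^esub> g a b)"
    if "a \<in> carrier (sq_ee M)" "b \<in> carrier (sq_ee N)" for a b
    by (rule W.inv_equality) (use that in simp_all)
  obtain h where h: "h \<in> hom (tensor_e M N) W"
    "\<And>s. s \<in> tensor_gens M N \<Longrightarrow>
      h (pres_class (tensor_gens M N) (tensor_rels M N) (pos_word [s])) = \<phi> s"
    unfolding tensor_e_def
  proof (rule presented_group_universal[OF W.is_group])
    show "\<phi> \<in> tensor_gens M N \<rightarrow> carrier W"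
      by (auto simp: tensor_gens_def)
    fix u v assume "(u, v) \<in> tensor_rels M N"
    then show "word_val W \<phi> u = word_val W \<phi> v"
    proof cases
      case (bar_left a a' b)
      then show ?thesis by (simp add: rels bihom_left[OF g])
    next
      case (bar_right a b b')
      then show ?thesis by (simp add: rels bihom_right[OF g])
    next
      case (bar_central a b s)
      have "\<phi> s \<in> carrier W" using bar_central(5) by (auto simp: tensor_gens_def)
      then obtain w k where s: "\<phi> s = (w, k)" "w \<in> carrier (tensor_e M N)" "k \<in> carrier L" by auto
      show ?thesis
        using bar_central s te.central_commute[OF bars_central, of a b w]
          L.central_commute[OF g_central, of a b k] by simp
    next
      case (circ_right x y1 y2)
      then show ?thesis by (simp add: rels f_right)
    next
      case (circ_left x1 x2 y)
      let ?c = "sq_cross M x2 x1"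
      have "f x1 y \<otimes>\<^bsub>L\<^esub> f x2 y \<otimes>\<^bsub>L\<^esub> (\<psi> (circ M N x1 y) (circ M N x2 y) \<otimes>\<^bsub>L\<^esub> g ?c (sq_H N y)) =
        f x1 y \<otimes>\<^bsub>L\<^esub> f x2 y \<otimes>\<^bsub>L\<^esub> (g ?c (sq_H N y) \<otimes>\<^bsub>L\<^esub> \<psi> (circ M N x1 y) (circ M N x2 y))"
        using circ_left by (subst L.central_commute[OF \<psi>_central]) simp_all
      then show ?thesis
        using circ_left by (simp add: rels f_left L.m_assoc te.m_assoc)
    next
      case (circ_P x b)
      then show ?thesis by (simp add: rels f_P)
    next
      case (P_circ a y)
      then show ?thesis by (simp add: rels P_f)
    next
      case (T_bar_T a b)
      then show ?thesis by (simp add: rels T_g_T inv_bar)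
    qed
  qed blast
  have h_circ: "h (circ M N x y) = (circ M N x y, f x y)"
    if "x \<in> carrier (sq_e M)" "y \<in> carrier (sq_e N)" for x y
    using h(2)[of "Circ x y"] that by (simp add: circ_def)
  have h_bar: "h (bar M N a b) = (bar M N a b, g a b)"
    if "a \<in> carrier (sq_ee M)" "b \<in> carrier (sq_ee N)" for a b
    using h(2)[of "Bar a b"] that by (simp add: bar_def)
  have mem: "h u \<in> carrier (tensor_e M N) \<times> carrier L" if "u \<in> carrier (tensor_e M N)" for u
    using hom_in_carrier[OF h(1) that] by simp
  have mult: "h (u \<otimes>\<^bsub>tensor_e M N\<^esub> v) = (fst (h u) \<otimes>\<^bsub>tensor_e M N\<^esub> fst (h v),
      snd (h u) \<otimes>\<^bsub>L\<^esub> snd (h v) \<otimes>\<^bsub>L\<^esub> \<psi> (fst (h u)) (fst (h v)))"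
    if "u \<in> carrier (tensor_e M N)" "v \<in> carrier (tensor_e M N)" for u v
    using hom_mult[OF h(1) that] by (metis W_simps(3) prod.collapse)
  \<comment> \<open>The first component is an endomorphism fixing all generators, hence the
    identity. Therefore the twist occurring in the second component is \<open>\<psi> u v\<close>
    itself.\<close>
  have fst_h: "fst (h u) = u" if "u \<in> carrier (tensor_e M N)" for u
  proof (rule te.generate_hom_eq[OF te.is_group _ _ te_gens_closed])
    show "(\<lambda>u. fst (h u)) \<in> hom (tensor_e M N) (tensor_e M N)"
      using mem mult by (intro homI) (auto simp: mem_Times_iff)
    show "(\<lambda>u. u) \<in> hom (tensor_e M N) (tensor_e M N)" by (intro homI) auto
    show "u \<in> generate (tensor_e M N) te_gens" using that te_generated by simp
  qed (auto simp: h_circ h_bar)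
  show thesis
  proof (rule that[of "\<lambda>u. snd (h u)"])
    show "snd (h u) \<in> carrier L" if "u \<in> carrier (tensor_e M N)" for u
      using mem[OF that] by (simp add: mem_Times_iff)
    show "snd (h (u \<otimes>\<^bsub>tensor_e M N\<^esub> v)) = snd (h u) \<otimes>\<^bsub>L\<^esub> snd (h v) \<otimes>\<^bsub>L\<^esub> \<psi> u v"
      if "u \<in> carrier (tensor_e M N)" "v \<in> carrier (tensor_e M N)" for u v
      using mult[OF that] fst_h that by simp
  qed (simp_all add: h_circ h_bar)
qed

text \<open>The case of a trivial twist: the ordinary universal property of the
  presentation.\<close>

lemma tensor_e_hom:
  fixes L :: "'l monoid"
  assumes "group L"
    and f: "\<And>x y. \<lbrakk>x \<in> carrier (sq_e M); y \<in> carrier (sq_e N)\<rbrakk> \<Longrightarrow> f x y \<in> carrier L"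
    and g: "bihom (sq_ee M) (sq_ee N) L g"
    and g_central: "\<And>a b. \<lbrakk>a \<in> carrier (sq_ee M); b \<in> carrier (sq_ee N)\<rbrakk> \<Longrightarrow> central L (g a b)"
    and f_right: "\<And>x y1 y2. \<lbrakk>x \<in> carrier (sq_e M); y1 \<in> carrier (sq_e N); y2 \<in> carrier (sq_e N)\<rbrakk>
      \<Longrightarrow> f x (y1 \<otimes>\<^bsub>sq_e N\<^esub> y2) = f x y1 \<otimes>\<^bsub>L\<^esub> f x y2"
    and f_left: "\<And>x1 x2 y. \<lbrakk>x1 \<in> carrier (sq_e M); x2 \<in> carrier (sq_e M); y \<in> carrier (sq_e N)\<rbrakk>
      \<Longrightarrow> f (x1 \<otimes>\<^bsub>sq_e M\<^esub> x2) y = f x1 y \<otimes>\<^bsub>L\<^esub> f x2 y \<otimes>\<^bsub>L\<^esub> g (sq_cross M x2 x1) (sq_H N y)"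
    and f_P: "\<And>x b. \<lbrakk>x \<in> carrier (sq_e M); b \<in> carrier (sq_ee N)\<rbrakk>
      \<Longrightarrow> f x (sq_P N b) = g (sq_cross M x x) b"
    and P_f: "\<And>a y. \<lbrakk>a \<in> carrier (sq_ee M); y \<in> carrier (sq_e N)\<rbrakk>
      \<Longrightarrow> f (sq_P M a) y = g a (sq_Delta N y)"
    and T_g_T: "\<And>a b. \<lbrakk>a \<in> carrier (sq_ee M); b \<in> carrier (sq_ee N)\<rbrakk>
      \<Longrightarrow> g (sq_T M a) (sq_T N b) = inv\<^bsub>L\<^esub> g a b"
  obtains F where "F \<in> hom (tensor_e M N) L"
    "\<And>x y. \<lbrakk>x \<in> carrier (sq_e M); y \<in> carrier (sq_e N)\<rbrakk> \<Longrightarrow> F (circ M N x y) = f x y"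
    "\<And>a b. \<lbrakk>a \<in> carrier (sq_ee M); b \<in> carrier (sq_ee N)\<rbrakk> \<Longrightarrow> F (bar M N a b) = g a b"
proof -
  interpret L: group L by fact
  obtain F where F: "\<And>u. u \<in> carrier (tensor_e M N) \<Longrightarrow> F u \<in> carrier L"
    "\<And>u v. \<lbrakk>u \<in> carrier (tensor_e M N); v \<in> carrier (tensor_e M N)\<rbrakk>
      \<Longrightarrow> F (u \<otimes>\<^bsub>tensor_e M N\<^esub> v) = F u \<otimes>\<^bsub>L\<^esub> F v \<otimes>\<^bsub>L\<^esub> \<one>\<^bsub>L\<^esub>"
    "\<And>x y. \<lbrakk>x \<in> carrier (sq_e M); y \<in> carrier (sq_e N)\<rbrakk> \<Longrightarrow> F (circ M N x y) = f x y"
    "\<And>a b. \<lbrakk>a \<in> carrier (sq_ee M); b \<in> carrier (sq_ee N)\<rbrakk> \<Longrightarrow> F (bar M N a b) = g a b"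
  proof (rule tensor_e_twisted[of L "\<lambda>_ _. \<one>\<^bsub>L\<^esub>" f g])
    show "bihom (tensor_e M N) (tensor_e M N) L (\<lambda>_ _. \<one>\<^bsub>L\<^esub>)" by (rule bihomI) auto
  qed (use assms in \<open>auto simp: L.central_one\<close>)
  show thesis
    by (rule that[of F]) (use F in \<open>auto intro: homI\<close>)
qed

end

section \<open>Words modulo central elements\<close>

text \<open>The analogue of \<^const>\<open>rep\<close> for noncommutative groups: the central factors of a product are
  collected in a formal linear combination, the others in a word.\<close>

definition prep :: "'a monoid \<Rightarrow> 'a \<Rightarrow> 'a list \<Rightarrow> ('a \<Rightarrow>\<^sub>0 int) \<Rightarrow> bool"
  where "prep G x xs p \<longleftrightarrow> set xs \<subseteq> carrier G \<and> Poly_Mapping.keys p \<subseteq> carrier (center G) \<and>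
    x = foldr (\<lambda>y z. y \<otimes>\<^bsub>G\<^esub> z) xs \<one>\<^bsub>G\<^esub> \<otimes>\<^bsub>G\<^esub> lin (center G) p"

lemma lin_center:
  assumes "group G" "Poly_Mapping.keys p \<subseteq> carrier (center G)"
  shows "central G (lin (center G) p)"
  using hom_in_carrier[OF lin_hom(1)[OF group.comm_group_center[OF assms(1)]]] assms(2)
  by (simp add: center_def)

lemma foldr_closed:
  assumes "group G" "set xs \<subseteq> carrier G"
  shows "foldr (\<lambda>y z. y \<otimes>\<^bsub>G\<^esub> z) xs \<one>\<^bsub>G\<^esub> \<in> carrier G"
proof -
  interpret group G by fact
  show ?thesis using assms(2) by (induction xs) auto
qed

lemma prep_mult:
  assumes G: "group G" and x: "prep G x xs p" and y: "prep G y ys q"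
  shows "prep G (x \<otimes>\<^bsub>G\<^esub> y) (xs @ ys) (p + q)"
proof -
  interpret group G by fact
  let ?f = "\<lambda>xs. foldr (\<lambda>y z. y \<otimes>\<^bsub>G\<^esub> z) xs \<one>\<^bsub>G\<^esub>" and ?l = "lin (center G)"
  have xs: "set xs \<subseteq> carrier G" "Poly_Mapping.keys p \<subseteq> carrier (center G)" "x = ?f xs \<otimes>\<^bsub>G\<^esub> ?l p"
    and ys: "set ys \<subseteq> carrier G" "Poly_Mapping.keys q \<subseteq> carrier (center G)" "y = ?f ys \<otimes>\<^bsub>G\<^esub> ?l q"
    using x y by (simp_all add: prep_def)
  have cen: "central G (?l p)" "central G (?l q)" using xs ys G by (simp_all add: lin_center)
  have cl: "?f xs \<in> carrier G" "?f ys \<in> carrier G" "?l p \<in> carrier G" "?l q \<in> carrier G"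
    using xs ys cen foldr_closed[OF G] by (auto simp: central_def)
  have app: "?f (xs @ ys) = ?f xs \<otimes>\<^bsub>G\<^esub> ?f ys"
    using xs(1)
  proof (induction xs)
    case (Cons z zs)
    then show ?case using cl(2) foldr_closed[OF G, of zs] by (simp add: m_assoc)
  qed (use cl in simp)
  have "?l (p + q) = ?l p \<otimes>\<^bsub>G\<^esub> ?l q"
    using hom_mult[OF lin_hom(1)[OF comm_group_center], of p q] xs ys by (simp add: center_def)
  moreover have "?f xs \<otimes>\<^bsub>G\<^esub> ?l p \<otimes>\<^bsub>G\<^esub> (?f ys \<otimes>\<^bsub>G\<^esub> ?l q) = ?f xs \<otimes>\<^bsub>G\<^esub> (?l p \<otimes>\<^bsub>G\<^esub> ?f ys) \<otimes>\<^bsub>G\<^esub> ?l q"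
    using cl by (simp add: m_assoc)
  ultimately have "x \<otimes>\<^bsub>G\<^esub> y = ?f (xs @ ys) \<otimes>\<^bsub>G\<^esub> ?l (p + q)"
    using cl by (simp add: app xs(3) ys(3) central_commute[OF cen(1)] m_assoc del: foldr_append)
  then show ?thesis
    using xs ys keys_add[of p q] by (auto simp: prep_def)
qed

lemma lin_center_zero: "group G \<Longrightarrow> lin (center G) 0 = \<one>\<^bsub>G\<^esub>"
  using rep_one[OF group.comm_group_center, of G] by (simp add: rep_def center_def)

lemma prep_one: "group G \<Longrightarrow> prep G \<one>\<^bsub>G\<^esub> [] 0"
  by (simp add: prep_def lin_center_zero group.is_monoid)

text \<open>This rule accepts every element of \<open>G\<close>, so wherever \<open>prep\<close> is
  derived it is tried after the rules for central factors; otherwise central terms would be frozen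
  inside the word.\<close>

lemma prep_atom: "group G \<Longrightarrow> x \<in> carrier G \<Longrightarrow> prep G x [x] 0"
  by (simp add: prep_def lin_center_zero group.is_monoid)

lemma prep_central:
  assumes "group G" "central G z"
  shows "prep G z [] (frag_of z)"
proof -
  interpret group G by fact
  show ?thesis
    using lin_hom(2)[OF comm_group_center, of z] assms(2) central_closed[OF assms(2)]
    by (simp add: prep_def) (simp add: center_def)
qed

lemma prep_central_inv:
  assumes "group G" "central G z"
  shows "prep G (inv\<^bsub>G\<^esub> z) [] (- frag_of z)"
proof -
  interpret group G by fact
  interpret Z: comm_group "center G" by (rule comm_group_center)
  have z: "z \<in> carrier (center G)" using assms(2) by (simp add: center_def)
  have "inv\<^bsub>center G\<^esub> z = inv\<^bsub>G\<^esub> z"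
    using Z.l_inv[OF z] Z.inv_closed[OF z] central_closed[OF assms(2)]
    by (intro inv_equality[symmetric]) (simp_all add: center_def central_def)
  then have "inv\<^bsub>G\<^esub> z = lin (center G) (- frag_of z)"
    using rep_inv[OF comm_group_center rep_atom[OF comm_group_center z]] by (simp add: rep_def)
  moreover have "inv\<^bsub>G\<^esub> z \<in> carrier G" using central_closed[OF assms(2)] by simp
  ultimately show ?thesis using z by (simp add: prep_def)
qed

lemma prep_eqI: "\<lbrakk>prep G x xs p; prep G y ys q; xs = ys; p = q\<rbrakk> \<Longrightarrow> x = y"
  by (simp add: prep_def)

section \<open>Cokernels\<close>

lemma restrict_hom: "\<lbrakk>group G; h \<in> hom G L\<rbrakk> \<Longrightarrow> restrict h (carrier G) \<in> hom G L"
  by (auto simp: hom_def group.is_monoid monoid.m_closed)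

text \<open>Isolated from square groups because the cokernel of \<open>tensor_P\<close> enters the
  definition of \<open>tensor_H\<close>, and hence precedes the proof that the tensor product is a
  square group.\<close>

locale central_hom = A: group A + E: group E for A :: "'b monoid" and E :: "'a monoid" +
  fixes p :: "'b \<Rightarrow> 'a"
  assumes hom: "p \<in> hom A E" and central: "a \<in> carrier A \<Longrightarrow> central E (p a)"
begin

sublocale p: group_hom A E p
  using hom by (simp add: group_hom_def group_hom_axioms_def A.is_group E.is_group)

lemma image_normal: "p ` carrier A \<lhd> E"
proof -
  have "x \<otimes>\<^bsub>E\<^esub> p a \<otimes>\<^bsub>E\<^esub> inv\<^bsub>E\<^esub> x = p a" if "x \<in> carrier E" "a \<in> carrier A" for x a
    using that central[of a] by (simp add: central_def E.m_assoc)
  then show ?thesis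
    unfolding E.normal_inv_iff using p.img_is_subgroup by auto
qed

sublocale im: normal "p ` carrier A" E by (rule image_normal)

lemma coker_group: "group (coker A E p)"
  unfolding coker_def by (rule im.factorgroup_is_group)

lemma class_hom: "coker_class A E p \<in> hom E (coker A E p)"
  unfolding coker_def using im.r_coset_hom_Mod by (simp add: coker_class_def[abs_def])

sublocale Q: group "coker A E p" by (rule coker_group)

sublocale cls: group_hom E "coker A E p" "coker_class A E p"
  using class_hom by (simp add: group_hom_def group_hom_axioms_def E.is_group Q.is_group)

lemma coker_cases:
  assumes "X \<in> carrier (coker A E p)"
  obtains x where "x \<in> carrier E" "X = coker_class A E p x"
  using assms by (auto simp: coker_def carrier_FactGroup coker_class_def)

lemma class_p: "a \<in> carrier A \<Longrightarrow> coker_class A E p (p a) = \<one>\<^bsub>coker A E p\<^esub>"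
  by (simp add: coker_class_def coker_def E.coset_join2 im.subgroup_axioms)

lemma mem_class: "y \<in> coker_class A E p x \<longleftrightarrow> (\<exists>a \<in> carrier A. y = p a \<otimes>\<^bsub>E\<^esub> x)"
  by (auto simp: coker_class_def r_coset_def)

text \<open>Functions on the cokernel are defined below by picking representatives with
  \<open>SOME\<close>; the picked element differs from any given one by an element of the image of
  \<open>p\<close>.\<close>

lemma some_class:
  assumes "x \<in> carrier E"
  obtains a where "a \<in> carrier A" "(SOME y. y \<in> coker_class A E p x) = p a \<otimes>\<^bsub>E\<^esub> x"
proof -
  have "x = p \<one>\<^bsub>A\<^esub> \<otimes>\<^bsub>E\<^esub> x" using assms by simp
  then have "x \<in> coker_class A E p x" unfolding mem_class by blast
  then show thesis using someI[of "\<lambda>y. y \<in> coker_class A E p x"] that unfolding mem_class by blast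
qed

lemma coker_comm_group:
  assumes "\<And>x y. \<lbrakk>x \<in> carrier E; y \<in> carrier E\<rbrakk> \<Longrightarrow> \<exists>a \<in> carrier A. x \<otimes>\<^bsub>E\<^esub> y = y \<otimes>\<^bsub>E\<^esub> x \<otimes>\<^bsub>E\<^esub> p a"
  shows "comm_group (coker A E p)"
proof (rule Q.group_comm_groupI)
  fix X Y assume "X \<in> carrier (coker A E p)" "Y \<in> carrier (coker A E p)"
  then obtain x y where x: "x \<in> carrier E" "X = coker_class A E p x"
    and y: "y \<in> carrier E" "Y = coker_class A E p y" by (metis coker_cases)
  obtain a where a: "a \<in> carrier A" "x \<otimes>\<^bsub>E\<^esub> y = y \<otimes>\<^bsub>E\<^esub> x \<otimes>\<^bsub>E\<^esub> p a" using assms x y by blast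
  have "coker_class A E p (x \<otimes>\<^bsub>E\<^esub> y) = coker_class A E p (y \<otimes>\<^bsub>E\<^esub> x)"
    unfolding a(2) using x y a(1) by (simp add: class_p)
  then show "X \<otimes>\<^bsub>coker A E p\<^esub> Y = Y \<otimes>\<^bsub>coker A E p\<^esub> X" using x y by simp
qed

end

context square_group
begin

sublocale co: central_hom "sq_ee M" "sq_e M" "sq_P M"
  by unfold_locales (fact P_hom, rule P_central)

lemma coker_comm: "comm_group (sq_coker M)"
  unfolding sq_coker_def by (rule co.coker_comm_group) (blast intro: commutation cross_closed)

sublocale cok: comm_group "sq_coker M" by (rule coker_comm)

lemma class_hom: "sq_coker_class M \<in> hom (sq_e M) (sq_coker M)"
  unfolding sq_coker_def sq_coker_class_def by (rule co.class_hom)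

sublocale cls: group_hom "sq_e M" "sq_coker M" "sq_coker_class M"
  using class_hom by (simp add: group_hom_def group_hom_axioms_def e.is_group cok.is_group)

lemma coker_cases:
  assumes "X \<in> carrier (sq_coker M)"
  obtains x where "x \<in> carrier (sq_e M)" "X = sq_coker_class M x"
  using co.coker_cases assms unfolding sq_coker_def sq_coker_class_def by blast

lemma class_P [simp]: "a \<in> carrier (sq_ee M) \<Longrightarrow> sq_coker_class M (sq_P M a) = \<one>\<^bsub>sq_coker M\<^esub>"
  unfolding sq_coker_def sq_coker_class_def by (rule co.class_p)

definition coker_cross :: "'a set \<Rightarrow> 'a set \<Rightarrow> 'b"
  where "coker_cross X Y = sq_cross M (SOME x. x \<in> X) (SOME y. y \<in> Y)"

text \<open>Independence of the representatives holds because the cross-effect vanishes as soon as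
  one argument lies in the image of \<open>P\<close>.\<close>

lemma coker_cross [simp]:
  assumes "x \<in> carrier (sq_e M)" "y \<in> carrier (sq_e M)"
  shows "coker_cross (sq_coker_class M x) (sq_coker_class M y) = sq_cross M x y"
proof -
  obtain a b where "a \<in> carrier (sq_ee M)" "b \<in> carrier (sq_ee M)"
    "(SOME z. z \<in> sq_coker_class M x) = sq_P M a \<otimes>\<^bsub>sq_e M\<^esub> x"
    "(SOME z. z \<in> sq_coker_class M y) = sq_P M b \<otimes>\<^bsub>sq_e M\<^esub> y"
    using co.some_class assms unfolding sq_coker_class_def by metis
  then show ?thesis using assms by (simp add: coker_cross_def)
qed

lemma coker_cross_bihom: "bihom (sq_coker M) (sq_coker M) (sq_ee M) coker_cross"
proof (rule bihomI)
  fix X Y assume "X \<in> carrier (sq_coker M)" "Y \<in> carrier (sq_coker M)"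
  then show "coker_cross X Y \<in> carrier (sq_ee M)" by (elim coker_cases) simp
next
  fix X X' Y assume "X \<in> carrier (sq_coker M)" "X' \<in> carrier (sq_coker M)" "Y \<in> carrier (sq_coker M)"
  then show "coker_cross (X \<otimes>\<^bsub>sq_coker M\<^esub> X') Y = coker_cross X Y \<otimes>\<^bsub>sq_ee M\<^esub> coker_cross X' Y"
    by (elim coker_cases) (simp flip: cls.hom_mult)
next
  fix X Y Y' assume "X \<in> carrier (sq_coker M)" "Y \<in> carrier (sq_coker M)" "Y' \<in> carrier (sq_coker M)"
  then show "coker_cross X (Y \<otimes>\<^bsub>sq_coker M\<^esub> Y') = coker_cross X Y \<otimes>\<^bsub>sq_ee M\<^esub> coker_cross X Y'"
    by (elim coker_cases) (simp flip: cls.hom_mult)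
qed

end

section \<open>Commutation formulas determined on generators\<close>

lemma (in group) mult_inv_cancel:
  "\<lbrakk>v \<in> carrier G; z \<in> carrier G\<rbrakk> \<Longrightarrow> v \<otimes> (inv v \<otimes> z) = z"
  "\<lbrakk>v \<in> carrier G; z \<in> carrier G\<rbrakk> \<Longrightarrow> inv v \<otimes> (v \<otimes> z) = z"
  by (simp_all flip: m_assoc)

text \<open>For fixed \<open>v\<close>, conjugation by \<open>v\<close> and
  \<open>u \<mapsto> u \<otimes> \<gamma> u\<close> are both homomorphisms, the latter because
  \<open>\<gamma>\<close> is a homomorphism with central values. They agree on \<open>S\<close>,
  hence everywhere.\<close>

lemma (in group) commutation_left_from_generators:
  assumes \<gamma>: "\<gamma> \<in> hom G G" and c: "\<And>u. u \<in> carrier G \<Longrightarrow> central G (\<gamma> u)"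
    and S: "S \<subseteq> carrier G" "carrier G = generate G S"
    and gen: "\<And>s. s \<in> S \<Longrightarrow> s \<otimes> v = v \<otimes> s \<otimes> \<gamma> s"
    and u: "u \<in> carrier G" and v: "v \<in> carrier G"
  shows "u \<otimes> v = v \<otimes> u \<otimes> \<gamma> u"
proof -
  have cl: "x \<in> carrier G \<Longrightarrow> \<gamma> x \<in> carrier G" for x using hom_in_carrier[OF \<gamma>] .
  have "inv v \<otimes> (u \<otimes> v) = u \<otimes> \<gamma> u"
  proof (rule generate_hom_eq[OF is_group _ _ S(1), of "\<lambda>u. inv v \<otimes> (u \<otimes> v)" "\<lambda>u. u \<otimes> \<gamma> u"])
    show "(\<lambda>u. inv v \<otimes> (u \<otimes> v)) \<in> hom G G"
    proof (rule homI)
      fix x y assume "x \<in> carrier G" "y \<in> carrier G"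
      then show "inv v \<otimes> (x \<otimes> y \<otimes> v) = inv v \<otimes> (x \<otimes> v) \<otimes> (inv v \<otimes> (y \<otimes> v))"
        using v by (simp add: m_assoc mult_inv_cancel)
    qed (use v in simp)
    show "(\<lambda>u. u \<otimes> \<gamma> u) \<in> hom G G"
    proof (rule homI)
      fix x y assume xy: "x \<in> carrier G" "y \<in> carrier G"
      then have "x \<otimes> \<gamma> x \<otimes> (y \<otimes> \<gamma> y) = x \<otimes> (\<gamma> x \<otimes> y) \<otimes> \<gamma> y" by (simp add: m_assoc cl)
      also have "\<dots> = x \<otimes> (y \<otimes> \<gamma> x) \<otimes> \<gamma> y" using xy by (simp add: central_commute[OF c])
      finally show "x \<otimes> y \<otimes> \<gamma> (x \<otimes> y) = x \<otimes> \<gamma> x \<otimes> (y \<otimes> \<gamma> y)"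
        using xy by (simp add: hom_mult[OF \<gamma>] m_assoc cl)
    qed (simp add: cl)
    show "inv v \<otimes> (s \<otimes> v) = s \<otimes> \<gamma> s" if "s \<in> S" for s
    proof -
      have "s \<in> carrier G" using S(1) that by auto
      then show ?thesis using gen[OF that] v cl by (simp add: m_assoc inv_solve_left')
    qed
    show "u \<in> generate G S" using u S by simp
  qed
  then have "v \<otimes> (inv v \<otimes> (u \<otimes> v)) = v \<otimes> (u \<otimes> \<gamma> u)" by simp
  then show ?thesis using u v cl by (simp add: m_assoc mult_inv_cancel)
qed

lemma (in group) commutation_from_generators:
  assumes \<beta>: "bihom G G G \<beta>" and c: "\<And>u v. \<lbrakk>u \<in> carrier G; v \<in> carrier G\<rbrakk> \<Longrightarrow> central G (\<beta> u v)"
    and S: "S \<subseteq> carrier G" "carrier G = generate G S"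
    and gen: "\<And>s t. \<lbrakk>s \<in> S; t \<in> S\<rbrakk> \<Longrightarrow> s \<otimes> t = t \<otimes> s \<otimes> \<beta> s t"
    and uv: "u \<in> carrier G" "v \<in> carrier G"
  shows "u \<otimes> v = v \<otimes> u \<otimes> \<beta> u v"
proof (rule commutation_left_from_generators[OF bihom_hom_left[OF \<beta>] _ S])
  note [simp] = bihom_closed[OF \<beta>] bihom_right[OF \<beta>]
  show "s \<otimes> v = v \<otimes> s \<otimes> \<beta> s v" if "s \<in> S" for s
  proof -
    have s: "s \<in> carrier G" using that S(1) by auto
    \<comment> \<open>The previous lemma with the two factors exchanged: now \<open>s\<close> is
      fixed, \<open>v\<close> varies, and the defect is the inverse of
      \<open>\<beta> s v\<close>.\<close>
    have "v \<otimes> s = s \<otimes> v \<otimes> inv \<beta> s v"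
    proof (rule commutation_left_from_generators[OF _ _ S, of "\<lambda>v. inv \<beta> s v" s v])
      show "(\<lambda>v. inv \<beta> s v) \<in> hom G G"
        using s by (intro homI)
          (simp_all add: inv_mult_group central_commute[OF central_inv[OF c], of s _ "inv \<beta> s _"])
      show "t \<otimes> s = s \<otimes> t \<otimes> inv \<beta> s t" if "t \<in> S" for t
      proof -
        have "t \<in> carrier G" using that S(1) by auto
        then show ?thesis using gen[OF \<open>s \<in> S\<close> that] s by (simp add: m_assoc)
      qed
    qed (use s uv in \<open>simp_all add: c central_inv\<close>)
    then show ?thesis using s uv by (simp add: m_assoc)
  qed
qed (use uv in \<open>simp_all add: c\<close>)

context group_pair
begin

lemma central_tensor: "w \<in> carrier (A \<bowtie> B) \<Longrightarrow> central (A \<bowtie> B) w"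
  by (simp add: central_def T.m_comm)

end

section \<open>The tensor product is a square group\<close>

context sq_pair
begin

lemmas t_reps = rep_mult[OF ab.tensor_comm_group] rep_inv[OF ab.tensor_comm_group]
  rep_one[OF ab.tensor_comm_group]
lemmas t_atom = rep_atom[OF ab.tensor_comm_group]

lemmas pure_simps [simp] = ab.pure_closed ab.pure_left ab.pure_right ab.pure_one_left
  ab.pure_one_right ab.pure_inv_left ab.pure_inv_right

sublocale co: group_pair "sq_coker M" "sq_coker N"
  by (simp add: group_pair_def M.cok.is_group N.cok.is_group)

lemmas co_simps [simp] = co.pure_closed co.pure_left co.pure_right co.pure_one_left
  co.pure_one_right co.pure_inv_left co.pure_inv_right

abbreviation "CC \<equiv> sq_coker M \<bowtie> sq_coker N"

sublocale cc: group_pair CC CC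
  by (simp add: group_pair_def co.T.is_group)

lemma is_tensor_P_tensor_P: "is_tensor_P M N (tensor_P M N)" and ex1_tensor_P: "\<exists>!p. is_tensor_P M N p"
proof -
  obtain h where h: "h \<in> hom (tensor_ee M N) (tensor_e M N)"
    "\<And>a b. \<lbrakk>a \<in> carrier (sq_ee M); b \<in> carrier (sq_ee N)\<rbrakk> \<Longrightarrow> h (pure_ee M N a b) = bar M N a b"
    using ab.tensor_lift_central[OF te.is_group bar_bihom bar_central] by metis
  have "is_tensor_P M N (restrict h (carrier (tensor_ee M N)))"
    using h by (auto simp: is_tensor_P_def restrict_hom ab.T.is_group)
  moreover have "p = q" if p: "is_tensor_P M N p" and q: "is_tensor_P M N q" for p q
  proof (rule extensionalityI[of p "carrier (tensor_ee M N)"])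
    show "p w = q w" if "w \<in> carrier (tensor_ee M N)" for w
      by (rule ab.tensor_hom_eqI[of p "tensor_e M N" q, OF _ _ _ that])
        (use p q in \<open>simp_all add: is_tensor_P_def\<close>)
  qed (use p q in \<open>simp_all add: is_tensor_P_def\<close>)
  ultimately show "\<exists>!p. is_tensor_P M N p" by blast
  then show "is_tensor_P M N (tensor_P M N)" unfolding tensor_P_def by (rule theI')
qed

lemma tensor_P_hom: "tensor_P M N \<in> hom (tensor_ee M N) (tensor_e M N)"
  and tensor_P_pure: "\<lbrakk>a \<in> carrier (sq_ee M); b \<in> carrier (sq_ee N)\<rbrakk>
    \<Longrightarrow> tensor_P M N (pure_ee M N a b) = bar M N a b"
  using is_tensor_P_tensor_P by (auto simp: is_tensor_P_def)

lemma tensor_P_central: "w \<in> carrier (tensor_ee M N) \<Longrightarrow> central (tensor_e M N) (tensor_P M N w)"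
  by (induction rule: ab.tensor_induct)
    (simp_all add: tensor_P_pure bar_central hom_mult[OF tensor_P_hom] te.central_mult)

sublocale tP: central_hom "tensor_ee M N" "tensor_e M N" "tensor_P M N"
  by unfold_locales (fact tensor_P_hom, rule tensor_P_central)

text \<open>The class map into \<open>Coker P \<otimes> Coker P\<close>, obtained directly from the
  presentation. It precedes the comparison isomorphism and allows the bilinear form to be pulled
  back to the e-level at once.\<close>

definition "is_tcls h \<longleftrightarrow> h \<in> hom (tensor_e M N) CC \<and>
    (\<forall>x \<in> carrier (sq_e M). \<forall>y \<in> carrier (sq_e N).
      h (circ M N x y) = pure_tensor (sq_coker M) (sq_coker N) (sq_coker_class M x) (sq_coker_class N y)) \<and>
    (\<forall>a \<in> carrier (sq_ee M). \<forall>b \<in> carrier (sq_ee N). h (bar M N a b) = \<one>\<^bsub>CC\<^esub>)"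

lemma ex_tcls: "\<exists>h. is_tcls h"
proof -
  obtain h where "h \<in> hom (tensor_e M N) CC"
    "\<And>x y. \<lbrakk>x \<in> carrier (sq_e M); y \<in> carrier (sq_e N)\<rbrakk> \<Longrightarrow>
      h (circ M N x y) = pure_tensor (sq_coker M) (sq_coker N) (sq_coker_class M x) (sq_coker_class N y)"
    "\<And>a b. \<lbrakk>a \<in> carrier (sq_ee M); b \<in> carrier (sq_ee N)\<rbrakk> \<Longrightarrow> h (bar M N a b) = \<one>\<^bsub>CC\<^esub>"
    by (rule tensor_e_hom[of CC "\<lambda>x y. pure_tensor (sq_coker M) (sq_coker N) (sq_coker_class M x) (sq_coker_class N y)"
        "\<lambda>_ _. \<one>\<^bsub>CC\<^esub>"]) (auto intro: bihomI simp: co.T.central_one)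
  then show ?thesis unfolding is_tcls_def by blast
qed

definition "tcls = (SOME h. is_tcls h)"

lemma tcls_hom: "tcls \<in> hom (tensor_e M N) CC"
  and tcls_circ [simp]: "\<lbrakk>x \<in> carrier (sq_e M); y \<in> carrier (sq_e N)\<rbrakk> \<Longrightarrow>
      tcls (circ M N x y) = pure_tensor (sq_coker M) (sq_coker N) (sq_coker_class M x) (sq_coker_class N y)"
  and tcls_bar [simp]: "\<lbrakk>a \<in> carrier (sq_ee M); b \<in> carrier (sq_ee N)\<rbrakk> \<Longrightarrow> tcls (bar M N a b) = \<one>\<^bsub>CC\<^esub>"
  using someI_ex[OF ex_tcls, folded tcls_def, unfolded is_tcls_def] by auto

sublocale tcls: group_hom "tensor_e M N" CC tcls
  using tcls_hom by (simp add: group_hom_def group_hom_axioms_def te.is_group co.T.is_group)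

text \<open>A middle-four interchange followed by the tensor product of the two induced
  cross-effects, built by currying: one pair of variables is linearised at a time.\<close>

lemma ex_tensor_form: "\<exists>\<Phi>. is_tensor_form M N \<Phi>"
proof -
  let ?C = "sq_coker M" and ?D = "sq_coker N"
  note bM = M.coker_cross_bihom and bN = N.coker_cross_bihom
  note [simp] = bihom_closed[OF bM] bihom_left[OF bM] bihom_right[OF bM]
    bihom_closed[OF bN] bihom_left[OF bN] bihom_right[OF bN]
  \<comment> \<open>The primed variables come first because they are the parameters of the inner
    lift.\<close>
  define q where "q X' Y' X Y = pure_ee M N (M.coker_cross X X') (N.coker_cross Y Y')" for X' Y' X Y
  have q: "bihom ?C ?D (tensor_ee M N) (q X' Y')" if "X' \<in> carrier ?C" "Y' \<in> carrier ?D" for X' Y'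
    using that by (intro bihomI) (simp_all add: q_def)
  define q1 where "q1 X' Y' = tensor_lift ?C ?D (tensor_ee M N) (q X' Y')" for X' Y'
  note grp = M.cok.is_group N.cok.is_group
  have q1_X: "bihom ?C CC (tensor_ee M N) (\<lambda>X'. q1 X' Y')" if Y': "Y' \<in> carrier ?D" for Y'
    unfolding q1_def
    by (rule tensor_lift_bihom[OF grp grp(1) ab.tensor_comm_group])
      (use Y' q in \<open>auto intro!: homI simp: q_def\<close>)
  have q1_Y: "bihom ?D CC (tensor_ee M N) (q1 X')" if X': "X' \<in> carrier ?C" for X'
    unfolding q1_def
    by (rule tensor_lift_bihom[OF grp grp(2) ab.tensor_comm_group])
      (use X' q in \<open>auto intro!: homI simp: q_def\<close>)
  have q1_p: "bihom ?C ?D (tensor_ee M N) (\<lambda>X' Y'. q1 X' Y' p)" if "p \<in> carrier CC" for p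
    using that bihom_closed[OF q1_X] bihom_left[OF q1_X] bihom_left[OF q1_Y]
    by (intro bihomI) auto
  \<comment> \<open>Now \<open>p\<close> ranges over the already linearised unprimed pair, and the
    lift is taken in the primed pair.\<close>
  define q2 where "q2 p = tensor_lift ?C ?D (tensor_ee M N) (\<lambda>X' Y'. q1 X' Y' p)" for p
  have q2: "bihom CC CC (tensor_ee M N) q2"
    unfolding q2_def[abs_def]
    by (rule tensor_lift_bihom[OF grp co.T.is_group ab.tensor_comm_group])
      (use q1_p bihom_hom_right[OF q1_Y] in auto)
  define \<Phi> where "\<Phi> = tensor_lift CC CC (tensor_ee M N) q2"
  note l = tensor_lift_hom[OF co.T.is_group co.T.is_group ab.tensor_comm_group q2]
    tensor_lift_pure[OF co.T.is_group co.T.is_group ab.tensor_comm_group q2]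
  have "is_tensor_form M N \<Phi>"
    unfolding is_tensor_form_def \<Phi>_def
    by (simp add: l q2_def tensor_lift_pure[OF grp ab.tensor_comm_group q1_p]
        tensor_lift_pure[OF grp ab.tensor_comm_group q, folded q1_def]) (simp add: q_def)
  then show ?thesis by blast
qed

definition "form = (SOME \<Phi>. is_tensor_form M N \<Phi>)"

text \<open>The cross-effect that \<open>H\<close> is going to have, available before
  \<open>H\<close> itself.\<close>

definition "tform u v = form (pure_tensor CC CC (tcls u) (tcls v))"

lemma is_tensor_form: "is_tensor_form M N form"
  unfolding form_def using ex_tensor_form by (rule someI_ex)

text \<open>Stated for every admissible \<open>\<Phi>\<close> and not just for \<open>form\<close>,
  because \<open>is_tensor_H\<close> hides its own \<open>\<Phi>\<close> behind an existential
  quantifier.\<close>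

lemma form_bihom:
  assumes "is_tensor_form M N \<Phi>"
  shows "bihom (tensor_e M N) (tensor_e M N) (tensor_ee M N)
    (\<lambda>u v. \<Phi> (pure_tensor CC CC (tcls u) (tcls v)))"
proof -
  have \<Phi>: "\<Phi> \<in> hom (CC \<bowtie> CC) (tensor_ee M N)" using assms by (simp add: is_tensor_form_def)
  show ?thesis
    by (intro bihomI)
      (simp_all add: hom_in_carrier[OF \<Phi>] hom_mult[OF \<Phi>] cc.pure_closed cc.pure_left cc.pure_right)
qed

lemma form_simps:
  assumes "is_tensor_form M N \<Phi>"
  shows "\<lbrakk>x \<in> carrier (sq_e M); y \<in> carrier (sq_e N); x' \<in> carrier (sq_e M); y' \<in> carrier (sq_e N)\<rbrakk>
    \<Longrightarrow> \<Phi> (pure_tensor CC CC (tcls (circ M N x y)) (tcls (circ M N x' y'))) =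
      pure_ee M N (sq_cross M x x') (sq_cross N y y')"
    and "\<lbrakk>a \<in> carrier (sq_ee M); b \<in> carrier (sq_ee N); u \<in> carrier (tensor_e M N)\<rbrakk>
      \<Longrightarrow> \<Phi> (pure_tensor CC CC (tcls (bar M N a b)) (tcls u)) = \<one>\<^bsub>tensor_ee M N\<^esub>"
    and "\<lbrakk>a \<in> carrier (sq_ee M); b \<in> carrier (sq_ee N); u \<in> carrier (tensor_e M N)\<rbrakk>
      \<Longrightarrow> \<Phi> (pure_tensor CC CC (tcls u) (tcls (bar M N a b))) = \<one>\<^bsub>tensor_ee M N\<^esub>"
proof -
  have \<Phi>: "\<Phi> \<in> hom (CC \<bowtie> CC) (tensor_ee M N)" using assms by (simp add: is_tensor_form_def)
  have "\<Phi> \<one>\<^bsub>CC \<bowtie> CC\<^esub> = \<one>\<^bsub>tensor_ee M N\<^esub>"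
    using hom_one[OF \<Phi> cc.T.is_group ab.T.is_group] .
  then show "\<lbrakk>a \<in> carrier (sq_ee M); b \<in> carrier (sq_ee N); u \<in> carrier (tensor_e M N)\<rbrakk>
      \<Longrightarrow> \<Phi> (pure_tensor CC CC (tcls (bar M N a b)) (tcls u)) = \<one>\<^bsub>tensor_ee M N\<^esub>"
    "\<lbrakk>a \<in> carrier (sq_ee M); b \<in> carrier (sq_ee N); u \<in> carrier (tensor_e M N)\<rbrakk>
      \<Longrightarrow> \<Phi> (pure_tensor CC CC (tcls u) (tcls (bar M N a b))) = \<one>\<^bsub>tensor_ee M N\<^esub>"
    by (simp_all add: cc.pure_one_left cc.pure_one_right)
qed (use assms in \<open>simp add: is_tensor_form_def\<close>)

lemmas tform_bihom = form_bihom[OF is_tensor_form, folded tform_def]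
lemmas tform_simps [simp] = form_simps[OF is_tensor_form, folded tform_def]
lemmas tform_closed [simp] = bihom_closed[OF tform_bihom]

lemma bar_rel_circ:
  assumes "x1 \<in> carrier (sq_e M)" "x2 \<in> carrier (sq_e M)" "y1 \<in> carrier (sq_e N)" "y2 \<in> carrier (sq_e N)"
  shows "circ M N x2 y1 \<otimes>\<^bsub>tensor_e M N\<^esub> circ M N x1 y2 =
    circ M N x1 y2 \<otimes>\<^bsub>tensor_e M N\<^esub> circ M N x2 y1 \<otimes>\<^bsub>tensor_e M N\<^esub> bar M N (sq_cross M x2 x1) (sq_cross N y1 y2)"
proof -
  let ?c = "sq_cross M x2 x1"
  let ?A = "circ M N x1 y1" and ?B = "circ M N x2 y1" and ?C = "circ M N x1 y2" and ?D = "circ M N x2 y2"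
  let ?b1 = "bar M N ?c (sq_H N y1)" and ?b2 = "bar M N ?c (sq_H N y2)" and ?b3 = "bar M N ?c (sq_cross N y1 y2)"
  note m [simp] = assms
  \<comment> \<open>Fact \<open>1\<close> splits the right variable first and \<open>2\<close> the
    left one. The outer factors \<open>?A\<close>, \<open>?D\<close> and the terms
    \<open>?b1\<close>, \<open>?b2\<close> are common to both; what remains after cancelling is the
    commutator of \<open>?B\<close> and \<open>?C\<close>, and \<open>?b3\<close> comes from the
    cross term of \<open>H (y1 + y2)\<close>.\<close>
  have 1: "circ M N (x1 \<otimes>\<^bsub>sq_e M\<^esub> x2) (y1 \<otimes>\<^bsub>sq_e N\<^esub> y2) =
      ?A \<otimes>\<^bsub>tensor_e M N\<^esub> ?B \<otimes>\<^bsub>tensor_e M N\<^esub> ?b1 \<otimes>\<^bsub>tensor_e M N\<^esub> (?C \<otimes>\<^bsub>tensor_e M N\<^esub> ?D \<otimes>\<^bsub>tensor_e M N\<^esub> ?b2)"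
    by (simp add: circ_right circ_left)
  have 2: "circ M N (x1 \<otimes>\<^bsub>sq_e M\<^esub> x2) (y1 \<otimes>\<^bsub>sq_e N\<^esub> y2) =
      ?A \<otimes>\<^bsub>tensor_e M N\<^esub> ?C \<otimes>\<^bsub>tensor_e M N\<^esub> (?B \<otimes>\<^bsub>tensor_e M N\<^esub> ?D) \<otimes>\<^bsub>tensor_e M N\<^esub>
      (?b1 \<otimes>\<^bsub>tensor_e M N\<^esub> ?b2 \<otimes>\<^bsub>tensor_e M N\<^esub> ?b3)"
    by (simp add: circ_left) (simp add: circ_right N.H_mult bar_right)
  note pr = prep_mult[OF te.is_group] prep_one[OF te.is_group]
  note pc = prep_central[OF te.is_group bar_central] prep_central_inv[OF te.is_group bar_central]
  note pa = prep_atom[OF te.is_group]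
  have "?A \<otimes>\<^bsub>tensor_e M N\<^esub> (?B \<otimes>\<^bsub>tensor_e M N\<^esub> ?C \<otimes>\<^bsub>tensor_e M N\<^esub> (?D \<otimes>\<^bsub>tensor_e M N\<^esub> (?b1 \<otimes>\<^bsub>tensor_e M N\<^esub> ?b2))) =
      ?A \<otimes>\<^bsub>tensor_e M N\<^esub> ?B \<otimes>\<^bsub>tensor_e M N\<^esub> ?b1 \<otimes>\<^bsub>tensor_e M N\<^esub> (?C \<otimes>\<^bsub>tensor_e M N\<^esub> ?D \<otimes>\<^bsub>tensor_e M N\<^esub> ?b2)"
    by (rule prep_eqI, (rule pr | (rule pc, simp, simp; fail) | rule pa, simp; fail)+, simp_all add: algebra_simps)
  also have "\<dots> = ?A \<otimes>\<^bsub>tensor_e M N\<^esub> ?C \<otimes>\<^bsub>tensor_e M N\<^esub> (?B \<otimes>\<^bsub>tensor_e M N\<^esub> ?D) \<otimes>\<^bsub>tensor_e M N\<^esub>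
      (?b1 \<otimes>\<^bsub>tensor_e M N\<^esub> ?b2 \<otimes>\<^bsub>tensor_e M N\<^esub> ?b3)"
    using 1 2 by simp
  also have "\<dots> = ?A \<otimes>\<^bsub>tensor_e M N\<^esub> (?C \<otimes>\<^bsub>tensor_e M N\<^esub> ?B \<otimes>\<^bsub>tensor_e M N\<^esub> ?b3 \<otimes>\<^bsub>tensor_e M N\<^esub>
      (?D \<otimes>\<^bsub>tensor_e M N\<^esub> (?b1 \<otimes>\<^bsub>tensor_e M N\<^esub> ?b2)))"
    by (rule prep_eqI, (rule pr | (rule pc, simp, simp; fail) | rule pa, simp; fail)+, simp_all add: algebra_simps)
  finally show ?thesis
    by (simp del: te.m_closed add: te.m_closed)
qed

text \<open>Both the commutator and \<open>P\<close> of the form are controlled by generators: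
  \<open>bar_rel_circ\<close> covers two \<open>circ\<close> generators, and a \<open>bar\<close>
  generator is central while \<open>tform\<close> vanishes on it. This becomes the axiom on
  \<open>P (x|y)\<close>.\<close>

lemma tform_commutation:
  assumes "u \<in> carrier (tensor_e M N)" "v \<in> carrier (tensor_e M N)"
  shows "u \<otimes>\<^bsub>tensor_e M N\<^esub> v = v \<otimes>\<^bsub>tensor_e M N\<^esub> u \<otimes>\<^bsub>tensor_e M N\<^esub> tensor_P M N (tform u v)"
proof (rule te.commutation_from_generators[OF _ _ te_gens_closed te_generated _ assms])
  show "bihom (tensor_e M N) (tensor_e M N) (tensor_e M N) (\<lambda>u v. tensor_P M N (tform u v))"
    by (intro bihomI)
      (simp_all add: bihom_left[OF tform_bihom] bihom_right[OF tform_bihom])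
  show "central (tensor_e M N) (tensor_P M N (tform u v))"
    if "u \<in> carrier (tensor_e M N)" "v \<in> carrier (tensor_e M N)" for u v
    using that by (simp add: tensor_P_central)
  fix s t assume s: "s \<in> te_gens" and t: "t \<in> te_gens"
  have st: "s \<in> carrier (tensor_e M N)" "t \<in> carrier (tensor_e M N)" using s t te_gens_closed by blast+
  show "s \<otimes>\<^bsub>tensor_e M N\<^esub> t = t \<otimes>\<^bsub>tensor_e M N\<^esub> s \<otimes>\<^bsub>tensor_e M N\<^esub> tensor_P M N (tform s t)"
  proof (cases "(\<exists>a \<in> carrier (sq_ee M). \<exists>b \<in> carrier (sq_ee N). s = bar M N a b) \<or>
      (\<exists>a \<in> carrier (sq_ee M). \<exists>b \<in> carrier (sq_ee N). t = bar M N a b)")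
    case True
    then consider a b where "a \<in> carrier (sq_ee M)" "b \<in> carrier (sq_ee N)" "s = bar M N a b"
      | a b where "a \<in> carrier (sq_ee M)" "b \<in> carrier (sq_ee N)" "t = bar M N a b" by blast
    then show ?thesis
    proof cases
      case 1
      then show ?thesis using st te.central_commute[OF bar_central, of a b t] by simp
    next
      case 2
      then show ?thesis using st te.central_commute[OF bar_central, of a b s] by simp
    qed
  next
    case False
    then obtain x y x' y' where "x \<in> carrier (sq_e M)" "y \<in> carrier (sq_e N)" "s = circ M N x y"
      "x' \<in> carrier (sq_e M)" "y' \<in> carrier (sq_e N)" "t = circ M N x' y'" using s t by blast
    then show ?thesis using bar_rel_circ[of x' x y y'] by (simp add: tensor_P_pure)
  qed
qed

lemma tcoker_comm: "comm_group (coker (tensor_ee M N) (tensor_e M N) (tensor_P M N))"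
  by (rule tP.coker_comm_group) (rule bexI, rule tform_commutation, simp_all)

end

section \<open>The cokernel of \<open>P\<close> and the quadratic map \<open>H\<close> on the tensor
  product\<close>

context sq_pair
begin

abbreviation "tcoker \<equiv> coker (tensor_ee M N) (tensor_e M N) (tensor_P M N)"
abbreviation "tclass \<equiv> coker_class (tensor_ee M N) (tensor_e M N) (tensor_P M N)"

sublocale tco: comm_group tcoker by (rule tcoker_comm)

lemma tcls_P [simp]: "w \<in> carrier (tensor_ee M N) \<Longrightarrow> tcls (tensor_P M N w) = \<one>\<^bsub>CC\<^esub>"
  by (induction rule: ab.tensor_induct)
    (simp_all add: tensor_P_pure hom_mult[OF tensor_P_hom])

lemma tclass_bar [simp]:
  "\<lbrakk>a \<in> carrier (sq_ee M); b \<in> carrier (sq_ee N)\<rbrakk> \<Longrightarrow> tclass (bar M N a b) = \<one>\<^bsub>tcoker\<^esub>"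
  using tP.class_p[of "pure_ee M N a b"] by (simp add: tensor_P_pure)

text \<open>Any admissible \<open>\<theta>\<close> composed with the class map is
  \<open>tcls\<close>, so the choice hidden in \<open>is_tensor_H\<close> has no influence.\<close>

lemma is_coker_iso_class:
  assumes "is_coker_iso M N \<theta>" "u \<in> carrier (tensor_e M N)"
  shows "\<theta> (tclass u) = tcls u"
proof -
  have \<theta>: "\<theta> \<in> hom tcoker CC" using assms by (simp add: is_coker_iso_def iso_def)
  have one: "\<theta> \<one>\<^bsub>tcoker\<^esub> = \<one>\<^bsub>CC\<^esub>" by (rule hom_one[OF \<theta> tP.coker_group co.T.is_group])
  show ?thesis
  proof (rule te.generate_hom_eq[OF co.T.is_group _ tcls_hom te_gens_closed, of "\<lambda>u. \<theta> (tclass u)"])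
    show "(\<lambda>u. \<theta> (tclass u)) \<in> hom (tensor_e M N) CC"
      by (intro homI) (simp_all add: hom_in_carrier[OF \<theta>] hom_mult[OF \<theta>])
    show "\<theta> (tclass s) = tcls s" if "s \<in> te_gens" for s
      using that assms(1) one by (auto simp: is_coker_iso_def)
    show "u \<in> generate (tensor_e M N) te_gens" using assms(2) te_generated by simp
  qed
qed

text \<open>One direction factors \<open>tcls\<close>. For the inverse, \<open>circ\<close> becomes
  bilinear modulo the image of \<open>P\<close>, since the defect in relation (3) is a
  \<open>bar\<close>; the cokernel is an admissible target because the commutator formula makes it
  commutative.\<close>

lemma ex_coker_iso: "\<exists>\<theta>. is_coker_iso M N \<theta>"
proof -
  let ?C = "sq_coker M" and ?D = "sq_coker N"
  have "tensor_P M N ` carrier (tensor_ee M N) \<subseteq> kernel (tensor_e M N) CC tcls"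
    by (auto simp: kernel_def)
  then obtain \<theta> where \<theta>: "\<theta> \<in> hom tcoker CC"
    "\<And>u. u \<in> carrier (tensor_e M N) \<Longrightarrow> \<theta> (tclass u) = tcls u"
    using tcls.FactGroup_universal_kernel[OF tP.image_normal]
    unfolding coker_def coker_class_def by metis
  \<comment> \<open>Changing representatives by elements of the image of \<open>P\<close> changes
    \<open>circ\<close> only by \<open>bar\<close> terms, by relations (3) to (5).\<close>
  define k where "k X Y = tclass (circ M N (SOME x. x \<in> X) (SOME y. y \<in> Y))" for X Y
  have k: "k (sq_coker_class M x) (sq_coker_class N y) = tclass (circ M N x y)"
    if xy: "x \<in> carrier (sq_e M)" "y \<in> carrier (sq_e N)" for x y
  proof -
    obtain a b where ab: "a \<in> carrier (sq_ee M)" "b \<in> carrier (sq_ee N)"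
      "(SOME z. z \<in> sq_coker_class M x) = sq_P M a \<otimes>\<^bsub>sq_e M\<^esub> x"
      "(SOME z. z \<in> sq_coker_class N y) = sq_P N b \<otimes>\<^bsub>sq_e N\<^esub> y"
      using M.co.some_class[OF xy(1)] N.co.some_class[OF xy(2)] unfolding sq_coker_class_def by metis
    have "circ M N (sq_P M a \<otimes>\<^bsub>sq_e M\<^esub> x) (sq_P N b \<otimes>\<^bsub>sq_e N\<^esub> y) =
        bar M N (sq_cross M (sq_P M a \<otimes>\<^bsub>sq_e M\<^esub> x) (sq_P M a \<otimes>\<^bsub>sq_e M\<^esub> x)) b \<otimes>\<^bsub>tensor_e M N\<^esub>
        (bar M N a (sq_Delta N y) \<otimes>\<^bsub>tensor_e M N\<^esub> circ M N x y \<otimes>\<^bsub>tensor_e M N\<^esub>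
          bar M N (sq_cross M x (sq_P M a)) (sq_H N y))"
      using xy ab by (simp add: circ_right circ_P del: M.cross_left M.cross_right M.cross_P)
        (simp add: circ_left P_circ)
    then show ?thesis using xy ab by (simp add: k_def)
  qed
  have k_bihom: "bihom ?C ?D tcoker k"
  proof (rule bihomI)
    fix X Y assume "X \<in> carrier ?C" "Y \<in> carrier ?D"
    then show "k X Y \<in> carrier tcoker" by (elim M.coker_cases N.coker_cases) (simp add: k)
  next
    fix X X' Y assume "X \<in> carrier ?C" "X' \<in> carrier ?C" "Y \<in> carrier ?D"
    then show "k (X \<otimes>\<^bsub>?C\<^esub> X') Y = k X Y \<otimes>\<^bsub>tcoker\<^esub> k X' Y"
      by (elim M.coker_cases N.coker_cases)
        (simp add: k circ_left flip: M.cls.hom_mult)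
  next
    fix X Y Y' assume "X \<in> carrier ?C" "Y \<in> carrier ?D" "Y' \<in> carrier ?D"
    then show "k X (Y \<otimes>\<^bsub>?D\<^esub> Y') = k X Y \<otimes>\<^bsub>tcoker\<^esub> k X Y'"
      by (elim M.coker_cases N.coker_cases)
        (simp add: k circ_right flip: N.cls.hom_mult)
  qed
  obtain \<kappa> where \<kappa>: "\<kappa> \<in> hom CC tcoker"
    "\<And>X Y. \<lbrakk>X \<in> carrier ?C; Y \<in> carrier ?D\<rbrakk> \<Longrightarrow> \<kappa> (pure_tensor ?C ?D X Y) = k X Y"
    using co.tensor_lift_exists[OF tcoker_comm k_bihom] by metis
  have \<kappa>1: "\<kappa> \<one>\<^bsub>CC\<^esub> = \<one>\<^bsub>tcoker\<^esub>" by (rule hom_one[OF \<kappa>(1) co.T.is_group tP.coker_group])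
  have \<theta>\<kappa>: "\<theta> (\<kappa> w) = w" if "w \<in> carrier CC" for w
  proof (rule co.tensor_hom_eqI[of "\<lambda>w. \<theta> (\<kappa> w)" CC "\<lambda>w. w", OF _ _ _ that])
    show "(\<lambda>w. \<theta> (\<kappa> w)) \<in> hom CC CC"
      by (intro homI) (simp_all add: hom_in_carrier[OF \<theta>(1)] hom_in_carrier[OF \<kappa>(1)]
          hom_mult[OF \<theta>(1)] hom_mult[OF \<kappa>(1)])
    show "(\<lambda>w. w) \<in> hom CC CC" by (intro homI) auto
    fix X Y assume "X \<in> carrier ?C" "Y \<in> carrier ?D"
    then show "\<theta> (\<kappa> (pure_tensor ?C ?D X Y)) = pure_tensor ?C ?D X Y"
      by (elim M.coker_cases N.coker_cases) (simp add: \<kappa> k \<theta>)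
  qed
  have \<kappa>\<theta>': "\<kappa> (tcls u) = tclass u" if "u \<in> carrier (tensor_e M N)" for u
  proof (rule te.generate_hom_eq[OF tP.coker_group _ tP.class_hom te_gens_closed, of "\<lambda>u. \<kappa> (tcls u)"])
    show "(\<lambda>u. \<kappa> (tcls u)) \<in> hom (tensor_e M N) tcoker"
      by (intro homI) (simp_all add: hom_in_carrier[OF \<kappa>(1)] hom_mult[OF \<kappa>(1)])
    show "\<kappa> (tcls s) = tclass s" if "s \<in> te_gens" for s
      using that by (auto simp: \<kappa> k \<kappa>1)
    show "u \<in> generate (tensor_e M N) te_gens" using that te_generated by simp
  qed
  have \<kappa>\<theta>: "\<kappa> (\<theta> X) = X" if "X \<in> carrier tcoker" for X
    using that by (elim tP.coker_cases) (simp add: \<theta> \<kappa>\<theta>')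
  have "bij_betw \<theta> (carrier tcoker) (carrier CC)"
    by (rule bij_betw_byWitness[where f' = \<kappa>])
      (use \<theta>\<kappa> \<kappa>\<theta> hom_in_carrier[OF \<theta>(1)] hom_in_carrier[OF \<kappa>(1)] in auto)
  then have "is_coker_iso M N \<theta>"
    using \<theta> by (simp add: is_coker_iso_def iso_def)
  then show ?thesis by blast
qed

text \<open>The twisted universal property with target \<open>tensor_ee M N\<close> and twist
  \<open>tform\<close>: the prescribed values of \<open>H\<close> on generators satisfy the
  relations up to that form.\<close>

lemma ex_tensor_H: "\<exists>h. is_tensor_H M N h"
proof -
  let ?T = "tensor_ee M N"
  let ?f = "\<lambda>x y. pure_ee M N (sq_cross M x x) (sq_H N y) \<otimes>\<^bsub>?T\<^esub> pure_ee M N (sq_H M x) (sq_Delta N y)"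
  let ?g = "\<lambda>a b. pure_ee M N a b \<otimes>\<^bsub>?T\<^esub> inv\<^bsub>?T\<^esub> pure_ee M N (sq_T M a) (sq_T N b)"
  obtain h where h: "\<And>u. u \<in> carrier (tensor_e M N) \<Longrightarrow> h u \<in> carrier ?T"
    "\<And>u v. \<lbrakk>u \<in> carrier (tensor_e M N); v \<in> carrier (tensor_e M N)\<rbrakk>
      \<Longrightarrow> h (u \<otimes>\<^bsub>tensor_e M N\<^esub> v) = h u \<otimes>\<^bsub>?T\<^esub> h v \<otimes>\<^bsub>?T\<^esub> tform u v"
    "\<And>x y. \<lbrakk>x \<in> carrier (sq_e M); y \<in> carrier (sq_e N)\<rbrakk> \<Longrightarrow> h (circ M N x y) = ?f x y"
    "\<And>a b. \<lbrakk>a \<in> carrier (sq_ee M); b \<in> carrier (sq_ee N)\<rbrakk> \<Longrightarrow> h (bar M N a b) = ?g a b"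
  proof (rule tensor_e_twisted[OF ab.T.is_group tform_bihom, of ?f ?g])
    fix x y1 y2 assume "x \<in> carrier (sq_e M)" "y1 \<in> carrier (sq_e N)" "y2 \<in> carrier (sq_e N)"
    then show "?f x (y1 \<otimes>\<^bsub>sq_e N\<^esub> y2) = ?f x y1 \<otimes>\<^bsub>?T\<^esub> ?f x y2 \<otimes>\<^bsub>?T\<^esub> tform (circ M N x y1) (circ M N x y2)"
      by (simp add: N.H_mult)
        (rule rep_eqI, (rule t_reps | rule t_atom, simp; fail)+, simp add: algebra_simps)
  next
    \<comment> \<open>The excess is \<open>((x1|x2) + (x2|x1)) \<otimes> H(y) + (x1|x2) \<otimes>
      \<Delta>(y)\<close>. Expanding \<open>\<Delta>(y)\<close> turns it into
      \<open>(x1|x2) \<otimes> (y|y)\<close>, which is the twist, plus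
      \<open>(x2|x1) \<otimes> H(y) + (x1|x2) \<otimes> T H(y)\<close>, which is \<open>H\<close> of
      the \<open>bar\<close> term in relation (3).\<close>
    fix x1 x2 y assume "x1 \<in> carrier (sq_e M)" "x2 \<in> carrier (sq_e M)" "y \<in> carrier (sq_e N)"
    then show "?f (x1 \<otimes>\<^bsub>sq_e M\<^esub> x2) y = ?f x1 y \<otimes>\<^bsub>?T\<^esub> ?f x2 y \<otimes>\<^bsub>?T\<^esub>
        tform (circ M N x1 y) (circ M N x2 y) \<otimes>\<^bsub>?T\<^esub> ?g (sq_cross M x2 x1) (sq_H N y)"
      by (simp add: M.H_mult N.Delta_eq)
        (rule rep_eqI, (rule t_reps | rule t_atom, simp; fail)+, simp add: algebra_simps)
  next
    fix x b assume "x \<in> carrier (sq_e M)" "b \<in> carrier (sq_ee N)"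
    then show "?f x (sq_P N b) = ?g (sq_cross M x x) b"
      by (simp add: N.H_P)
        (rule rep_eqI, (rule t_reps | rule t_atom, simp; fail)+, simp add: algebra_simps)
  next
    fix a y assume "a \<in> carrier (sq_ee M)" "y \<in> carrier (sq_e N)"
    then show "?f (sq_P M a) y = ?g a (sq_Delta N y)"
      by (simp add: M.H_P)
        (rule rep_eqI, (rule t_reps | rule t_atom, simp; fail)+, simp add: algebra_simps)
  next
    fix a b assume "a \<in> carrier (sq_ee M)" "b \<in> carrier (sq_ee N)"
    then show "?g (sq_T M a) (sq_T N b) = inv\<^bsub>?T\<^esub> ?g a b"
      by (simp add: ab.T.inv_mult ab.T.m_comm)
  next
    show "bihom (sq_ee M) (sq_ee N) ?T ?g"
      by (intro bihomI) (simp_all add: ab.T.inv_mult ab.T.m_ac)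
  qed (simp_all add: ab.central_tensor, blast)
  define H where "H = restrict h (carrier (tensor_e M N))"
  have cross: "cross_effect (tensor_e M N) ?T H u v = tform u v"
    if uv: "u \<in> carrier (tensor_e M N)" "v \<in> carrier (tensor_e M N)" for u v
  proof -
    have "h u \<otimes>\<^bsub>?T\<^esub> h v \<otimes>\<^bsub>?T\<^esub> tform u v \<otimes>\<^bsub>?T\<^esub> inv\<^bsub>?T\<^esub> h u \<otimes>\<^bsub>?T\<^esub> inv\<^bsub>?T\<^esub> h v = tform u v"
      using uv h(1)
      by - (rule rep_eqI, (rule t_reps | rule t_atom, simp; fail)+,
          simp add: algebra_simps)
    then show ?thesis using uv by (simp add: cross_effect_def H_def h(2))
  qed
  obtain \<theta> where \<theta>: "is_coker_iso M N \<theta>" using ex_coker_iso ..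
  have "quadratic_map (tensor_e M N) ?T H"
    unfolding quadratic_map_def
    by (auto intro!: homI simp: cross bihom_left[OF tform_bihom] bihom_right[OF tform_bihom])
      (simp add: H_def h(1))
  moreover have "H \<in> extensional (carrier (tensor_e M N))" by (simp add: H_def)
  moreover have "\<forall>u \<in> carrier (tensor_e M N). \<forall>v \<in> carrier (tensor_e M N).
      cross_effect (tensor_e M N) ?T H u v = form (pure_tensor CC CC (\<theta> (tclass u)) (\<theta> (tclass v)))"
    by (simp add: cross is_coker_iso_class[OF \<theta>] tform_def)
  ultimately have "is_tensor_H M N H"
    unfolding is_tensor_H_def using \<theta> is_tensor_form by (auto simp: H_def h)
  then show ?thesis by blast
qed

text \<open>Two forms pulled back along \<open>tcls\<close> agree on generators, so every solution
  of the specification has cross-effect \<open>tform\<close>; this is what makes \<open>H\<close>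
  unique.\<close>

lemma is_tensor_H_cross:
  assumes "is_tensor_H M N h" "u \<in> carrier (tensor_e M N)" "v \<in> carrier (tensor_e M N)"
  shows "cross_effect (tensor_e M N) (tensor_ee M N) h u v = tform u v"
proof -
  obtain \<theta> \<Phi> where \<theta>: "is_coker_iso M N \<theta>" and \<Phi>: "is_tensor_form M N \<Phi>"
    and eq: "cross_effect (tensor_e M N) (tensor_ee M N) h u v =
      \<Phi> (pure_tensor CC CC (\<theta> (tclass u)) (\<theta> (tclass v)))"
    using assms unfolding is_tensor_H_def by blast
  have "\<Phi> (pure_tensor CC CC (tcls u) (tcls v)) = tform u v"
  proof (rule bihom_eq_on_generators[OF te.is_group te.is_group ab.T.is_group form_bihom[OF \<Phi>]
        tform_bihom te_gens_closed te_generated te_gens_closed te_generated _ assms(2,3)])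
    fix s t assume "s \<in> te_gens" "t \<in> te_gens"
    then show "\<Phi> (pure_tensor CC CC (tcls s) (tcls t)) = tform s t"
      by (elim UnE CollectE exE conjE)
        (simp_all only: form_simps[OF \<Phi>] tform_simps circ_closed bar_closed)
  qed
  then show ?thesis using eq assms(2,3) by (simp add: is_coker_iso_class[OF \<theta>])
qed

lemma is_tensor_H_mult:
  assumes h: "is_tensor_H M N h" and uv: "u \<in> carrier (tensor_e M N)" "v \<in> carrier (tensor_e M N)"
  shows "h (u \<otimes>\<^bsub>tensor_e M N\<^esub> v) = h u \<otimes>\<^bsub>tensor_ee M N\<^esub> h v \<otimes>\<^bsub>tensor_ee M N\<^esub> tform u v"
proof -
  have "h w \<in> carrier (tensor_ee M N)" if "w \<in> carrier (tensor_e M N)" for w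
    using h that by (auto simp: is_tensor_H_def quadratic_map_def)
  then show ?thesis
    unfolding is_tensor_H_cross[OF assms, symmetric] cross_effect_def using uv
    by - (rule rep_eqI, (rule t_reps | rule t_atom, simp; fail)+,
        simp add: algebra_simps)
qed

lemma ex1_tensor_H: "\<exists>!h. is_tensor_H M N h"
proof (rule ex_ex1I[OF ex_tensor_H])
  fix h h' assume h: "is_tensor_H M N h" and h': "is_tensor_H M N h'"
  have cl: "k w \<in> carrier (tensor_ee M N)" if "w \<in> carrier (tensor_e M N)" "is_tensor_H M N k" for w k
    using that by (auto simp: is_tensor_H_def quadratic_map_def)
  show "h = h'"
  proof (rule extensionalityI[of h "carrier (tensor_e M N)"])
    fix u assume u: "u \<in> carrier (tensor_e M N)"
    show "h u = h' u"
    proof (rule quadratic_eq_on_generators[OF te.is_group ab.T.is_group tform_bihom _ _ _ _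
          te_gens_closed te_generated _ u])
      show "h s = h' s" if "s \<in> te_gens" for s
        using that h h' by (auto simp: is_tensor_H_def)
    qed (use h h' cl is_tensor_H_mult in auto)
  qed (use h h' in \<open>auto simp: is_tensor_H_def\<close>)
qed

lemma is_tensor_H: "is_tensor_H M N (tensor_H M N)"
  unfolding tensor_H_def by (rule theI'[OF ex1_tensor_H])

lemma tensor_sel: "sq_e (M \<diamond> N) = tensor_e M N" "sq_ee (M \<diamond> N) = tensor_ee M N"
  "sq_P (M \<diamond> N) = tensor_P M N" "sq_H (M \<diamond> N) = tensor_H M N"
  by (simp_all add: sq_tensor_def)

lemma tensor_cross:
  "\<lbrakk>u \<in> carrier (tensor_e M N); v \<in> carrier (tensor_e M N)\<rbrakk> \<Longrightarrow> sq_cross (M \<diamond> N) u v = tform u v"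
  by (simp add: sq_cross_def tensor_sel is_tensor_H_cross[OF is_tensor_H])

lemma tform_P [simp]:
  assumes "w \<in> carrier (tensor_ee M N)" "u \<in> carrier (tensor_e M N)"
  shows "tform (tensor_P M N w) u = \<one>\<^bsub>tensor_ee M N\<^esub>" "tform u (tensor_P M N w) = \<one>\<^bsub>tensor_ee M N\<^esub>"
proof -
  note one = bihom_one_left[OF tform_bihom te.is_group te.is_group ab.T.is_group]
    bihom_one_right[OF tform_bihom te.is_group te.is_group ab.T.is_group]
  show "tform (tensor_P M N w) u = \<one>\<^bsub>tensor_ee M N\<^esub>" "tform u (tensor_P M N w) = \<one>\<^bsub>tensor_ee M N\<^esub>"
    using one(1)[of u] one(2)[of u] tcls.hom_one assms by (simp_all add: tform_def)
qed

lemma tensor_H_mult: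
  "\<lbrakk>u \<in> carrier (tensor_e M N); v \<in> carrier (tensor_e M N)\<rbrakk> \<Longrightarrow>
    tensor_H M N (u \<otimes>\<^bsub>tensor_e M N\<^esub> v) =
      tensor_H M N u \<otimes>\<^bsub>tensor_ee M N\<^esub> tensor_H M N v \<otimes>\<^bsub>tensor_ee M N\<^esub> tform u v"
  by (rule is_tensor_H_mult[OF is_tensor_H])

lemma tensor_H_closed: "u \<in> carrier (tensor_e M N) \<Longrightarrow> tensor_H M N u \<in> carrier (tensor_ee M N)"
  using is_tensor_H by (auto simp: is_tensor_H_def quadratic_map_def)

text \<open>On a pure tensor, \<open>P\<close> of \<open>a \<otimes> b - T a \<otimes> T b\<close>
  is twice \<open>bar a b\<close> by relation (6). Sums cause no trouble because
  \<open>tform\<close> vanishes on the image of \<open>P\<close>, which is central.\<close>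

lemma tensor_PHP:
  assumes "w \<in> carrier (tensor_ee M N)"
  shows "tensor_P M N (tensor_H M N (tensor_P M N w)) = tensor_P M N w [^]\<^bsub>tensor_e M N\<^esub> (2::nat)"
  using assms
proof (induction rule: ab.tensor_induct)
  case (pure a b)
  have "tensor_H M N (bar M N a b) =
    pure_ee M N a b \<otimes>\<^bsub>tensor_ee M N\<^esub> inv\<^bsub>tensor_ee M N\<^esub> pure_ee M N (sq_T M a) (sq_T N b)"
    using is_tensor_H pure by (simp add: is_tensor_H_def)
  then show ?case
    using pure by (simp add: tensor_P_pure T_bar_T numeral_2_eq_2 hom_mult[OF tensor_P_hom])
next
  case (mult u v)
  then show ?case
    using te.central_commute[OF tensor_P_central, of u "tensor_P M N v"]
    by (simp add: tensor_H_mult tensor_H_closed numeral_2_eq_2 te.m_assoc)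
      (simp flip: te.m_assoc)
qed

lemma square_group_tensor: "square_group (M \<diamond> N)"
proof (rule square_group.intro)
  show "group (sq_e (M \<diamond> N))" "comm_group (sq_ee (M \<diamond> N))"
    by (simp_all add: tensor_sel te.is_group ab.tensor_comm_group)
  show "sq_P (M \<diamond> N) \<in> hom (sq_ee (M \<diamond> N)) (sq_e (M \<diamond> N))"
    by (simp add: tensor_sel tensor_P_hom)
  show "quadratic_map (sq_e (M \<diamond> N)) (sq_ee (M \<diamond> N)) (sq_H (M \<diamond> N))"
    using is_tensor_H by (simp add: tensor_sel is_tensor_H_def)
  fix x y assume xy: "x \<in> carrier (sq_e (M \<diamond> N))" "y \<in> carrier (sq_e (M \<diamond> N))"
  show "sq_P (M \<diamond> N) (sq_cross (M \<diamond> N) x y) = inv\<^bsub>sq_e (M \<diamond> N)\<^esub> x \<otimes>\<^bsub>sq_e (M \<diamond> N)\<^esub>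
      inv\<^bsub>sq_e (M \<diamond> N)\<^esub> y \<otimes>\<^bsub>sq_e (M \<diamond> N)\<^esub> x \<otimes>\<^bsub>sq_e (M \<diamond> N)\<^esub> y"
    using xy tform_commutation[of x y]
    by (simp add: tensor_sel tensor_cross te.m_assoc te.mult_inv_cancel)
qed (simp_all add: tensor_sel tensor_cross tensor_PHP)

end

section \<open>Computation rules in the square group \<open>M \<diamond> N\<close>\<close>

context sq_pair
begin

sublocale T: square_group "M \<diamond> N" by (rule square_group_tensor)

text \<open>Oriented towards the components of \<open>M \<diamond> N\<close>, so that the rules
  proved for arbitrary square groups also apply inside iterated tensor products.\<close>

lemmas tensor_fold [simp] = tensor_sel[symmetric]

text \<open>From here on \<open>bar\<close> is rewritten to \<open>P\<close> of a pure tensor.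
  Centrality and linearity become facts about \<open>P\<close>, and compatibility of an arrow with
  \<open>P\<close> determines its values on \<open>bar\<close>.\<close>

lemma bar_P [simp]:
  "\<lbrakk>a \<in> carrier (sq_ee M); b \<in> carrier (sq_ee N)\<rbrakk> \<Longrightarrow> bar M N a b = sq_P (M \<diamond> N) (pure_ee M N a b)"
  using tensor_P_pure by simp

lemmas t_pure_simps [simp] = pure_simps[folded tensor_sel]
lemmas t_circ_closed [simp] = circ_closed[folded tensor_sel]
lemmas t_circ_right [simp] = circ_right[folded tensor_sel]
lemmas t_pure_bihom = ab.pure_bihom[folded tensor_sel]
lemmas t_induct = ab.tensor_induct[folded tensor_sel, consumes 1, case_names pure mult]

lemma t_circ_left:
  assumes "x1 \<in> carrier (sq_e M)" "x2 \<in> carrier (sq_e M)" "y \<in> carrier (sq_e N)"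
  shows "circ M N (x1 \<otimes>\<^bsub>sq_e M\<^esub> x2) y = circ M N x1 y \<otimes>\<^bsub>sq_e (M \<diamond> N)\<^esub> circ M N x2 y
    \<otimes>\<^bsub>sq_e (M \<diamond> N)\<^esub> sq_P (M \<diamond> N) (pure_ee M N (sq_cross M x2 x1) (sq_H N y))"
  using circ_left[OF assms] assms by simp

lemma t_circ_P [simp]:
  "\<lbrakk>x \<in> carrier (sq_e M); b \<in> carrier (sq_ee N)\<rbrakk>
    \<Longrightarrow> circ M N x (sq_P N b) = sq_P (M \<diamond> N) (pure_ee M N (sq_cross M x x) b)"
  using circ_P by simp

lemma t_P_circ [simp]:
  "\<lbrakk>a \<in> carrier (sq_ee M); y \<in> carrier (sq_e N)\<rbrakk>
    \<Longrightarrow> circ M N (sq_P M a) y = sq_P (M \<diamond> N) (pure_ee M N a (sq_Delta N y))"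
  using P_circ by simp

lemma H_circ [simp]:
  assumes "x \<in> carrier (sq_e M)" "y \<in> carrier (sq_e N)"
  shows "sq_H (M \<diamond> N) (circ M N x y) = pure_ee M N (sq_cross M x x) (sq_H N y)
    \<otimes>\<^bsub>sq_ee (M \<diamond> N)\<^esub> pure_ee M N (sq_H M x) (sq_Delta N y)"
  using is_tensor_H assms by (simp add: is_tensor_H_def)

lemma H_P_pure:
  assumes "a \<in> carrier (sq_ee M)" "b \<in> carrier (sq_ee N)"
  shows "sq_H (M \<diamond> N) (sq_P (M \<diamond> N) (pure_ee M N a b)) =
    pure_ee M N a b \<otimes>\<^bsub>sq_ee (M \<diamond> N)\<^esub> inv\<^bsub>sq_ee (M \<diamond> N)\<^esub> pure_ee M N (sq_T M a) (sq_T N b)"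
  using is_tensor_H assms by (simp add: is_tensor_H_def)

text \<open>This is \<open>T = H P - 1\<close> on a pure tensor. With it, \<open>P T = P\<close> on
  \<open>M \<diamond> N\<close> restates relation (6).\<close>

lemma T_pure [simp]:
  assumes "a \<in> carrier (sq_ee M)" "b \<in> carrier (sq_ee N)"
  shows "sq_T (M \<diamond> N) (pure_ee M N a b) = inv\<^bsub>sq_ee (M \<diamond> N)\<^esub> pure_ee M N (sq_T M a) (sq_T N b)"
  using assms by (simp add: sq_T_def[of "M \<diamond> N"] H_P_pure T.ee.m_ac T.ee.mult_inv_cancel)

lemma cross_circ [simp]:
  assumes "x \<in> carrier (sq_e M)" "y \<in> carrier (sq_e N)" "x' \<in> carrier (sq_e M)" "y' \<in> carrier (sq_e N)"
  shows "sq_cross (M \<diamond> N) (circ M N x y) (circ M N x' y') = pure_ee M N (sq_cross M x x') (sq_cross N y y')"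
  using assms tensor_cross[of "circ M N x y" "circ M N x' y'"] by simp

text \<open>In \<open>T H - H + (u|u)\<close> for \<open>u = x \<circ> y\<close>, the terms with
  \<open>(x|x)\<close> combine to \<open>(x|x) \<otimes> \<Delta>(y)\<close>, and
  \<open>T \<Delta> = - \<Delta>\<close> turns the others into
  \<open>(T H(x) - H(x)) \<otimes> \<Delta>(y)\<close>. Compatibility of associativity with
  \<open>H\<close> rests on this multiplicativity.\<close>

lemma Delta_circ [simp]:
  assumes "x \<in> carrier (sq_e M)" "y \<in> carrier (sq_e N)"
  shows "sq_Delta (M \<diamond> N) (circ M N x y) = pure_ee M N (sq_Delta M x) (sq_Delta N y)"
  using assms
  by (simp add: T.Delta_eq M.Delta_eq N.Delta_eq)
    (rule rep_eqI, (rule T.reps | rule T.rep_atom, simp; fail)+, simp add: algebra_simps)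

text \<open>Apply \<open>P T = P\<close> to \<open>a \<otimes> T b\<close>.\<close>

lemma P_pure_T:
  assumes "a \<in> carrier (sq_ee M)" "b \<in> carrier (sq_ee N)"
  shows "sq_P (M \<diamond> N) (pure_ee M N (sq_T M a) b) =
    inv\<^bsub>sq_e (M \<diamond> N)\<^esub> sq_P (M \<diamond> N) (pure_ee M N a (sq_T N b))"
  using T.P_T[of "pure_ee M N a (sq_T N b)"] assms by (simp flip: T.P_T[of "pure_ee M N a (sq_T N b)"] del: T.P_T)

end

section \<open>Generators\<close>

definition gen_e :: "('a, 'b) sq_grp \<Rightarrow> 'a set \<Rightarrow> bool"
  where "gen_e M S \<longleftrightarrow> S \<subseteq> carrier (sq_e M) \<and>
    carrier (sq_e M) = generate (sq_e M) (S \<union> sq_P M ` carrier (sq_ee M))"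

definition gen_ee :: "('a, 'b) sq_grp \<Rightarrow> 'b set \<Rightarrow> bool"
  where "gen_ee M S \<longleftrightarrow> S \<subseteq> carrier (sq_ee M) \<and> carrier (sq_ee M) = generate (sq_ee M) S"

lemma (in group) generate_carrier: "generate G (carrier G) = carrier G"
  using generate_incl[of "carrier G"] by (auto intro: generate.incl)

lemma (in group) generate_induct [consumes 1, case_names closed incl mult inv one]:
  assumes "u \<in> generate G S" "S \<subseteq> carrier G"
    and "\<And>s. s \<in> S \<Longrightarrow> P s"
    and "\<And>u v. \<lbrakk>u \<in> carrier G; v \<in> carrier G; P u; P v\<rbrakk> \<Longrightarrow> P (u \<otimes> v)"
    and "\<And>u. \<lbrakk>u \<in> carrier G; P u\<rbrakk> \<Longrightarrow> P (inv u)"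
    and "P \<one>"
  shows "P u"
  using assms(1)
proof induction
  case (inv s)
  then show ?case using assms(2,3,5) by blast
next
  case (eng u v)
  then show ?case using assms(4) generate_in_carrier[OF assms(2)] by blast
qed (use assms in blast)+

context square_group
begin

lemma gen_carrier: "gen_e M (carrier (sq_e M))" "gen_ee M (carrier (sq_ee M))"
proof -
  have "carrier (sq_e M) \<union> sq_P M ` carrier (sq_ee M) = carrier (sq_e M)" by auto
  then show "gen_e M (carrier (sq_e M))" "gen_ee M (carrier (sq_ee M))"
    by (simp_all add: gen_e_def gen_ee_def e.generate_carrier ee.generate_carrier)
qed

lemma gen_e_closed: "gen_e M S \<Longrightarrow> S \<union> sq_P M ` carrier (sq_ee M) \<subseteq> carrier (sq_e M)"
  by (auto simp: gen_e_def)

end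

context sq_pair
begin

lemma gen_ee_tensor:
  assumes S: "gen_ee M S" and S': "gen_ee N S'"
  shows "gen_ee (M \<diamond> N) {pure_ee M N a b |a b. a \<in> S \<and> b \<in> S'}" (is "gen_ee _ ?U")
proof -
  have sub: "S \<subseteq> carrier (sq_ee M)" "S' \<subseteq> carrier (sq_ee N)" using S S' by (auto simp: gen_ee_def)
  have U: "?U \<subseteq> carrier (sq_ee (M \<diamond> N))" using sub by (auto intro!: t_pure_simps)
  interpret G: subgroup "generate (sq_ee (M \<diamond> N)) ?U" "sq_ee (M \<diamond> N)"
    by (rule T.ee.generate_is_subgroup[OF U])
  have 1: "pure_ee M N a b \<in> generate (sq_ee (M \<diamond> N)) ?U" if a: "a \<in> S" and b: "b \<in> carrier (sq_ee N)" for a b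
  proof -
    have "b \<in> generate (sq_ee N) S'" using b S' by (simp add: gen_ee_def)
    then show ?thesis
    proof (induction rule: N.ee.generate_induct)
      case (incl s)
      then show ?case using a by (blast intro: generate.incl)
    qed (use a sub in \<open>auto simp: subset_iff\<close>)
  qed
  have 2: "pure_ee M N a b \<in> generate (sq_ee (M \<diamond> N)) ?U" if "a \<in> carrier (sq_ee M)" and b: "b \<in> carrier (sq_ee N)" for a b
  proof -
    have "a \<in> generate (sq_ee M) S" using that S by (simp add: gen_ee_def)
    then show ?thesis
      by (induction rule: M.ee.generate_induct) (use 1 b sub in auto)
  qed
  have "w \<in> generate (sq_ee (M \<diamond> N)) ?U" if "w \<in> carrier (sq_ee (M \<diamond> N))" for w
    using that by (induction rule: t_induct) (use 2 in auto)
  then show ?thesis using U G.subset by (auto simp: gen_ee_def)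
qed

text \<open>The right variable is treated first, for \<open>x\<close> in \<open>S\<close>, where
  \<open>circ\<close> is a homomorphism; then the left variable, where the corrections of relation
  (3) lie in the image of \<open>P\<close> and hence in the generated subgroup.\<close>

lemma gen_e_tensor:
  assumes S: "gen_e M S" and S': "gen_e N S'"
  shows "gen_e (M \<diamond> N) {circ M N x y |x y. x \<in> S \<and> y \<in> S'}" (is "gen_e _ ?U")
proof -
  let ?V = "?U \<union> sq_P (M \<diamond> N) ` carrier (sq_ee (M \<diamond> N))"
  have sub: "S \<subseteq> carrier (sq_e M)" "S' \<subseteq> carrier (sq_e N)" using S S' by (auto simp: gen_e_def)
  have U: "?U \<subseteq> carrier (sq_e (M \<diamond> N))" using sub by (auto intro!: t_circ_closed)
  then have V: "?V \<subseteq> carrier (sq_e (M \<diamond> N))" by auto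
  interpret G: subgroup "generate (sq_e (M \<diamond> N)) ?V" "sq_e (M \<diamond> N)"
    by (rule T.e.generate_is_subgroup[OF V])
  have P: "sq_P (M \<diamond> N) w \<in> generate (sq_e (M \<diamond> N)) ?V" if "w \<in> carrier (sq_ee (M \<diamond> N))" for w
    using that by (blast intro: generate.incl)
  have 1: "circ M N x y \<in> generate (sq_e (M \<diamond> N)) ?V" if x: "x \<in> S" and y: "y \<in> carrier (sq_e N)" for x y
  proof -
    have xM: "x \<in> carrier (sq_e M)" using x sub by auto
    interpret h: group_hom "sq_e N" "sq_e (M \<diamond> N)" "circ M N x"
      using xM by (auto simp: group_hom_def group_hom_axioms_def N.e.is_group T.e.is_group intro!: homI)
    have "y \<in> generate (sq_e N) (S' \<union> sq_P N ` carrier (sq_ee N))" using y S' by (simp add: gen_e_def)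
    then show ?thesis
    proof (induction rule: N.e.generate_induct)
      case (incl s)
      then show ?case
      proof
        assume "s \<in> S'"
        then show ?thesis using x by (blast intro: generate.incl)
      next
        assume "s \<in> sq_P N ` carrier (sq_ee N)"
        then show ?thesis using xM P by auto
      qed
    qed (use xM sub in \<open>auto simp: subset_iff\<close>)
  qed
  have 2: "circ M N x y \<in> generate (sq_e (M \<diamond> N)) ?V" if "x \<in> carrier (sq_e M)" and y: "y \<in> carrier (sq_e N)" for x y
  proof -
    have circ_one: "circ M N \<one>\<^bsub>sq_e M\<^esub> y = \<one>\<^bsub>sq_e (M \<diamond> N)\<^esub>"
      using t_P_circ[of "\<one>\<^bsub>sq_ee M\<^esub>" y] y by simp
    have "x \<in> generate (sq_e M) (S \<union> sq_P M ` carrier (sq_ee M))" using that S by (simp add: gen_e_def)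
    then show ?thesis
    proof (induction rule: M.e.generate_induct)
      case (incl s)
      then show ?case using 1 y P by auto
    next
      case (mult u v)
      then show ?case using P y by (simp add: t_circ_left)
    next
      case (inv u)
      let ?w = "sq_P (M \<diamond> N) (pure_ee M N (sq_cross M (inv\<^bsub>sq_e M\<^esub> u) u) (sq_H N y))"
      \<comment> \<open>As \<open>circ\<close> is not additive on the left, \<open>circ\<close> of
        an inverse is computed from relation (3) for \<open>u\<close> and its inverse, whose product
        gives the unit.\<close>
      have "circ M N u y \<otimes>\<^bsub>sq_e (M \<diamond> N)\<^esub> circ M N (inv\<^bsub>sq_e M\<^esub> u) y \<otimes>\<^bsub>sq_e (M \<diamond> N)\<^esub> ?w = \<one>\<^bsub>sq_e (M \<diamond> N)\<^esub>"
        using t_circ_left[of u "inv\<^bsub>sq_e M\<^esub> u" y] inv y circ_one by simp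
      then have "circ M N u y \<otimes>\<^bsub>sq_e (M \<diamond> N)\<^esub> (circ M N (inv\<^bsub>sq_e M\<^esub> u) y \<otimes>\<^bsub>sq_e (M \<diamond> N)\<^esub> ?w) = \<one>\<^bsub>sq_e (M \<diamond> N)\<^esub>"
        using inv y by (simp add: T.e.m_assoc)
      then have "circ M N (inv\<^bsub>sq_e M\<^esub> u) y \<otimes>\<^bsub>sq_e (M \<diamond> N)\<^esub> ?w = inv\<^bsub>sq_e (M \<diamond> N)\<^esub> circ M N u y"
        using inv y by (intro T.e.inv_equality[OF T.e.inv_comm, symmetric]) simp_all
      then have "circ M N (inv\<^bsub>sq_e M\<^esub> u) y =
          inv\<^bsub>sq_e (M \<diamond> N)\<^esub> circ M N u y \<otimes>\<^bsub>sq_e (M \<diamond> N)\<^esub> inv\<^bsub>sq_e (M \<diamond> N)\<^esub> ?w"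
        using inv y by (intro T.e.inv_solve_right[THEN iffD2]) simp_all
      moreover have "?w \<in> generate (sq_e (M \<diamond> N)) ?V" using inv y by (intro P) simp
      ultimately show ?case using inv(2) by (simp only:) (intro G.m_closed G.m_inv_closed)
    next
      case one
      show ?case by (simp add: circ_one G.one_closed)
    qed (use sub in auto)
  qed
  have "s \<in> generate (sq_e (M \<diamond> N)) ?V" if s: "s \<in> te_gens" for s
  proof -
    from s consider x y where "x \<in> carrier (sq_e M)" "y \<in> carrier (sq_e N)" "s = circ M N x y"
      | a b where "a \<in> carrier (sq_ee M)" "b \<in> carrier (sq_ee N)" "s = bar M N a b" by blast
    then show ?thesis by cases (simp_all add: 2 P)
  qed
  then have "te_gens \<subseteq> generate (sq_e (M \<diamond> N)) ?V" by blast
  then have "generate (sq_e (M \<diamond> N)) te_gens \<subseteq> generate (sq_e (M \<diamond> N)) ?V"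
    by (rule T.e.generate_subgroup_incl) (rule G.subgroup_axioms)
  then have "carrier (sq_e (M \<diamond> N)) \<subseteq> generate (sq_e (M \<diamond> N)) ?V"
    using te_generated by simp
  then show ?thesis using U G.subset unfolding gen_e_def by blast
qed

end

section \<open>Morphisms\<close>

locale sg_mor = M: square_group M + N: square_group N
  for M :: "('a, 'b) sq_grp" and N :: "('c, 'd) sq_grp" and f :: "('a, 'b, 'c, 'd) sg_arr" +
  assumes f: "f \<in> sg_hom M N"
begin

sublocale e: group_hom "sq_e M" "sq_e N" "map_e f"
  using f by (simp add: group_hom_def group_hom_axioms_def M.e.is_group N.e.is_group sg_hom_def)

sublocale ee: group_hom "sq_ee M" "sq_ee N" "map_ee f"
  using f by (simp add: group_hom_def group_hom_axioms_def M.ee.is_group N.ee.is_group sg_hom_def)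

lemma map_H [simp]: "x \<in> carrier (sq_e M) \<Longrightarrow> map_ee f (sq_H M x) = sq_H N (map_e f x)"
  and map_P [simp]: "a \<in> carrier (sq_ee M) \<Longrightarrow> map_e f (sq_P M a) = sq_P N (map_ee f a)"
  and dom_cod [simp]: "sg_dom f = M" "sg_cod f = N"
  using f by (auto simp: sg_hom_def)

lemma map_cross [simp]:
  "\<lbrakk>x \<in> carrier (sq_e M); y \<in> carrier (sq_e M)\<rbrakk>
    \<Longrightarrow> map_ee f (sq_cross M x y) = sq_cross N (map_e f x) (map_e f y)"
  by (simp add: sq_cross_def cross_effect_def)

lemma map_T [simp]: "a \<in> carrier (sq_ee M) \<Longrightarrow> map_ee f (sq_T M a) = sq_T N (map_ee f a)"
  by (simp add: sq_T_def)

lemma map_Delta [simp]: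
  "x \<in> carrier (sq_e M) \<Longrightarrow> map_ee f (sq_Delta M x) = sq_Delta N (map_e f x)"
  by (simp add: M.Delta_eq N.Delta_eq)

end

text \<open>The e-level values on the image of \<open>P\<close> are forced by the ee-level, so
  agreement on \<open>S\<close> and \<open>S'\<close> suffices.\<close>

lemma sg_hom_eqI:
  assumes "square_group M" "square_group N" and f: "f \<in> sg_hom M N" and g: "g \<in> sg_hom M N"
    and S: "gen_e M S" and S': "gen_ee M S'"
    and e: "\<And>x. x \<in> S \<Longrightarrow> map_e f x = map_e g x"
    and ee: "\<And>a. a \<in> S' \<Longrightarrow> map_ee f a = map_ee g a"
  shows "f = g"
proof -
  interpret F: sg_mor M N f using assms by (simp add: sg_mor_def sg_mor_axioms_def)
  interpret G: sg_mor M N g using assms by (simp add: sg_mor_def sg_mor_axioms_def)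
  have eq_ee: "map_ee f a = map_ee g a" if "a \<in> carrier (sq_ee M)" for a
    by (rule F.M.ee.generate_hom_eq[OF F.N.ee.is_group F.ee.homh G.ee.homh _ ee, of S'])
      (use S' that in \<open>auto simp: gen_ee_def\<close>)
  have eq_e: "map_e f x = map_e g x" if x: "x \<in> carrier (sq_e M)" for x
  proof (rule F.M.e.generate_hom_eq[OF F.N.e.is_group F.e.homh G.e.homh F.M.gen_e_closed[OF S]])
    show "map_e f s = map_e g s" if "s \<in> S \<union> sq_P M ` carrier (sq_ee M)" for s
      using that e eq_ee by auto
    show "x \<in> generate (sq_e M) (S \<union> sq_P M ` carrier (sq_ee M))"
      using x S by (simp add: gen_e_def)
  qed
  have "map_e f = map_e g"
    by (rule extensionalityI[of _ "carrier (sq_e M)"]) (use f g eq_e in \<open>auto simp: sg_hom_def\<close>)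
  moreover have "map_ee f = map_ee g"
    by (rule extensionalityI[of _ "carrier (sq_ee M)"]) (use f g eq_ee in \<open>auto simp: sg_hom_def\<close>)
  ultimately show ?thesis by (intro sg_arr.equality) simp_all
qed

text \<open>Cross-effects are compared first; they are bilinear and vanish on the image of
  \<open>P\<close>. Then \<open>k H\<close> and \<open>H e\<close> are quadratic with the same
  cross-effect, so generators decide, and on the image of \<open>P\<close> the hypothesis on
  \<open>T\<close> gives the claim through \<open>H P = T + 1\<close>.\<close>

lemma sg_hom_from_generators:
  assumes "square_group M" "square_group N"
    and e: "e \<in> hom (sq_e M) (sq_e N)" and k: "k \<in> hom (sq_ee M) (sq_ee N)"
    and P: "\<And>a. a \<in> carrier (sq_ee M) \<Longrightarrow> e (sq_P M a) = sq_P N (k a)"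
    and T: "\<And>a. a \<in> carrier (sq_ee M) \<Longrightarrow> k (sq_T M a) = sq_T N (k a)"
    and S: "gen_e M S"
    and cross: "\<And>s t. \<lbrakk>s \<in> S; t \<in> S\<rbrakk> \<Longrightarrow> k (sq_cross M s t) = sq_cross N (e s) (e t)"
    and H: "\<And>s. s \<in> S \<Longrightarrow> k (sq_H M s) = sq_H N (e s)"
  shows "\<lparr>sg_dom = M, sg_cod = N, map_e = restrict e (carrier (sq_e M)),
    map_ee = restrict k (carrier (sq_ee M))\<rparr> \<in> sg_hom M N"
proof -
  interpret M: square_group M by fact
  interpret N: square_group N by fact
  interpret e: group_hom "sq_e M" "sq_e N" e
    using e by (simp add: group_hom_def group_hom_axioms_def M.e.is_group N.e.is_group)
  interpret k: group_hom "sq_ee M" "sq_ee N" k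
    using k by (simp add: group_hom_def group_hom_axioms_def M.ee.is_group N.ee.is_group)
  let ?S = "S \<union> sq_P M ` carrier (sq_ee M)"
  have S': "?S \<subseteq> carrier (sq_e M)" "carrier (sq_e M) = generate (sq_e M) ?S"
    using M.gen_e_closed[OF S] S by (simp_all add: gen_e_def)
  have b1: "bihom (sq_e M) (sq_e M) (sq_ee N) (\<lambda>x y. k (sq_cross M x y))"
    by (rule bihomI) simp_all
  have b2: "bihom (sq_e M) (sq_e M) (sq_ee N) (\<lambda>x y. sq_cross N (e x) (e y))"
    by (rule bihomI) simp_all
  have cr: "k (sq_cross M x y) = sq_cross N (e x) (e y)"
    if "x \<in> carrier (sq_e M)" "y \<in> carrier (sq_e M)" for x y
  proof (rule bihom_eq_on_generators[OF M.e.is_group M.e.is_group N.ee.is_group b1 b2 S' S' _ that])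
    fix s t assume st: "s \<in> ?S" "t \<in> ?S"
    then have mem: "s \<in> carrier (sq_e M)" "t \<in> carrier (sq_e M)" using S'(1) by blast+
    show "k (sq_cross M s t) = sq_cross N (e s) (e t)"
    proof (cases "s \<in> S \<and> t \<in> S")
      case True
      then show ?thesis using cross by blast
    next
      case False
      then show ?thesis using st mem by (auto simp: P)
    qed
  qed
  have "k (sq_H M x) = sq_H N (e x)" if x: "x \<in> carrier (sq_e M)" for x
  proof (rule quadratic_eq_on_generators[OF M.e.is_group N.ee.is_group b1 _ _ _ _ S' _ x])
    fix x y assume "x \<in> carrier (sq_e M)" "y \<in> carrier (sq_e M)"
    then show "k (sq_H M (x \<otimes>\<^bsub>sq_e M\<^esub> y)) =
        k (sq_H M x) \<otimes>\<^bsub>sq_ee N\<^esub> k (sq_H M y) \<otimes>\<^bsub>sq_ee N\<^esub> k (sq_cross M x y)"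
      "sq_H N (e (x \<otimes>\<^bsub>sq_e M\<^esub> y)) =
        sq_H N (e x) \<otimes>\<^bsub>sq_ee N\<^esub> sq_H N (e y) \<otimes>\<^bsub>sq_ee N\<^esub> k (sq_cross M x y)"
      by (simp_all add: M.H_mult N.H_mult cr)
  next
    fix s assume "s \<in> ?S"
    then show "k (sq_H M s) = sq_H N (e s)"
      using H by (auto simp: P T M.H_P N.H_P)
  qed simp_all
  then show ?thesis
    using restrict_hom[OF M.e.is_group e] restrict_hom[OF M.ee.is_group k]
    by (simp add: sg_hom_def P)
qed

context sq_pair
begin

text \<open>To define an arrow out of \<open>M \<diamond> N\<close> it suffices to check relations (2)-(5) and the
  compatibility with \<open>H\<close> on generators: (1) and (6) are automatic because the images of the
  \<open>bar\<close> generators lie in the image of \<open>P\<close> and \<open>P T = P\<close>.\<close>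

lemma tensor_morphism:
  assumes Q: "square_group Q" and S: "gen_e M S" and S': "gen_e N S'"
    and k: "bihom (sq_ee M) (sq_ee N) (sq_ee Q) k"
    and T: "\<And>a b. \<lbrakk>a \<in> carrier (sq_ee M); b \<in> carrier (sq_ee N)\<rbrakk>
      \<Longrightarrow> sq_T Q (k a b) = inv\<^bsub>sq_ee Q\<^esub> k (sq_T M a) (sq_T N b)"
    and f: "\<And>x y. \<lbrakk>x \<in> carrier (sq_e M); y \<in> carrier (sq_e N)\<rbrakk> \<Longrightarrow> f x y \<in> carrier (sq_e Q)"
    and f_right: "\<And>x y1 y2. \<lbrakk>x \<in> carrier (sq_e M); y1 \<in> carrier (sq_e N); y2 \<in> carrier (sq_e N)\<rbrakk>
      \<Longrightarrow> f x (y1 \<otimes>\<^bsub>sq_e N\<^esub> y2) = f x y1 \<otimes>\<^bsub>sq_e Q\<^esub> f x y2"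
    and f_left: "\<And>x1 x2 y. \<lbrakk>x1 \<in> carrier (sq_e M); x2 \<in> carrier (sq_e M); y \<in> carrier (sq_e N)\<rbrakk>
      \<Longrightarrow> f (x1 \<otimes>\<^bsub>sq_e M\<^esub> x2) y = f x1 y \<otimes>\<^bsub>sq_e Q\<^esub> f x2 y \<otimes>\<^bsub>sq_e Q\<^esub>
        sq_P Q (k (sq_cross M x2 x1) (sq_H N y))"
    and f_P: "\<And>x b. \<lbrakk>x \<in> carrier (sq_e M); b \<in> carrier (sq_ee N)\<rbrakk>
      \<Longrightarrow> f x (sq_P N b) = sq_P Q (k (sq_cross M x x) b)"
    and P_f: "\<And>a y. \<lbrakk>a \<in> carrier (sq_ee M); y \<in> carrier (sq_e N)\<rbrakk>
      \<Longrightarrow> f (sq_P M a) y = sq_P Q (k a (sq_Delta N y))"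
    and cross: "\<And>x y x' y'. \<lbrakk>x \<in> S; y \<in> S'; x' \<in> S; y' \<in> S'\<rbrakk>
      \<Longrightarrow> sq_cross Q (f x y) (f x' y') = k (sq_cross M x x') (sq_cross N y y')"
    and H: "\<And>x y. \<lbrakk>x \<in> S; y \<in> S'\<rbrakk>
      \<Longrightarrow> sq_H Q (f x y) = k (sq_cross M x x) (sq_H N y) \<otimes>\<^bsub>sq_ee Q\<^esub> k (sq_H M x) (sq_Delta N y)"
  obtains t where "t \<in> sg_hom (M \<diamond> N) Q"
    "\<And>x y. \<lbrakk>x \<in> carrier (sq_e M); y \<in> carrier (sq_e N)\<rbrakk> \<Longrightarrow> map_e t (circ M N x y) = f x y"
    "\<And>a b. \<lbrakk>a \<in> carrier (sq_ee M); b \<in> carrier (sq_ee N)\<rbrakk> \<Longrightarrow> map_ee t (pure_ee M N a b) = k a b"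
proof -
  interpret Q: square_group Q by fact
  note [simp] = bihom_closed[OF k] f
  obtain kk where kk: "kk \<in> hom (tensor_ee M N) (sq_ee Q)"
    "\<And>a b. \<lbrakk>a \<in> carrier (sq_ee M); b \<in> carrier (sq_ee N)\<rbrakk> \<Longrightarrow> kk (pure_ee M N a b) = k a b"
    using ab.tensor_lift_exists[OF Q.comm_group_ee k] by metis
  have kk1: "kk \<in> hom (sq_ee (M \<diamond> N)) (sq_ee Q)" using kk(1) by simp
  interpret kk: group_hom "sq_ee (M \<diamond> N)" "sq_ee Q" kk
    using kk1 by (simp add: group_hom_def group_hom_axioms_def Q.ee.is_group T.ee.is_group)
  obtain F where F: "F \<in> hom (tensor_e M N) (sq_e Q)"
    "\<And>x y. \<lbrakk>x \<in> carrier (sq_e M); y \<in> carrier (sq_e N)\<rbrakk> \<Longrightarrow> F (circ M N x y) = f x y"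
    "\<And>a b. \<lbrakk>a \<in> carrier (sq_ee M); b \<in> carrier (sq_ee N)\<rbrakk> \<Longrightarrow> F (bar M N a b) = sq_P Q (k a b)"
  proof (rule tensor_e_hom[OF Q.e.is_group, of f "\<lambda>a b. sq_P Q (k a b)"])
    show "bihom (sq_ee M) (sq_ee N) (sq_e Q) (\<lambda>a b. sq_P Q (k a b))"
      by (rule bihomI) (simp_all add: bihom_left[OF k] bihom_right[OF k])
    show "central (sq_e Q) (sq_P Q (k a b))" if "a \<in> carrier (sq_ee M)" "b \<in> carrier (sq_ee N)" for a b
      using that by (simp add: Q.P_central)
    \<comment> \<open>By the hypothesis on \<open>T\<close> at \<open>T a\<close>,
      \<open>T b\<close>, applying \<open>T\<close> to this argument gives \<open>- k a b\<close>;
      then use \<open>P T = P\<close>.\<close>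
    show "sq_P Q (k (sq_T M a) (sq_T N b)) = inv\<^bsub>sq_e Q\<^esub> sq_P Q (k a b)"
      if "a \<in> carrier (sq_ee M)" "b \<in> carrier (sq_ee N)" for a b
      using T[of "sq_T M a" "sq_T N b"] Q.P_T[of "k (sq_T M a) (sq_T N b)"] that by simp
  qed (use f f_right f_left f_P P_f in \<open>simp_all, blast?\<close>)
  have F1: "F \<in> hom (sq_e (M \<diamond> N)) (sq_e Q)" using F(1) by simp
  have FP: "F (sq_P (M \<diamond> N) w) = sq_P Q (kk w)" if "w \<in> carrier (sq_ee (M \<diamond> N))" for w
    using that
  proof (induction rule: t_induct)
    case (pure a b)
    then show ?case using F(3)[OF pure] by (simp add: kk)
  next
    case (mult u v)
    then show ?case by (simp add: hom_mult[OF F1])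
  qed
  have kT: "kk (sq_T (M \<diamond> N) w) = sq_T Q (kk w)" if "w \<in> carrier (sq_ee (M \<diamond> N))" for w
    using that by (induction rule: t_induct) (simp_all add: kk T)
  let ?t = "\<lparr>sg_dom = M \<diamond> N, sg_cod = Q, map_e = restrict F (carrier (sq_e (M \<diamond> N))),
    map_ee = restrict kk (carrier (sq_ee (M \<diamond> N)))\<rparr>"
  have sub: "S \<subseteq> carrier (sq_e M)" "S' \<subseteq> carrier (sq_e N)" using S S' by (auto simp: gen_e_def)
  have "?t \<in> sg_hom (M \<diamond> N) Q"
  proof (rule sg_hom_from_generators[OF square_group_tensor Q F1 kk1 FP kT gen_e_tensor[OF S S']])
    fix s t assume "s \<in> {circ M N x y |x y. x \<in> S \<and> y \<in> S'}" "t \<in> {circ M N x y |x y. x \<in> S \<and> y \<in> S'}"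
    then show "kk (sq_cross (M \<diamond> N) s t) = sq_cross Q (F s) (F t)"
      using sub by (auto simp: subset_iff F kk cross)
  next
    fix s assume "s \<in> {circ M N x y |x y. x \<in> S \<and> y \<in> S'}"
    then show "kk (sq_H (M \<diamond> N) s) = sq_H Q (F s)"
      using sub by (auto simp: subset_iff F kk H)
  qed
  then show thesis by (rule that) (simp_all add: F kk)
qed

lemma arr_eqI_gen:
  assumes "square_group Q" "f \<in> sg_hom (M \<diamond> N) Q" "g \<in> sg_hom (M \<diamond> N) Q"
    and "gen_e M S" "gen_e N S'" "gen_ee M U" "gen_ee N U'"
    and "\<And>x y. \<lbrakk>x \<in> S; y \<in> S'\<rbrakk> \<Longrightarrow> map_e f (circ M N x y) = map_e g (circ M N x y)"
    and "\<And>a b. \<lbrakk>a \<in> U; b \<in> U'\<rbrakk> \<Longrightarrow> map_ee f (pure_ee M N a b) = map_ee g (pure_ee M N a b)"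
  shows "f = g"
  by (rule sg_hom_eqI[OF square_group_tensor assms(1-3) gen_e_tensor[OF assms(4,5)]
        gen_ee_tensor[OF assms(6,7)]])
    (use assms(8,9) in auto)

lemma arr_eqI:
  assumes "square_group Q" "gen_e M S" "gen_e N S'" "f \<in> sg_hom (M \<diamond> N) Q" "g \<in> sg_hom (M \<diamond> N) Q"
    and "\<And>x y. \<lbrakk>x \<in> S; y \<in> S'\<rbrakk> \<Longrightarrow> map_e f (circ M N x y) = map_e g (circ M N x y)"
    and "\<And>a b. \<lbrakk>a \<in> carrier (sq_ee M); b \<in> carrier (sq_ee N)\<rbrakk>
      \<Longrightarrow> map_ee f (pure_ee M N a b) = map_ee g (pure_ee M N a b)"
  shows "f = g"
  by (rule arr_eqI_gen[OF assms(1,4,5,2,3) M.gen_carrier(2) N.gen_carrier(2) assms(6,7)])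

end

lemma sg_isoI:
  assumes "f \<in> sg_hom M N" "g \<in> sg_hom N M" "g \<cdot> f = sg_id M" "f \<cdot> g = sg_id N"
  shows "f \<in> sg_iso M N"
  using assms by (auto simp: sg_iso_def)

lemma sg_comp_simps:
  assumes "f \<in> sg_hom M N"
  shows "x \<in> carrier (sq_e M) \<Longrightarrow> map_e (g \<cdot> f) x = map_e g (map_e f x)"
    and "a \<in> carrier (sq_ee M) \<Longrightarrow> map_ee (g \<cdot> f) a = map_ee g (map_ee f a)"
  using assms by (simp_all add: sg_comp_def compose_def sg_hom_def)

lemma sg_id_simps [simp]:
  "x \<in> carrier (sq_e M) \<Longrightarrow> map_e (sg_id M) x = x"
  "a \<in> carrier (sq_ee M) \<Longrightarrow> map_ee (sg_id M) a = a"
  by (simp_all add: sg_id_def)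

section \<open>Functoriality\<close>

locale sg_mor_pair = F: sg_mor M M' f + G: sg_mor N N' g
  for M :: "('a, 'b) sq_grp" and M' :: "('c, 'd) sq_grp" and f :: "('a, 'b, 'c, 'd) sg_arr"
    and N :: "('e, 'f) sq_grp" and N' :: "('g, 'h) sq_grp" and g :: "('e, 'f, 'g, 'h) sg_arr"
begin

sublocale MN: sq_pair M N ..
sublocale MN': sq_pair M' N' ..

text \<open>The prescribed values on \<open>bar\<close> follow from those on pure tensors by
  compatibility with \<open>P\<close>. The specifications of the braiding and the associator are
  reduced in the same way.\<close>

lemma is_tensor_arr_iff:
  "is_tensor_arr f g t \<longleftrightarrow> t \<in> sg_hom (M \<diamond> N) (M' \<diamond> N') \<and>
    (\<forall>x \<in> carrier (sq_e M). \<forall>y \<in> carrier (sq_e N).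
      map_e t (circ M N x y) = circ M' N' (map_e f x) (map_e g y)) \<and>
    (\<forall>a \<in> carrier (sq_ee M). \<forall>b \<in> carrier (sq_ee N).
      map_ee t (pure_ee M N a b) = pure_ee M' N' (map_ee f a) (map_ee g b))"
    (is "_ \<longleftrightarrow> ?R")
proof
  assume t: ?R
  then interpret t: sg_mor "M \<diamond> N" "M' \<diamond> N'" t
    by (simp add: sg_mor_def sg_mor_axioms_def MN.square_group_tensor MN'.square_group_tensor)
  show "is_tensor_arr f g t" using t by (simp add: is_tensor_arr_def)
qed (simp add: is_tensor_arr_def)

lemma ex1_tensor_arr: "\<exists>!t. is_tensor_arr f g t"
proof (rule ex_ex1I)
  obtain t where "t \<in> sg_hom (M \<diamond> N) (M' \<diamond> N')"
    "\<And>x y. \<lbrakk>x \<in> carrier (sq_e M); y \<in> carrier (sq_e N)\<rbrakk> \<Longrightarrow>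
      map_e t (circ M N x y) = circ M' N' (map_e f x) (map_e g y)"
    "\<And>a b. \<lbrakk>a \<in> carrier (sq_ee M); b \<in> carrier (sq_ee N)\<rbrakk> \<Longrightarrow>
      map_ee t (pure_ee M N a b) = pure_ee M' N' (map_ee f a) (map_ee g b)"
  proof (rule MN.tensor_morphism[OF MN'.square_group_tensor F.M.gen_carrier(1) G.M.gen_carrier(1),
        of "\<lambda>a b. pure_ee M' N' (map_ee f a) (map_ee g b)" "\<lambda>x y. circ M' N' (map_e f x) (map_e g y)"])
    show "bihom (sq_ee M) (sq_ee N) (sq_ee (M' \<diamond> N')) (\<lambda>a b. pure_ee M' N' (map_ee f a) (map_ee g b))"
      by (rule bihomI) simp_all
  qed (simp_all add: MN'.t_circ_left, blast?)
  then show "\<exists>t. is_tensor_arr f g t" unfolding is_tensor_arr_iff by blast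
  fix t t' assume "is_tensor_arr f g t" "is_tensor_arr f g t'"
  then show "t = t'"
    unfolding is_tensor_arr_iff
    by (intro MN.arr_eqI[OF MN'.square_group_tensor F.M.gen_carrier(1) G.M.gen_carrier(1)]) auto
qed

lemma is_tensor_arr: "is_tensor_arr f g (f \<diamond>\<^sub>m g)"
  unfolding tensor_arr_def by (rule theI'[OF ex1_tensor_arr])

lemma tensor_arr_hom: "f \<diamond>\<^sub>m g \<in> sg_hom (M \<diamond> N) (M' \<diamond> N')"
  and tensor_arr_e [simp]: "\<lbrakk>x \<in> carrier (sq_e M); y \<in> carrier (sq_e N)\<rbrakk>
      \<Longrightarrow> map_e (f \<diamond>\<^sub>m g) (circ M N x y) = circ M' N' (map_e f x) (map_e g y)"
  and tensor_arr_ee [simp]: "\<lbrakk>a \<in> carrier (sq_ee M); b \<in> carrier (sq_ee N)\<rbrakk>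
      \<Longrightarrow> map_ee (f \<diamond>\<^sub>m g) (pure_ee M N a b) = pure_ee M' N' (map_ee f a) (map_ee g b)"
  using is_tensor_arr by (auto simp: is_tensor_arr_iff)

sublocale fg: sg_mor "M \<diamond> N" "M' \<diamond> N'" "f \<diamond>\<^sub>m g"
  by (simp add: sg_mor_def sg_mor_axioms_def tensor_arr_hom MN.square_group_tensor
      MN'.square_group_tensor)

end

lemma sg_mor_id: "square_group M \<Longrightarrow> sg_mor M M (sg_id M)"
  by (simp add: sg_mor_def sg_mor_axioms_def sg_id_hom)

lemma sg_mor_comp: "\<lbrakk>sg_mor L M f; sg_mor M N g\<rbrakk> \<Longrightarrow> sg_mor L N (g \<cdot> f)"
  by (auto simp: sg_mor_def sg_mor_axioms_def intro: sg_comp_hom)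

lemma sg_morI: "\<lbrakk>square_group M; square_group N; f \<in> sg_hom M N\<rbrakk> \<Longrightarrow> sg_mor M N f"
  by (simp add: sg_mor_def sg_mor_axioms_def)

lemma sq_pairI: "\<lbrakk>square_group M; square_group N\<rbrakk> \<Longrightarrow> sq_pair M N"
  by (simp add: sq_pair_def)

lemma sg_mor_pairI: "\<lbrakk>sg_mor M M' f; sg_mor N N' g\<rbrakk> \<Longrightarrow> sg_mor_pair M M' f N N' g"
  by (simp add: sg_mor_pair_def)

lemma tensor_arr_id:
  assumes "square_group M" "square_group N"
  shows "sg_id M \<diamond>\<^sub>m sg_id N = sg_id (M \<diamond> N)"
proof -
  interpret sg_mor_pair M M "sg_id M" N N "sg_id N"
    by (intro sg_mor_pairI sg_mor_id assms)
  show ?thesis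
    by (rule MN.arr_eqI[OF MN.square_group_tensor F.M.gen_carrier(1) G.M.gen_carrier(1)
          tensor_arr_hom sg_id_hom[OF MN.square_group_tensor]]) simp_all
qed

lemma tensor_arr_comp:
  assumes "sg_mor M M' f" "sg_mor M' M'' f'" "sg_mor N N' g" "sg_mor N' N'' g'"
  shows "(f' \<cdot> f) \<diamond>\<^sub>m (g' \<cdot> g) = (f' \<diamond>\<^sub>m g') \<cdot> (f \<diamond>\<^sub>m g)"
proof -
  interpret a: sg_mor_pair M M' f N N' g by (intro sg_mor_pairI assms)
  interpret b: sg_mor_pair M' M'' f' N' N'' g' by (intro sg_mor_pairI assms)
  interpret c: sg_mor_pair M M'' "f' \<cdot> f" N N'' "g' \<cdot> g"
    by (intro sg_mor_pairI sg_mor_comp[of M M' f] sg_mor_comp[of N N' g] assms)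
  show ?thesis
    by (rule a.MN.arr_eqI[OF b.MN'.square_group_tensor a.F.M.gen_carrier(1) a.G.M.gen_carrier(1)
          c.tensor_arr_hom sg_comp_hom[OF a.MN.square_group_tensor a.tensor_arr_hom b.tensor_arr_hom]])
      (simp_all add: sg_comp_simps[OF a.tensor_arr_hom] sg_comp_simps[OF a.F.f] sg_comp_simps[OF a.G.f])
qed

section \<open>Integer powers and elements killed by \<open>P\<close>\<close>

context square_group
begin

lemmas preps = prep_mult[OF group_e] prep_one[OF group_e]
lemmas prep_P = prep_central[OF group_e P_central] prep_central_inv[OF group_e P_central]
lemmas prep_at = prep_atom[OF group_e]

lemma P_cross_self [simp]: "x \<in> carrier (sq_e M) \<Longrightarrow> sq_P M (sq_cross M x x) = \<one>\<^bsub>sq_e M\<^esub>"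
  by (simp add: P_cross e.m_assoc e.mult_inv_cancel)

text \<open>\<open>P T = P\<close> cancels two terms of \<open>Delta_eq\<close>, and
  \<open>P (x|x)\<close> is the commutator of \<open>x\<close> with itself. The left unit
  isomorphism needs this for relation (5).\<close>

lemma P_Delta [simp]: "x \<in> carrier (sq_e M) \<Longrightarrow> sq_P M (sq_Delta M x) = \<one>\<^bsub>sq_e M\<^esub>"
  by (simp add: Delta_eq)

lemma cross_pow:
  assumes "x \<in> carrier (sq_e M)" "y \<in> carrier (sq_e M)"
  shows "sq_cross M (x [^]\<^bsub>sq_e M\<^esub> (m::int)) (y [^]\<^bsub>sq_e M\<^esub> (n::int)) = sq_cross M x y [^]\<^bsub>sq_ee M\<^esub> (m * n)"
proof -
  have l: "group_hom (sq_e M) (sq_ee M) (\<lambda>x. sq_cross M x z)" if "z \<in> carrier (sq_e M)" for z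
    using that bihom_hom_left[OF cross_bihom]
    by (simp add: group_hom_def group_hom_axioms_def e.is_group ee.is_group)
  have r: "group_hom (sq_e M) (sq_ee M) (sq_cross M z)" if "z \<in> carrier (sq_e M)" for z
    using that bihom_hom_right[OF cross_bihom]
    by (simp add: group_hom_def group_hom_axioms_def e.is_group ee.is_group)
  show ?thesis
    using assms group_hom.hom_int_pow[OF l, of "y [^]\<^bsub>sq_e M\<^esub> n" x m] group_hom.hom_int_pow[OF r, of x y n]
    by (simp add: ee.int_pow_pow mult.commute)
qed

end

section \<open>The unit object\<close>

lemma Z_nil_sel: "sq_e Z_nil = integer_group" "sq_ee Z_nil = integer_group"
  by (simp_all add: Z_nil_def)

lemma Z_nil_simps [simp]:
  "carrier (sq_e Z_nil) = UNIV" "carrier (sq_ee Z_nil) = UNIV"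
  "m \<otimes>\<^bsub>sq_e Z_nil\<^esub> n = m + n" "m \<otimes>\<^bsub>sq_ee Z_nil\<^esub> n = m + n"
  "\<one>\<^bsub>sq_e Z_nil\<^esub> = 0" "\<one>\<^bsub>sq_ee Z_nil\<^esub> = 0"
  "inv\<^bsub>sq_e Z_nil\<^esub> n = - n" "inv\<^bsub>sq_ee Z_nil\<^esub> n = - n"
  "n [^]\<^bsub>sq_e Z_nil\<^esub> (k::int) = k * n" "n [^]\<^bsub>sq_ee Z_nil\<^esub> (k::int) = k * n"
  "n [^]\<^bsub>sq_e Z_nil\<^esub> (l::nat) = int l * n" "n [^]\<^bsub>sq_ee Z_nil\<^esub> (l::nat) = int l * n"
  "sq_H Z_nil n = n * (n - 1) div 2" "sq_P Z_nil n = 0"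
  by (simp_all add: Z_nil_def)

lemma binomial_even: "2 * (n * (n - 1) div 2) = n * (n - (1::int))"
  by (rule dvd_mult_div_cancel) simp

lemma binomial_add: "(m + n) * (m + n - 1) div 2 = m * (m - 1) div 2 + n * (n - 1) div 2 + m * (n::int)"
proof -
  have "2 * ((m + n) * (m + n - 1) div 2) = 2 * (m * (m - 1) div 2 + n * (n - 1) div 2 + m * n)"
    unfolding distrib_left binomial_even by (simp add: algebra_simps)
  then show ?thesis by (simp only: mult_left_cancel[OF zero_neq_numeral[symmetric]])
qed

lemma Z_nil_cross [simp]: "sq_cross Z_nil m n = m * n"
  by (simp add: sq_cross_def cross_effect_def binomial_add)

lemma square_group_Z_nil: "square_group Z_nil"
proof (rule square_group.intro)
  show "group (sq_e Z_nil)" "comm_group (sq_ee Z_nil)"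
    by (simp_all add: Z_nil_sel abelian_integer_group)
  show "quadratic_map (sq_e Z_nil) (sq_ee Z_nil) (sq_H Z_nil)"
    using Z_nil_cross unfolding sq_cross_def quadratic_map_def
    by (auto intro!: homI simp: algebra_simps)
  show "sq_P Z_nil \<in> hom (sq_ee Z_nil) (sq_e Z_nil)" by (auto intro!: homI)
qed (simp_all add: int_pow_int)

lemma Z_nil_T [simp]: "sq_T Z_nil n = - n"
  by (simp add: sq_T_def)

text \<open>Here \<open>T = - 1\<close> and \<open>(n|n) = n^2\<close>, so \<open>Delta_eq\<close>
  reads \<open>n^2 - n (n - 1) = n\<close>.\<close>

lemma Z_nil_Delta [simp]: "sq_Delta Z_nil n = n"
proof -
  interpret square_group Z_nil by (rule square_group_Z_nil)
  show ?thesis using binomial_even[of n] by (simp add: Delta_eq algebra_simps)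
qed

text \<open>Arrows out of a product with \<open>Z_nil\<close> can thus be tested at the integer 1,
  where \<open>H\<close> is 0 and the cross-effect with itself is 1.\<close>

lemma gen_e_Z_nil: "gen_e Z_nil {1}"
proof -
  interpret square_group Z_nil by (rule square_group_Z_nil)
  have "1 [^]\<^bsub>sq_e Z_nil\<^esub> n \<in> generate (sq_e Z_nil) {1, 0}" for n :: int
    by (intro e.subgroup_int_pow_closed e.generate_is_subgroup generate.incl) auto
  then have "generate (sq_e Z_nil) {1, 0} = UNIV" by auto
  moreover have "{1::int} \<union> sq_P Z_nil ` UNIV = {1, 0}" by auto
  ultimately show ?thesis by (simp add: gen_e_def)
qed

context square_group
begin

text \<open>The power formula for groups of nilpotency class 2. To cover negative exponents
  uniformly, the right side is shown to be a homomorphism in \<open>n\<close> from the integers,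
  determined by its value at 1.\<close>

lemma pow_mult_hom:
  assumes xy: "x \<in> carrier (sq_e M)" "y \<in> carrier (sq_e M)"
  shows "(x \<otimes>\<^bsub>sq_e M\<^esub> y) [^]\<^bsub>sq_e M\<^esub> (n::int) = x [^]\<^bsub>sq_e M\<^esub> n \<otimes>\<^bsub>sq_e M\<^esub> y [^]\<^bsub>sq_e M\<^esub> n \<otimes>\<^bsub>sq_e M\<^esub>
    sq_P M (sq_cross M y x [^]\<^bsub>sq_ee M\<^esub> (n * (n - 1) div 2))"
proof -
  let ?c = "sq_cross M y x"
  define g where "g n = x [^]\<^bsub>sq_e M\<^esub> n \<otimes>\<^bsub>sq_e M\<^esub> y [^]\<^bsub>sq_e M\<^esub> n \<otimes>\<^bsub>sq_e M\<^esub>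
    sq_P M (?c [^]\<^bsub>sq_ee M\<^esub> (n * (n - 1) div 2))" for n :: int
  have g: "g \<in> hom (sq_e Z_nil) (sq_e M)"
  proof (rule homI)
    fix m n :: int
    let ?P = "\<lambda>k. sq_P M (?c [^]\<^bsub>sq_ee M\<^esub> (k::int))"
    \<comment> \<open>Moving the \<open>m\<close>-th power past the \<open>n\<close>-th costs
      \<open>m * n\<close> copies of the commutator, exactly the extra term in
      \<open>binomial_add\<close>.\<close>
    have com: "y [^]\<^bsub>sq_e M\<^esub> m \<otimes>\<^bsub>sq_e M\<^esub> x [^]\<^bsub>sq_e M\<^esub> n =
        x [^]\<^bsub>sq_e M\<^esub> n \<otimes>\<^bsub>sq_e M\<^esub> y [^]\<^bsub>sq_e M\<^esub> m \<otimes>\<^bsub>sq_e M\<^esub> ?P (m * n)"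
      using commutation[of "y [^]\<^bsub>sq_e M\<^esub> m" "x [^]\<^bsub>sq_e M\<^esub> n"] xy by (simp add: cross_pow)
    have "g m \<otimes>\<^bsub>sq_e M\<^esub> g n = x [^]\<^bsub>sq_e M\<^esub> m \<otimes>\<^bsub>sq_e M\<^esub> (y [^]\<^bsub>sq_e M\<^esub> m \<otimes>\<^bsub>sq_e M\<^esub> x [^]\<^bsub>sq_e M\<^esub> n)
        \<otimes>\<^bsub>sq_e M\<^esub> y [^]\<^bsub>sq_e M\<^esub> n \<otimes>\<^bsub>sq_e M\<^esub> ?P (m * (m - 1) div 2) \<otimes>\<^bsub>sq_e M\<^esub> ?P (n * (n - 1) div 2)"
      unfolding g_def using xy
      by - (rule prep_eqI, (rule preps | (rule prep_P, simp; fail) | rule prep_at, simp; fail)+,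
          simp_all add: algebra_simps)
    also have "\<dots> = (x [^]\<^bsub>sq_e M\<^esub> m \<otimes>\<^bsub>sq_e M\<^esub> x [^]\<^bsub>sq_e M\<^esub> n) \<otimes>\<^bsub>sq_e M\<^esub> (y [^]\<^bsub>sq_e M\<^esub> m
        \<otimes>\<^bsub>sq_e M\<^esub> y [^]\<^bsub>sq_e M\<^esub> n) \<otimes>\<^bsub>sq_e M\<^esub> (?P (m * (m - 1) div 2) \<otimes>\<^bsub>sq_e M\<^esub> ?P (n * (n - 1) div 2)
        \<otimes>\<^bsub>sq_e M\<^esub> ?P (m * n))"
      unfolding com using xy
      by - (rule prep_eqI, (rule preps | (rule prep_P, simp; fail) | rule prep_at, simp; fail)+,
          simp_all add: algebra_simps)
    also have "\<dots> = g (m + n)"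
      using xy by (simp add: g_def binomial_add e.int_pow_mult flip: P_mult ee.int_pow_mult)
    finally show "g (m \<otimes>\<^bsub>sq_e Z_nil\<^esub> n) = g m \<otimes>\<^bsub>sq_e M\<^esub> g n" by simp
  qed (use xy in \<open>simp add: g_def\<close>)
  interpret Z: square_group Z_nil by (rule square_group_Z_nil)
  have "g 1 = x \<otimes>\<^bsub>sq_e M\<^esub> y" using xy by (simp add: g_def)
  then show ?thesis
    using hom_int_pow[OF g _ Z.e.is_group e.is_group, of 1 n] by (simp flip: g_def)
qed

lemma ee_pow_hom: "bihom (sq_ee Z_nil) (sq_ee M) (sq_ee M) (\<lambda>n a. a [^]\<^bsub>sq_ee M\<^esub> n)"
  by (rule bihomI) (simp_all add: ee.int_pow_mult ee.int_pow_distrib)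

lemma T_pow: "a \<in> carrier (sq_ee M) \<Longrightarrow> sq_T M (a [^]\<^bsub>sq_ee M\<^esub> (n::int)) = sq_T M a [^]\<^bsub>sq_ee M\<^esub> n"
  by (rule T.hom_int_pow)

lemma P_pow: "a \<in> carrier (sq_ee M) \<Longrightarrow> sq_P M (a [^]\<^bsub>sq_ee M\<^esub> (n::int)) = sq_P M a [^]\<^bsub>sq_e M\<^esub> n"
  by (rule P.hom_int_pow)

end

locale sq_unit = square_group M for M :: "('a, 'b) sq_grp"
begin

sublocale Z: square_group Z_nil by (rule square_group_Z_nil)
sublocale ZM: sq_pair Z_nil M ..
sublocale MZ: sq_pair M Z_nil ..

lemma left_unitor_exists: "\<exists>l. is_left_unitor M l"
proof -
  \<comment> \<open>Relation (3), applied to an \<open>n\<close>-fold sum of 1, forces this formula: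
    each pair of summands contributes one \<open>P H(x)\<close>.\<close>
  let ?f = "\<lambda>(n::int) x. x [^]\<^bsub>sq_e M\<^esub> n \<otimes>\<^bsub>sq_e M\<^esub> sq_P M (sq_H M x [^]\<^bsub>sq_ee M\<^esub> (n * (n - 1) div 2))"
  obtain l where "l \<in> sg_hom (Z_nil \<diamond> M) M"
    "\<And>n x. \<lbrakk>n \<in> carrier (sq_e Z_nil); x \<in> carrier (sq_e M)\<rbrakk> \<Longrightarrow> map_e l (circ Z_nil M n x) = ?f n x"
    "\<And>n a. \<lbrakk>n \<in> carrier (sq_ee Z_nil); a \<in> carrier (sq_ee M)\<rbrakk> \<Longrightarrow> map_ee l (pure_ee Z_nil M n a) = a [^]\<^bsub>sq_ee M\<^esub> n"
  proof (rule ZM.tensor_morphism[OF square_group_axioms gen_e_Z_nil gen_carrier(1) ee_pow_hom, of ?f])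
    fix n :: int and y1 y2 assume y: "y1 \<in> carrier (sq_e M)" "y2 \<in> carrier (sq_e M)"
    let ?C = "n * (n - 1) div 2"
    \<comment> \<open>The commutators from the power formula cancel the cross term of
      \<open>H (y1 + y2)\<close>, since \<open>T (y2|y1) = - (y1|y2)\<close> and
      \<open>P T = P\<close>.\<close>
    have "sq_P M (sq_cross M y2 y1 [^]\<^bsub>sq_ee M\<^esub> ?C) = inv\<^bsub>sq_e M\<^esub> sq_P M (sq_cross M y1 y2 [^]\<^bsub>sq_ee M\<^esub> ?C)"
      using P_T[of "sq_cross M y2 y1 [^]\<^bsub>sq_ee M\<^esub> ?C"] y
      by (simp add: T_pow ee.int_pow_inv del: P_T)
    then show "?f n (y1 \<otimes>\<^bsub>sq_e M\<^esub> y2) = ?f n y1 \<otimes>\<^bsub>sq_e M\<^esub> ?f n y2"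
      using y
      by (simp add: pow_mult_hom H_mult ee.int_pow_distrib)
        (rule prep_eqI, (rule preps | (rule prep_P, simp; fail) | rule prep_at, simp; fail)+, simp_all add: algebra_simps)
  next
    fix m n :: int and y assume y: "y \<in> carrier (sq_e M)"
    show "?f (m \<otimes>\<^bsub>sq_e Z_nil\<^esub> n) y = ?f m y \<otimes>\<^bsub>sq_e M\<^esub> ?f n y \<otimes>\<^bsub>sq_e M\<^esub>
        sq_P M (sq_H M y [^]\<^bsub>sq_ee M\<^esub> sq_cross Z_nil n m)"
      using y
      by (simp add: binomial_add e.int_pow_mult ee.int_pow_mult mult.commute[of n m])
        (rule prep_eqI, (rule preps | (rule prep_P, simp; fail) | rule prep_at, simp; fail)+, simp_all add: algebra_simps)
  next
    fix n :: int and b assume b: "b \<in> carrier (sq_ee M)"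
    \<comment> \<open>As \<open>P H P = 2 P\<close>, the binomial term counts twice on the image of
      \<open>P\<close>; the total coefficient is \<open>n^2\<close>, the cross-effect of
      \<open>n\<close> with itself.\<close>
    have "n + (n * (n - 1) div 2 + n * (n - 1) div 2) = n * n"
      using binomial_even[of n] by (simp add: algebra_simps)
    then show "?f n (sq_P M b) = sq_P M (b [^]\<^bsub>sq_ee M\<^esub> sq_cross Z_nil n n)"
      using b by (simp add: H_P ee.int_pow_distrib P_pow flip: e.int_pow_mult)
  next
    fix a :: int and y assume "y \<in> carrier (sq_e M)"
    then show "?f (sq_P Z_nil a) y = sq_P M (sq_Delta M y [^]\<^bsub>sq_ee M\<^esub> a)"
      by (simp add: P_pow)
  qed (simp_all add: T_pow ee.int_pow_neg, blast?)
  then show ?thesis unfolding is_left_unitor_def by auto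
qed

text \<open>Additivity on the right sends \<open>circ x n\<close> to the \<open>n\<close>-th power
  of \<open>x\<close>. Relation (2) is addition of exponents, and relation (3) is
  \<open>pow_mult_hom\<close>, because \<open>H(n)\<close> is the binomial coefficient.\<close>

lemma right_unitor_exists: "\<exists>r. is_right_unitor M r"
proof -
  have k: "bihom (sq_ee M) (sq_ee Z_nil) (sq_ee M) (\<lambda>a n. a [^]\<^bsub>sq_ee M\<^esub> n)"
    using ee_pow_hom by (simp add: bihom_def)
  obtain r where "r \<in> sg_hom (M \<diamond> Z_nil) M"
    "\<And>x n. \<lbrakk>x \<in> carrier (sq_e M); n \<in> carrier (sq_e Z_nil)\<rbrakk> \<Longrightarrow> map_e r (circ M Z_nil x n) = x [^]\<^bsub>sq_e M\<^esub> n"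
    "\<And>a n. \<lbrakk>a \<in> carrier (sq_ee M); n \<in> carrier (sq_ee Z_nil)\<rbrakk> \<Longrightarrow> map_ee r (pure_ee M Z_nil a n) = a [^]\<^bsub>sq_ee M\<^esub> n"
  proof (rule MZ.tensor_morphism[OF square_group_axioms gen_carrier(1) gen_e_Z_nil k, of "\<lambda>x n. x [^]\<^bsub>sq_e M\<^esub> n"])
  qed (simp_all add: T_pow ee.int_pow_neg e.int_pow_mult pow_mult_hom P_pow, blast?)
  then show ?thesis unfolding is_right_unitor_def by auto
qed

lemma ex1_left_unitor: "\<exists>!l. is_left_unitor M l"
proof (rule ex_ex1I[OF left_unitor_exists])
  fix l l' assume "is_left_unitor M l" "is_left_unitor M l'"
  then show "l = l'"
    unfolding is_left_unitor_def
    by (intro ZM.arr_eqI[OF square_group_axioms gen_e_Z_nil gen_carrier(1)]) auto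
qed

lemma ex1_right_unitor: "\<exists>!r. is_right_unitor M r"
proof (rule ex_ex1I[OF right_unitor_exists])
  fix r r' assume "is_right_unitor M r" "is_right_unitor M r'"
  then show "r = r'"
    unfolding is_right_unitor_def
    by (intro MZ.arr_eqI[OF square_group_axioms gen_carrier(1) gen_e_Z_nil]) auto
qed

lemma is_left_unitor: "is_left_unitor M (left_unitor M)"
  unfolding left_unitor_def by (rule theI'[OF ex1_left_unitor])

lemma is_right_unitor: "is_right_unitor M (right_unitor M)"
  unfolding right_unitor_def by (rule theI'[OF ex1_right_unitor])

lemma left_unitor_hom: "left_unitor M \<in> sg_hom (Z_nil \<diamond> M) M"
  and left_unitor_simps [simp]:
    "a \<in> carrier (sq_ee M) \<Longrightarrow> map_ee (left_unitor M) (pure_ee Z_nil M n a) = a [^]\<^bsub>sq_ee M\<^esub> n"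
    "x \<in> carrier (sq_e M) \<Longrightarrow> map_e (left_unitor M) (circ Z_nil M 1 x) = x"
  using is_left_unitor by (auto simp: is_left_unitor_def)

lemma right_unitor_hom: "right_unitor M \<in> sg_hom (M \<diamond> Z_nil) M"
  and right_unitor_simps [simp]:
    "a \<in> carrier (sq_ee M) \<Longrightarrow> map_ee (right_unitor M) (pure_ee M Z_nil a n) = a [^]\<^bsub>sq_ee M\<^esub> n"
    "x \<in> carrier (sq_e M) \<Longrightarrow> map_e (right_unitor M) (circ M Z_nil x 1) = x"
  using is_right_unitor by (auto simp: is_right_unitor_def)

sublocale lu: sg_mor "Z_nil \<diamond> M" M "left_unitor M"
  by (rule sg_morI) (rule ZM.square_group_tensor square_group_axioms left_unitor_hom)+

sublocale ru: sg_mor "M \<diamond> Z_nil" M "right_unitor M"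
  by (rule sg_morI) (rule MZ.square_group_tensor square_group_axioms right_unitor_hom)+

lemma left_unitor_iso: "left_unitor M \<in> sg_iso (Z_nil \<diamond> M) M"
proof -
  \<comment> \<open>The inverse \<open>x \<mapsto> 1 \<circ> x\<close> is additive by relation (2).
    It respects \<open>H\<close> and \<open>T\<close> because at the integer 1 the values of
    \<open>H\<close>, cross-effect and \<open>T\<close> are 0, 1 and -1.\<close>
  let ?s = "\<lparr>sg_dom = M, sg_cod = Z_nil \<diamond> M, map_e = restrict (circ Z_nil M 1) (carrier (sq_e M)),
    map_ee = restrict (pure_ee Z_nil M 1) (carrier (sq_ee M))\<rparr>"
  have zero: "pure_ee Z_nil M 0 a = \<one>\<^bsub>sq_ee (Z_nil \<diamond> M)\<^esub>" if "a \<in> carrier (sq_ee M)" for a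
    using ZM.t_pure_simps(4)[OF that] by simp
  have neg: "pure_ee Z_nil M (- 1) a = inv\<^bsub>sq_ee (Z_nil \<diamond> M)\<^esub> pure_ee Z_nil M 1 a" if "a \<in> carrier (sq_ee M)" for a
    using ZM.t_pure_simps(6)[OF _ that, of 1] by simp
  have s: "?s \<in> sg_hom M (Z_nil \<diamond> M)"
    by (rule sg_hom_from_generators[OF square_group_axioms ZM.square_group_tensor _ _ _ _ gen_carrier(1)])
      (auto intro!: homI simp: zero neg)
  have pow: "pure_ee Z_nil M 1 (a [^]\<^bsub>sq_ee M\<^esub> n) = pure_ee Z_nil M n a" if "a \<in> carrier (sq_ee M)" for n :: int and a
  proof -
    have r: "pure_ee Z_nil M 1 \<in> hom (sq_ee M) (sq_ee (Z_nil \<diamond> M))"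
      and l: "(\<lambda>n. pure_ee Z_nil M n a) \<in> hom (sq_ee Z_nil) (sq_ee (Z_nil \<diamond> M))"
      using that bihom_hom_left[OF ZM.t_pure_bihom] bihom_hom_right[OF ZM.t_pure_bihom] by simp_all
    show ?thesis
      using hom_int_pow[OF r that ee.is_group ZM.T.ee.is_group, of n]
        hom_int_pow[OF l _ Z.ee.is_group ZM.T.ee.is_group, of 1 n] by simp
  qed
  show ?thesis
  proof (rule sg_isoI[OF left_unitor_hom s])
    show "?s \<cdot> left_unitor M = sg_id (Z_nil \<diamond> M)"
      by (rule ZM.arr_eqI[OF ZM.square_group_tensor gen_e_Z_nil gen_carrier(1)
            sg_comp_hom[OF ZM.square_group_tensor left_unitor_hom s] sg_id_hom[OF ZM.square_group_tensor]])
        (simp_all add: sg_comp_simps[OF left_unitor_hom] pow)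
    show "left_unitor M \<cdot> ?s = sg_id M"
      by (rule sg_hom_eqI[OF square_group_axioms square_group_axioms
            sg_comp_hom[OF square_group_axioms s left_unitor_hom] sg_id_hom[OF square_group_axioms]
            gen_carrier])
        (simp_all add: sg_comp_simps[OF s])
  qed
qed

lemma right_unitor_iso: "right_unitor M \<in> sg_iso (M \<diamond> Z_nil) M"
proof -
  \<comment> \<open>The inverse \<open>x \<mapsto> x \<circ> 1\<close> is additive because
    \<open>H(1) = 0\<close> removes the correction in relation (3), and it respects \<open>H\<close>
    because \<open>\<Delta>(1) = 1\<close>.\<close>
  let ?s = "\<lparr>sg_dom = M, sg_cod = M \<diamond> Z_nil, map_e = restrict (\<lambda>x. circ M Z_nil x 1) (carrier (sq_e M)),
    map_ee = restrict (\<lambda>a. pure_ee M Z_nil a 1) (carrier (sq_ee M))\<rparr>"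
  have zero: "pure_ee M Z_nil a 0 = \<one>\<^bsub>sq_ee (M \<diamond> Z_nil)\<^esub>" if "a \<in> carrier (sq_ee M)" for a
    using MZ.t_pure_simps(5)[OF that] by simp
  have neg: "pure_ee M Z_nil a (- 1) = inv\<^bsub>sq_ee (M \<diamond> Z_nil)\<^esub> pure_ee M Z_nil a 1" if "a \<in> carrier (sq_ee M)" for a
    using MZ.t_pure_simps(7)[OF that, of 1] by simp
  have s: "?s \<in> sg_hom M (M \<diamond> Z_nil)"
    by (rule sg_hom_from_generators[OF square_group_axioms MZ.square_group_tensor _ _ _ _ gen_carrier(1)])
      (auto intro!: homI simp: MZ.t_circ_left zero neg)
  have pow: "pure_ee M Z_nil (a [^]\<^bsub>sq_ee M\<^esub> n) 1 = pure_ee M Z_nil a n" if "a \<in> carrier (sq_ee M)" for n :: int and a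
  proof -
    have r: "pure_ee M Z_nil a \<in> hom (sq_ee Z_nil) (sq_ee (M \<diamond> Z_nil))"
      and l: "(\<lambda>a. pure_ee M Z_nil a 1) \<in> hom (sq_ee M) (sq_ee (M \<diamond> Z_nil))"
      using that bihom_hom_left[OF MZ.t_pure_bihom] bihom_hom_right[OF MZ.t_pure_bihom] by simp_all
    show ?thesis
      using hom_int_pow[OF l that ee.is_group MZ.T.ee.is_group, of n]
        hom_int_pow[OF r _ Z.ee.is_group MZ.T.ee.is_group, of 1 n] by simp
  qed
  show ?thesis
  proof (rule sg_isoI[OF right_unitor_hom s])
    show "?s \<cdot> right_unitor M = sg_id (M \<diamond> Z_nil)"
      by (rule MZ.arr_eqI[OF MZ.square_group_tensor gen_carrier(1) gen_e_Z_nil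
            sg_comp_hom[OF MZ.square_group_tensor right_unitor_hom s] sg_id_hom[OF MZ.square_group_tensor]])
        (simp_all add: sg_comp_simps[OF right_unitor_hom] pow)
    show "right_unitor M \<cdot> ?s = sg_id M"
      by (rule sg_hom_eqI[OF square_group_axioms square_group_axioms
            sg_comp_hom[OF square_group_axioms s right_unitor_hom] sg_id_hom[OF square_group_axioms]
            gen_carrier])
        (simp_all add: sg_comp_simps[OF s])
  qed
qed

end

section \<open>The commutativity isomorphism\<close>

locale sq_swap = MN: sq_pair M N + NM: sq_pair N M
  for M :: "('a, 'b) sq_grp" and N :: "('c, 'd) sq_grp"
begin

lemma is_braiding_iff:
  "is_braiding M N \<beta> \<longleftrightarrow> \<beta> \<in> sg_hom (M \<diamond> N) (N \<diamond> M) \<and>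
    (\<forall>a \<in> carrier (sq_ee M). \<forall>b \<in> carrier (sq_ee N).
      map_ee \<beta> (pure_ee M N a b) = pure_ee N M b a) \<and>
    (\<forall>x \<in> carrier (sq_e M). \<forall>y \<in> carrier (sq_e N).
      map_e \<beta> (circ M N x y) = circ N M y x \<otimes>\<^bsub>sq_e (N \<diamond> M)\<^esub>
        inv\<^bsub>sq_e (N \<diamond> M)\<^esub> sq_P (N \<diamond> M) (pure_ee N M (sq_H N y) (sq_T M (sq_H M x))))"
    (is "_ \<longleftrightarrow> ?R")
proof
  assume t: ?R
  then interpret t: sg_mor "M \<diamond> N" "N \<diamond> M" \<beta>
    by (simp add: sg_mor_def sg_mor_axioms_def MN.square_group_tensor NM.square_group_tensor)
  show "is_braiding M N \<beta>" using t by (simp add: is_braiding_def)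
qed (simp add: is_braiding_def)

lemma ex1_braiding: "\<exists>!\<beta>. is_braiding M N \<beta>"
proof (rule ex_ex1I)
  let ?Q = "N \<diamond> M"
  let ?f = "\<lambda>x y. circ N M y x \<otimes>\<^bsub>sq_e ?Q\<^esub> inv\<^bsub>sq_e ?Q\<^esub> sq_P ?Q (pure_ee N M (sq_H N y) (sq_T M (sq_H M x)))"
  obtain t where "t \<in> sg_hom (M \<diamond> N) ?Q"
    "\<And>x y. \<lbrakk>x \<in> carrier (sq_e M); y \<in> carrier (sq_e N)\<rbrakk> \<Longrightarrow> map_e t (circ M N x y) = ?f x y"
    "\<And>a b. \<lbrakk>a \<in> carrier (sq_ee M); b \<in> carrier (sq_ee N)\<rbrakk> \<Longrightarrow>
      map_ee t (pure_ee M N a b) = pure_ee N M b a"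
  proof (rule MN.tensor_morphism[OF NM.square_group_tensor MN.M.gen_carrier(1) MN.N.gen_carrier(1),
        of "\<lambda>a b. pure_ee N M b a" ?f])
    show "bihom (sq_ee M) (sq_ee N) (sq_ee ?Q) (\<lambda>a b. pure_ee N M b a)"
      by (rule bihomI) simp_all
  next
    fix x y1 y2 assume m: "x \<in> carrier (sq_e M)" "y1 \<in> carrier (sq_e N)" "y2 \<in> carrier (sq_e N)"
    \<comment> \<open>In \<open>N \<diamond> M\<close> the variable \<open>y\<close> is on the
      quadratic side, which yields \<open>(y2|y1) \<otimes> H(x)\<close>. The cross term of
      \<open>H (y1 + y2)\<close> in the correction cancels precisely this, making the formula
      additive in \<open>y\<close>.\<close>
    have "sq_P ?Q (pure_ee N M (sq_cross N y1 y2) (sq_T M (sq_H M x))) =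
        sq_P ?Q (pure_ee N M (sq_cross N y2 y1) (sq_H M x))"
      using arg_cong[OF NM.P_pure_T[of "sq_cross N y1 y2" "sq_H M x"], of "m_inv (sq_e ?Q)"] m by simp
    then show "?f x (y1 \<otimes>\<^bsub>sq_e N\<^esub> y2) = ?f x y1 \<otimes>\<^bsub>sq_e ?Q\<^esub> ?f x y2"
      using m
      by (simp add: NM.t_circ_left MN.N.H_mult NM.T.e.inv_mult_group)
        (rule prep_eqI, (rule NM.T.preps | (rule NM.T.prep_P, simp; fail) | rule NM.T.prep_at, simp; fail)+, simp_all add: algebra_simps)
  next
    \<comment> \<open>Conversely \<open>x\<close> is now on the additive side, and
      \<open>- H(y) \<otimes> T (x1|x2) = H(y) \<otimes> (x2|x1)\<close> supplies the defect
      demanded by relation (3).\<close>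
    fix x1 x2 y assume m: "x1 \<in> carrier (sq_e M)" "x2 \<in> carrier (sq_e M)" "y \<in> carrier (sq_e N)"
    then show "?f (x1 \<otimes>\<^bsub>sq_e M\<^esub> x2) y = ?f x1 y \<otimes>\<^bsub>sq_e ?Q\<^esub> ?f x2 y \<otimes>\<^bsub>sq_e ?Q\<^esub>
        sq_P ?Q (pure_ee N M (sq_H N y) (sq_cross M x2 x1))"
      by (simp add: MN.M.H_mult NM.T.e.inv_mult_group)
        (rule prep_eqI, (rule NM.T.preps | (rule NM.T.prep_P, simp; fail) | rule NM.T.prep_at, simp; fail)+, simp_all add: algebra_simps)
  next
    fix x b assume m: "x \<in> carrier (sq_e M)" "b \<in> carrier (sq_ee N)"
    \<comment> \<open>Subtracting the correction for \<open>H P b = T b + b\<close> from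
      \<open>b \<otimes> \<Delta>(x)\<close> removes the two \<open>H\<close>-terms of
      \<open>\<Delta>(x)\<close> and leaves \<open>b \<otimes> (x|x)\<close>.\<close>
    have "sq_P ?Q (pure_ee N M (sq_T N b) (sq_T M (sq_H M x))) =
        inv\<^bsub>sq_e ?Q\<^esub> sq_P ?Q (pure_ee N M b (sq_H M x))"
      using NM.P_pure_T[of b "sq_T M (sq_H M x)"] m by simp
    then show "?f x (sq_P N b) = sq_P ?Q (pure_ee N M b (sq_cross M x x))"
      using m
      by (simp add: MN.N.H_P MN.M.Delta_eq NM.T.e.inv_mult_group)
        (rule prep_eqI, (rule NM.T.preps | (rule NM.T.prep_P, simp; fail) | rule NM.T.prep_at, simp; fail)+, simp_all add: algebra_simps)
  next
    fix a y assume m: "a \<in> carrier (sq_ee M)" "y \<in> carrier (sq_e N)"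
    \<comment> \<open>Here the correction instead completes \<open>(y|y)\<close> to
      \<open>\<Delta>(y) = T H(y) - H(y) + (y|y)\<close>.\<close>
    have "sq_P ?Q (pure_ee N M (sq_T N (sq_H N y)) a) =
        inv\<^bsub>sq_e ?Q\<^esub> sq_P ?Q (pure_ee N M (sq_H N y) (sq_T M a))"
      using NM.P_pure_T[of "sq_H N y" a] m by simp
    then show "?f (sq_P M a) y = sq_P ?Q (pure_ee N M (sq_Delta N y) a)"
      using m
      by (simp add: MN.M.H_P MN.N.Delta_eq NM.T.e.inv_mult_group)
        (rule prep_eqI, (rule NM.T.preps | (rule NM.T.prep_P, simp; fail) | rule NM.T.prep_at, simp; fail)+, simp_all add: algebra_simps)
  next
    fix x y assume m: "x \<in> carrier (sq_e M)" "y \<in> carrier (sq_e N)"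
    then show "sq_H ?Q (?f x y) = pure_ee N M (sq_H N y) (sq_cross M x x) \<otimes>\<^bsub>sq_ee ?Q\<^esub>
        pure_ee N M (sq_Delta N y) (sq_H M x)"
      by (simp add: NM.T.H_mult NM.T.H_P MN.N.Delta_eq MN.M.Delta_eq flip: NM.T.P_inv)
        (rule rep_eqI, (rule NM.T.reps | rule NM.T.rep_atom, simp; fail)+, simp add: algebra_simps)
  qed (simp_all flip: NM.T.P_inv, blast?)
  then show "\<exists>\<beta>. is_braiding M N \<beta>" unfolding is_braiding_iff by blast
  fix t t' assume "is_braiding M N t" "is_braiding M N t'"
  then show "t = t'"
    unfolding is_braiding_iff
    by (intro MN.arr_eqI[OF NM.square_group_tensor MN.M.gen_carrier(1) MN.N.gen_carrier(1)]) auto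
qed

lemma is_braiding: "is_braiding M N (braiding M N)"
  unfolding braiding_def by (rule theI'[OF ex1_braiding])

lemma braiding_hom: "braiding M N \<in> sg_hom (M \<diamond> N) (N \<diamond> M)"
  and braiding_ee [simp]: "\<lbrakk>a \<in> carrier (sq_ee M); b \<in> carrier (sq_ee N)\<rbrakk>
      \<Longrightarrow> map_ee (braiding M N) (pure_ee M N a b) = pure_ee N M b a"
  and braiding_e [simp]: "\<lbrakk>x \<in> carrier (sq_e M); y \<in> carrier (sq_e N)\<rbrakk>
      \<Longrightarrow> map_e (braiding M N) (circ M N x y) = circ N M y x \<otimes>\<^bsub>sq_e (N \<diamond> M)\<^esub>
        inv\<^bsub>sq_e (N \<diamond> M)\<^esub> sq_P (N \<diamond> M) (pure_ee N M (sq_H N y) (sq_T M (sq_H M x)))"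
  using is_braiding by (auto simp: is_braiding_iff)

sublocale br: sg_mor "M \<diamond> N" "N \<diamond> M" "braiding M N"
  by (rule sg_morI) (rule MN.square_group_tensor NM.square_group_tensor braiding_hom)+

end

lemma sq_swapI: "\<lbrakk>square_group M; square_group N\<rbrakk> \<Longrightarrow> sq_swap M N"
  by (simp add: sq_swap_def sq_pairI)

lemma braiding_braiding:
  assumes "square_group M" "square_group N"
  shows "braiding N M \<cdot> braiding M N = sg_id (M \<diamond> N)"
proof -
  interpret a: sq_swap M N by (intro sq_swapI assms)
  interpret b: sq_swap N M by (intro sq_swapI assms)
  show ?thesis
  proof (rule a.MN.arr_eqI[OF a.MN.square_group_tensor a.MN.M.gen_carrier(1) a.MN.N.gen_carrier(1)
        sg_comp_hom[OF a.MN.square_group_tensor a.braiding_hom b.braiding_hom]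
        sg_id_hom[OF a.MN.square_group_tensor]])
    fix x y assume m: "x \<in> carrier (sq_e M)" "y \<in> carrier (sq_e N)"
    \<comment> \<open>The corrections of the two braidings are inverse to each other under
      \<open>P\<close>.\<close>
    have "sq_P (M \<diamond> N) (pure_ee M N (sq_T M (sq_H M x)) (sq_H N y)) =
        inv\<^bsub>sq_e (M \<diamond> N)\<^esub> sq_P (M \<diamond> N) (pure_ee M N (sq_H M x) (sq_T N (sq_H N y)))"
      using a.MN.P_pure_T m by simp
    then show "map_e (braiding N M \<cdot> braiding M N) (circ M N x y) = map_e (sg_id (M \<diamond> N)) (circ M N x y)"
      using m by (simp add: sg_comp_simps[OF a.braiding_hom] a.MN.T.e.m_assoc)
  qed (simp add: sg_comp_simps[OF a.braiding_hom])
qed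

lemma braiding_iso:
  assumes "square_group M" "square_group N"
  shows "braiding M N \<in> sg_iso (M \<diamond> N) (N \<diamond> M)"
proof -
  interpret a: sq_swap M N by (intro sq_swapI assms)
  interpret b: sq_swap N M by (intro sq_swapI assms)
  show ?thesis
    by (rule sg_isoI[OF a.braiding_hom b.braiding_hom]) (intro braiding_braiding assms)+
qed

lemma braiding_natural:
  assumes "sg_mor M M' f" "sg_mor N N' g"
  shows "braiding M' N' \<cdot> (f \<diamond>\<^sub>m g) = (g \<diamond>\<^sub>m f) \<cdot> braiding M N"
proof -
  interpret fg: sg_mor_pair M M' f N N' g by (intro sg_mor_pairI assms)
  interpret gf: sg_mor_pair N N' g M M' f by (intro sg_mor_pairI assms)
  interpret a: sq_swap M N by (intro sq_swapI fg.F.M.square_group_axioms fg.G.M.square_group_axioms)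
  interpret b: sq_swap M' N' by (intro sq_swapI fg.F.N.square_group_axioms fg.G.N.square_group_axioms)
  show ?thesis
    by (rule fg.MN.arr_eqI[OF gf.MN'.square_group_tensor fg.F.M.gen_carrier(1) fg.G.M.gen_carrier(1)
          sg_comp_hom[OF fg.MN.square_group_tensor fg.tensor_arr_hom b.braiding_hom]
          sg_comp_hom[OF fg.MN.square_group_tensor a.braiding_hom gf.tensor_arr_hom]])
      (simp_all add: sg_comp_simps[OF a.braiding_hom] sg_comp_simps[OF fg.tensor_arr_hom])
qed

context sq_pair
begin

lemmas gen_tensor = gen_e_tensor[OF M.gen_carrier(1) N.gen_carrier(1)]
  gen_ee_tensor[OF M.gen_carrier(2) N.gen_carrier(2)]

lemma circ_gens:
  defines "S \<equiv> {circ M N x y |x y. x \<in> carrier (sq_e M) \<and> y \<in> carrier (sq_e N)} \<union>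
    sq_P (M \<diamond> N) ` carrier (sq_ee (M \<diamond> N))"
  shows "S \<subseteq> carrier (sq_e (M \<diamond> N))" "carrier (sq_e (M \<diamond> N)) = generate (sq_e (M \<diamond> N)) S"
  using gen_tensor(1) T.gen_e_closed[OF gen_tensor(1)] unfolding S_def gen_e_def by blast+

end

section \<open>The associativity isomorphism\<close>

locale sq_triple = MN: sq_pair M N + NK: sq_pair N K + L: sq_pair "M \<diamond> N" K + R: sq_pair M "N \<diamond> K"
  for M :: "('a, 'b) sq_grp" and N :: "('c, 'd) sq_grp" and K :: "('e, 'f) sq_grp"
begin

abbreviation "LL \<equiv> (M \<diamond> N) \<diamond> K"
abbreviation "RR \<equiv> M \<diamond> (N \<diamond> K)"

text \<open>The third factor stays a parameter because \<open>tensor_morphism\<close> expects a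
  bilinear map on \<open>sq_ee (M \<diamond> N)\<close> and \<open>sq_ee K\<close>.\<close>

definition "assoc_ee w c = tensor_lift (sq_ee M) (sq_ee N) (sq_ee RR)
  (\<lambda>a b. pure_ee M (N \<diamond> K) a (pure_ee N K b c)) w"

definition "assoc_ee_inv a w = tensor_lift (sq_ee N) (sq_ee K) (sq_ee LL)
  (\<lambda>b c. pure_ee (M \<diamond> N) K (pure_ee M N a b) c) w"

lemma assoc_ee_pure [simp]:
  assumes "a \<in> carrier (sq_ee M)" "b \<in> carrier (sq_ee N)" "c \<in> carrier (sq_ee K)"
  shows "assoc_ee (pure_ee M N a b) c = pure_ee M (N \<diamond> K) a (pure_ee N K b c)"
  unfolding assoc_ee_def
  by (rule tensor_lift_pure[OF MN.M.ee.is_group MN.N.ee.is_group R.T.comm_group_ee])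
    (use assms in \<open>auto intro!: bihomI\<close>)

lemma assoc_ee_bihom: "bihom (sq_ee (M \<diamond> N)) (sq_ee K) (sq_ee RR) assoc_ee"
proof -
  have "bihom (sq_ee K) (sq_ee M \<bowtie> sq_ee N) (sq_ee RR) (\<lambda>c w. assoc_ee w c)"
    unfolding assoc_ee_def
    by (rule tensor_lift_bihom[OF MN.M.ee.is_group MN.N.ee.is_group NK.N.ee.is_group R.T.comm_group_ee])
      (auto intro!: bihomI homI)
  then show ?thesis by (simp add: bihom_def)
qed

lemmas assoc_ee_simps [simp] = bihom_closed[OF assoc_ee_bihom] bihom_left[OF assoc_ee_bihom] bihom_right[OF assoc_ee_bihom]
  bihom_inv_left[OF assoc_ee_bihom MN.T.ee.is_group NK.N.ee.is_group R.T.ee.is_group]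
  bihom_inv_right[OF assoc_ee_bihom MN.T.ee.is_group NK.N.ee.is_group R.T.ee.is_group]
  bihom_one_left[OF assoc_ee_bihom MN.T.ee.is_group NK.N.ee.is_group R.T.ee.is_group]
  bihom_one_right[OF assoc_ee_bihom MN.T.ee.is_group NK.N.ee.is_group R.T.ee.is_group]

lemma assoc_ee_inv_pure [simp]:
  assumes "a \<in> carrier (sq_ee M)" "b \<in> carrier (sq_ee N)" "c \<in> carrier (sq_ee K)"
  shows "assoc_ee_inv a (pure_ee N K b c) = pure_ee (M \<diamond> N) K (pure_ee M N a b) c"
  unfolding assoc_ee_inv_def
  by (rule tensor_lift_pure[OF MN.N.ee.is_group NK.N.ee.is_group L.T.comm_group_ee])
    (use assms in \<open>auto intro!: bihomI\<close>)

lemma assoc_ee_inv_bihom: "bihom (sq_ee M) (sq_ee (N \<diamond> K)) (sq_ee LL) assoc_ee_inv"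
proof -
  have "bihom (sq_ee M) (sq_ee N \<bowtie> sq_ee K) (sq_ee LL) assoc_ee_inv"
    unfolding assoc_ee_inv_def
    by (rule tensor_lift_bihom[OF MN.N.ee.is_group NK.N.ee.is_group MN.M.ee.is_group L.T.comm_group_ee])
      (auto intro!: bihomI homI)
  then show ?thesis by simp
qed

lemmas assoc_ee_inv_simps [simp] = bihom_closed[OF assoc_ee_inv_bihom] bihom_left[OF assoc_ee_inv_bihom] bihom_right[OF assoc_ee_inv_bihom]
  bihom_inv_left[OF assoc_ee_inv_bihom MN.M.ee.is_group NK.T.ee.is_group L.T.ee.is_group]
  bihom_inv_right[OF assoc_ee_inv_bihom MN.M.ee.is_group NK.T.ee.is_group L.T.ee.is_group]
  bihom_one_left[OF assoc_ee_inv_bihom MN.M.ee.is_group NK.T.ee.is_group L.T.ee.is_group]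
  bihom_one_right[OF assoc_ee_inv_bihom MN.M.ee.is_group NK.T.ee.is_group L.T.ee.is_group]

text \<open>On pure tensors \<open>T\<close> of \<open>M \<diamond> (N \<diamond> K)\<close>
  produces two signs and \<open>T\<close> of \<open>M \<diamond> N\<close> only one, which leaves
  the sign required by \<open>tensor_morphism\<close>.\<close>

lemma T_assoc_ee:
  assumes "w \<in> carrier (sq_ee (M \<diamond> N))" "c \<in> carrier (sq_ee K)"
  shows "sq_T RR (assoc_ee w c) = inv\<^bsub>sq_ee RR\<^esub> assoc_ee (sq_T (M \<diamond> N) w) (sq_T K c)"
  using assms(1)
proof (induction rule: MN.t_induct)
  case (mult u v)
  then show ?case using assms(2) by (simp add: R.T.ee.inv_mult)
qed (simp add: assms(2))

lemma T_assoc_ee_inv: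
  assumes "w \<in> carrier (sq_ee (N \<diamond> K))" "a \<in> carrier (sq_ee M)"
  shows "sq_T LL (assoc_ee_inv a w) = inv\<^bsub>sq_ee LL\<^esub> assoc_ee_inv (sq_T M a) (sq_T (N \<diamond> K) w)"
  using assms(1)
proof (induction rule: NK.t_induct)
  case (mult u v)
  then show ?case using assms(2) by (simp add: L.T.ee.inv_mult)
qed (simp add: assms(2))

lemma P_assoc_ee_T:
  assumes "w \<in> carrier (sq_ee (M \<diamond> N))" "c \<in> carrier (sq_ee K)"
  shows "sq_P RR (assoc_ee (sq_T (M \<diamond> N) w) c) = inv\<^bsub>sq_e RR\<^esub> sq_P RR (assoc_ee w (sq_T K c))"
  using arg_cong[OF R.T.P_T[of "assoc_ee w (sq_T K c)"], of "m_inv (sq_e RR)"] assms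
  by (simp add: T_assoc_ee del: R.T.P_T)

lemma P_assoc_ee_inv_T:
  assumes "w \<in> carrier (sq_ee (N \<diamond> K))" "a \<in> carrier (sq_ee M)"
  shows "sq_P LL (assoc_ee_inv (sq_T M a) w) = inv\<^bsub>sq_e LL\<^esub> sq_P LL (assoc_ee_inv a (sq_T (N \<diamond> K) w))"
  using arg_cong[OF L.T.P_T[of "assoc_ee_inv a (sq_T (N \<diamond> K) w)"], of "m_inv (sq_e LL)"] assms
  by (simp add: T_assoc_ee_inv del: L.T.P_T)

text \<open>The map \<open>u \<mapsto> u \<circ> z\<close> is not additive, so it is constructed on the group
  \<open>(M \<diamond> N)\<^sub>e\<close> by the twisted universal property.\<close>

definition "is_phi z F \<longleftrightarrow> (\<forall>u \<in> carrier (sq_e (M \<diamond> N)). F u \<in> carrier (sq_e RR)) \<and>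
    (\<forall>u \<in> carrier (sq_e (M \<diamond> N)). \<forall>v \<in> carrier (sq_e (M \<diamond> N)). F (u \<otimes>\<^bsub>sq_e (M \<diamond> N)\<^esub> v) =
      F u \<otimes>\<^bsub>sq_e RR\<^esub> F v \<otimes>\<^bsub>sq_e RR\<^esub> sq_P RR (assoc_ee (sq_cross (M \<diamond> N) v u) (sq_H K z))) \<and>
    (\<forall>x \<in> carrier (sq_e M). \<forall>y \<in> carrier (sq_e N).
      F (circ M N x y) = circ M (N \<diamond> K) x (circ N K y z)) \<and>
    (\<forall>a \<in> carrier (sq_ee M). \<forall>b \<in> carrier (sq_ee N).
      F (sq_P (M \<diamond> N) (pure_ee M N a b)) = sq_P RR (pure_ee M (N \<diamond> K) a (pure_ee N K b (sq_Delta K z))))"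

lemma ex_phi:
  assumes z: "z \<in> carrier (sq_e K)"
  shows "\<exists>F. is_phi z F"
proof -
  let ?f = "\<lambda>x y. circ M (N \<diamond> K) x (circ N K y z)"
  let ?g = "\<lambda>a b. sq_P RR (pure_ee M (N \<diamond> K) a (pure_ee N K b (sq_Delta K z)))"
  let ?\<psi> = "\<lambda>u v. sq_P RR (assoc_ee (sq_cross (M \<diamond> N) v u) (sq_H K z))"
  obtain F where "\<And>u. u \<in> carrier (tensor_e M N) \<Longrightarrow> F u \<in> carrier (sq_e RR)"
    "\<And>u v. \<lbrakk>u \<in> carrier (tensor_e M N); v \<in> carrier (tensor_e M N)\<rbrakk>
      \<Longrightarrow> F (u \<otimes>\<^bsub>tensor_e M N\<^esub> v) = F u \<otimes>\<^bsub>sq_e RR\<^esub> F v \<otimes>\<^bsub>sq_e RR\<^esub> ?\<psi> u v"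
    "\<And>x y. \<lbrakk>x \<in> carrier (sq_e M); y \<in> carrier (sq_e N)\<rbrakk> \<Longrightarrow> F (circ M N x y) = ?f x y"
    "\<And>a b. \<lbrakk>a \<in> carrier (sq_ee M); b \<in> carrier (sq_ee N)\<rbrakk> \<Longrightarrow> F (bar M N a b) = ?g a b"
  proof (rule MN.tensor_e_twisted[OF R.T.e.is_group, of ?\<psi> ?f ?g])
    show "bihom (tensor_e M N) (tensor_e M N) (sq_e RR) ?\<psi>"
      by (rule bihomI) (use z in simp_all)
    show "bihom (sq_ee M) (sq_ee N) (sq_e RR) ?g"
      by (rule bihomI) (use z in simp_all)
    show "central (sq_e RR) (?\<psi> u v)" if "u \<in> carrier (tensor_e M N)" "v \<in> carrier (tensor_e M N)" for u v
      using that z by (simp add: R.T.P_central)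
    show "central (sq_e RR) (?g a b)" if "a \<in> carrier (sq_ee M)" "b \<in> carrier (sq_ee N)" for a b
      using that z by (simp add: R.T.P_central)
  next
    \<comment> \<open>The defect of \<open>circ N K\<close> in \<open>y\<close> lies in the image of
      \<open>P\<close>; relation (4) turns \<open>x\<close> paired with it into the twist.\<close>
    fix x y1 y2 assume "x \<in> carrier (sq_e M)" "y1 \<in> carrier (sq_e N)" "y2 \<in> carrier (sq_e N)"
    then show "?f x (y1 \<otimes>\<^bsub>sq_e N\<^esub> y2) = ?f x y1 \<otimes>\<^bsub>sq_e RR\<^esub> ?f x y2 \<otimes>\<^bsub>sq_e RR\<^esub>
        ?\<psi> (circ M N x y1) (circ M N x y2)"
      using z by (simp add: NK.t_circ_left)
  next
    \<comment> \<open>The defect involves \<open>H (y \<circ> z) = (y|y) \<otimes> H(z) + H(y)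
      \<otimes> \<Delta>(z)\<close>: the first summand is the twist, the second the value on the
      \<open>bar\<close> term. This is where \<open>\<Delta>(z)\<close> in the formula for
      associativity comes from.\<close>
    fix x1 x2 y assume "x1 \<in> carrier (sq_e M)" "x2 \<in> carrier (sq_e M)" "y \<in> carrier (sq_e N)"
    then show "?f (x1 \<otimes>\<^bsub>sq_e M\<^esub> x2) y = ?f x1 y \<otimes>\<^bsub>sq_e RR\<^esub> ?f x2 y \<otimes>\<^bsub>sq_e RR\<^esub>
        ?\<psi> (circ M N x1 y) (circ M N x2 y) \<otimes>\<^bsub>sq_e RR\<^esub> ?g (sq_cross M x2 x1) (sq_H N y)"
      using z by (simp add: R.t_circ_left R.T.e.m_assoc)
  next
    \<comment> \<open>Moving \<open>T\<close> from \<open>a\<close> to the second factor gives signs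
      from \<open>P_pure_T\<close>, from \<open>T_pure\<close> and from
      \<open>T \<Delta> = - \<Delta>\<close>, hence one sign in all.\<close>
    fix a b assume m: "a \<in> carrier (sq_ee M)" "b \<in> carrier (sq_ee N)"
    then show "?g (sq_T M a) (sq_T N b) = inv\<^bsub>sq_e RR\<^esub> ?g a b"
      using R.P_pure_T[of a "pure_ee N K (sq_T N b) (sq_Delta K z)"] z by simp
  qed (use z in simp_all, blast?)
  then show ?thesis by (intro exI[of _ F]) (simp add: is_phi_def)
qed

definition "phi z = (SOME F. is_phi z F)"

lemma
  assumes "z \<in> carrier (sq_e K)"
  shows phi_closed [simp]: "u \<in> carrier (sq_e (M \<diamond> N)) \<Longrightarrow> phi z u \<in> carrier (sq_e RR)"
    and phi_mult: "\<lbrakk>u \<in> carrier (sq_e (M \<diamond> N)); v \<in> carrier (sq_e (M \<diamond> N))\<rbrakk> \<Longrightarrow>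
      phi z (u \<otimes>\<^bsub>sq_e (M \<diamond> N)\<^esub> v) =
      phi z u \<otimes>\<^bsub>sq_e RR\<^esub> phi z v \<otimes>\<^bsub>sq_e RR\<^esub> sq_P RR (assoc_ee (sq_cross (M \<diamond> N) v u) (sq_H K z))"
    and phi_circ [simp]: "\<lbrakk>x \<in> carrier (sq_e M); y \<in> carrier (sq_e N)\<rbrakk> \<Longrightarrow>
      phi z (circ M N x y) = circ M (N \<diamond> K) x (circ N K y z)"
    and phi_pure: "\<lbrakk>a \<in> carrier (sq_ee M); b \<in> carrier (sq_ee N)\<rbrakk> \<Longrightarrow>
      phi z (sq_P (M \<diamond> N) (pure_ee M N a b)) = sq_P RR (pure_ee M (N \<diamond> K) a (pure_ee N K b (sq_Delta K z)))"
  using someI_ex[OF ex_phi[OF assms], folded phi_def, unfolded is_phi_def] by blast+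

lemma phi_P [simp]:
  assumes "z \<in> carrier (sq_e K)" "w \<in> carrier (sq_ee (M \<diamond> N))"
  shows "phi z (sq_P (M \<diamond> N) w) = sq_P RR (assoc_ee w (sq_Delta K z))"
  using assms(2)
proof (induction rule: MN.t_induct)
  case (pure a b)
  then show ?case using assms(1) by (simp add: phi_pure)
next
  case (mult u v)
  then show ?case using assms(1) by (simp add: phi_mult)
qed

text \<open>The defect of \<open>phi\<close> lies in the image of \<open>P\<close>, where the
  cross-effect vanishes, so the left side is bilinear in \<open>u\<close> and \<open>u'\<close> and
  can be compared on generators.\<close>

lemma cross_phi [simp]:
  assumes z: "z \<in> carrier (sq_e K)" "z' \<in> carrier (sq_e K)"
    and u: "u \<in> carrier (sq_e (M \<diamond> N))" "u' \<in> carrier (sq_e (M \<diamond> N))"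
  shows "sq_cross RR (phi z u) (phi z' u') = assoc_ee (sq_cross (M \<diamond> N) u u') (sq_cross K z z')"
proof (rule bihom_eq_on_generators[OF MN.T.e.is_group MN.T.e.is_group R.T.ee.is_group _ _
      MN.circ_gens MN.circ_gens _ u])
  show "bihom (sq_e (M \<diamond> N)) (sq_e (M \<diamond> N)) (sq_ee RR) (\<lambda>u u'. sq_cross RR (phi z u) (phi z' u'))"
    by (rule bihomI) (use z in \<open>simp_all add: phi_mult\<close>)
  show "bihom (sq_e (M \<diamond> N)) (sq_e (M \<diamond> N)) (sq_ee RR) (\<lambda>u u'. assoc_ee (sq_cross (M \<diamond> N) u u') (sq_cross K z z'))"
    by (rule bihomI) (use z in simp_all)
qed (use z in auto)

text \<open>As functions of \<open>u\<close>, both sides have the same quadratic defect: exchanging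
  \<open>phi z1 v\<close> with \<open>phi z2 u\<close> costs \<open>(v|u) \<otimes> (z1|z2)\<close>
  under \<open>P\<close>, which is the cross term in \<open>H (z1 + z2)\<close>.\<close>

lemma phi_right:
  assumes z: "z1 \<in> carrier (sq_e K)" "z2 \<in> carrier (sq_e K)" and u: "u \<in> carrier (sq_e (M \<diamond> N))"
  shows "phi (z1 \<otimes>\<^bsub>sq_e K\<^esub> z2) u = phi z1 u \<otimes>\<^bsub>sq_e RR\<^esub> phi z2 u"
proof (rule quadratic_eq_on_generators[OF MN.T.e.is_group R.T.e.is_group _ _ _ _ _ MN.circ_gens _ u,
      of "\<lambda>u v. sq_P RR (assoc_ee (sq_cross (M \<diamond> N) v u) (sq_H K (z1 \<otimes>\<^bsub>sq_e K\<^esub> z2)))"])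
  show "bihom (sq_e (M \<diamond> N)) (sq_e (M \<diamond> N)) (sq_e RR)
      (\<lambda>u v. sq_P RR (assoc_ee (sq_cross (M \<diamond> N) v u) (sq_H K (z1 \<otimes>\<^bsub>sq_e K\<^esub> z2))))"
    by (rule bihomI) (use z in simp_all)
  fix u v assume m: "u \<in> carrier (sq_e (M \<diamond> N))" "v \<in> carrier (sq_e (M \<diamond> N))"
  note m = m z
  show "phi (z1 \<otimes>\<^bsub>sq_e K\<^esub> z2) (u \<otimes>\<^bsub>sq_e (M \<diamond> N)\<^esub> v) = phi (z1 \<otimes>\<^bsub>sq_e K\<^esub> z2) u \<otimes>\<^bsub>sq_e RR\<^esub>
      phi (z1 \<otimes>\<^bsub>sq_e K\<^esub> z2) v \<otimes>\<^bsub>sq_e RR\<^esub> sq_P RR (assoc_ee (sq_cross (M \<diamond> N) v u) (sq_H K (z1 \<otimes>\<^bsub>sq_e K\<^esub> z2)))"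
    using m by (intro phi_mult) auto
  let ?X = "sq_P RR (assoc_ee (sq_cross (M \<diamond> N) v u) (sq_H K z1))"
    and ?Y = "sq_P RR (assoc_ee (sq_cross (M \<diamond> N) v u) (sq_H K z2))"
  have com: "phi z1 v \<otimes>\<^bsub>sq_e RR\<^esub> phi z2 u = phi z2 u \<otimes>\<^bsub>sq_e RR\<^esub> phi z1 v \<otimes>\<^bsub>sq_e RR\<^esub>
      sq_P RR (assoc_ee (sq_cross (M \<diamond> N) v u) (sq_cross K z1 z2))"
    using R.T.commutation[of "phi z1 v" "phi z2 u"] m by simp
  have "phi z1 (u \<otimes>\<^bsub>sq_e (M \<diamond> N)\<^esub> v) \<otimes>\<^bsub>sq_e RR\<^esub> phi z2 (u \<otimes>\<^bsub>sq_e (M \<diamond> N)\<^esub> v) =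
      phi z1 u \<otimes>\<^bsub>sq_e RR\<^esub> (phi z1 v \<otimes>\<^bsub>sq_e RR\<^esub> phi z2 u) \<otimes>\<^bsub>sq_e RR\<^esub> phi z2 v \<otimes>\<^bsub>sq_e RR\<^esub> (?X \<otimes>\<^bsub>sq_e RR\<^esub> ?Y)"
    using m
    by (simp add: phi_mult)
      (rule prep_eqI, (rule R.T.preps | (rule R.T.prep_P, simp; fail) | rule R.T.prep_at, simp; fail)+, simp_all add: algebra_simps)
  also have "\<dots> = phi z1 u \<otimes>\<^bsub>sq_e RR\<^esub> phi z2 u \<otimes>\<^bsub>sq_e RR\<^esub> (phi z1 v \<otimes>\<^bsub>sq_e RR\<^esub> phi z2 v) \<otimes>\<^bsub>sq_e RR\<^esub>
      sq_P RR (assoc_ee (sq_cross (M \<diamond> N) v u) (sq_H K (z1 \<otimes>\<^bsub>sq_e K\<^esub> z2)))"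
    unfolding com using m
    by (simp add: NK.N.H_mult)
      (rule prep_eqI, (rule R.T.preps | (rule R.T.prep_P, simp; fail) | rule R.T.prep_at, simp; fail)+, simp_all add: algebra_simps)
  finally show "phi z1 (u \<otimes>\<^bsub>sq_e (M \<diamond> N)\<^esub> v) \<otimes>\<^bsub>sq_e RR\<^esub> phi z2 (u \<otimes>\<^bsub>sq_e (M \<diamond> N)\<^esub> v) = \<dots>" .
qed (use z in auto)

text \<open>Again quadratic in \<open>u\<close> on both sides. The right side has defect
  \<open>((u|v) + (v|u)) \<otimes> c\<close>, the left \<open>(v|u) \<otimes> (T c + c)\<close>, and
  these agree under \<open>P\<close>.\<close>

lemma phi_right_P:
  assumes c: "c \<in> carrier (sq_ee K)" and u: "u \<in> carrier (sq_e (M \<diamond> N))"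
  shows "phi (sq_P K c) u = sq_P RR (assoc_ee (sq_cross (M \<diamond> N) u u) c)"
proof (rule quadratic_eq_on_generators[OF MN.T.e.is_group R.T.e.is_group _ _ _ _ _ MN.circ_gens _ u,
      of "\<lambda>u v. sq_P RR (assoc_ee (sq_cross (M \<diamond> N) v u) (sq_H K (sq_P K c)))"])
  show "bihom (sq_e (M \<diamond> N)) (sq_e (M \<diamond> N)) (sq_e RR)
      (\<lambda>u v. sq_P RR (assoc_ee (sq_cross (M \<diamond> N) v u) (sq_H K (sq_P K c))))"
    by (rule bihomI) (use c in simp_all)
  fix u v assume m: "u \<in> carrier (sq_e (M \<diamond> N))" "v \<in> carrier (sq_e (M \<diamond> N))"
  show "phi (sq_P K c) (u \<otimes>\<^bsub>sq_e (M \<diamond> N)\<^esub> v) = phi (sq_P K c) u \<otimes>\<^bsub>sq_e RR\<^esub>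
      phi (sq_P K c) v \<otimes>\<^bsub>sq_e RR\<^esub> sq_P RR (assoc_ee (sq_cross (M \<diamond> N) v u) (sq_H K (sq_P K c)))"
    using m c by (intro phi_mult) auto
  have "sq_P RR (assoc_ee (sq_cross (M \<diamond> N) v u) (sq_T K c)) = sq_P RR (assoc_ee (sq_cross (M \<diamond> N) u v) c)"
    using arg_cong[OF P_assoc_ee_T[of "sq_cross (M \<diamond> N) v u" c], of "m_inv (sq_e RR)"] m c by simp
  then show "sq_P RR (assoc_ee (sq_cross (M \<diamond> N) (u \<otimes>\<^bsub>sq_e (M \<diamond> N)\<^esub> v) (u \<otimes>\<^bsub>sq_e (M \<diamond> N)\<^esub> v)) c) =
      sq_P RR (assoc_ee (sq_cross (M \<diamond> N) u u) c) \<otimes>\<^bsub>sq_e RR\<^esub> sq_P RR (assoc_ee (sq_cross (M \<diamond> N) v v) c) \<otimes>\<^bsub>sq_e RR\<^esub>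
      sq_P RR (assoc_ee (sq_cross (M \<diamond> N) v u) (sq_H K (sq_P K c)))"
    using m c
    by (simp add: NK.N.H_P)
      (rule prep_eqI, (rule R.T.preps | (rule R.T.prep_P, simp; fail) | rule R.T.prep_at, simp; fail)+, simp_all add: algebra_simps)
qed (use c in auto)

lemma is_associator_iff:
  "is_associator M N K \<alpha> \<longleftrightarrow> \<alpha> \<in> sg_hom LL RR \<and>
    (\<forall>a \<in> carrier (sq_ee M). \<forall>b \<in> carrier (sq_ee N). \<forall>c \<in> carrier (sq_ee K).
      map_ee \<alpha> (pure_ee (M \<diamond> N) K (pure_ee M N a b) c) = pure_ee M (N \<diamond> K) a (pure_ee N K b c)) \<and>
    (\<forall>x \<in> carrier (sq_e M). \<forall>y \<in> carrier (sq_e N). \<forall>z \<in> carrier (sq_e K).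
      map_e \<alpha> (circ (M \<diamond> N) K (circ M N x y) z) = circ M (N \<diamond> K) x (circ N K y z))"
    (is "_ \<longleftrightarrow> ?R")
proof
  assume t: ?R
  then interpret t: sg_mor LL RR \<alpha>
    by (simp add: sg_mor_def sg_mor_axioms_def L.square_group_tensor R.square_group_tensor)
  show "is_associator M N K \<alpha>" using t by (simp add: is_associator_def)
qed (simp add: is_associator_def)

lemma ex_associator: "\<exists>\<alpha>. is_associator M N K \<alpha>"
proof -
  obtain t where "t \<in> sg_hom LL RR"
    "\<And>u z. \<lbrakk>u \<in> carrier (sq_e (M \<diamond> N)); z \<in> carrier (sq_e K)\<rbrakk> \<Longrightarrow> map_e t (circ (M \<diamond> N) K u z) = phi z u"
    "\<And>w c. \<lbrakk>w \<in> carrier (sq_ee (M \<diamond> N)); c \<in> carrier (sq_ee K)\<rbrakk> \<Longrightarrow> map_ee t (pure_ee (M \<diamond> N) K w c) = assoc_ee w c"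
  proof (rule L.tensor_morphism[OF R.square_group_tensor MN.gen_tensor(1) NK.N.gen_carrier(1) assoc_ee_bihom,
        of "\<lambda>u z. phi z u"])
    fix u z assume "u \<in> {circ M N x y |x y. x \<in> carrier (sq_e M) \<and> y \<in> carrier (sq_e N)}" "z \<in> carrier (sq_e K)"
    then obtain x y where m: "x \<in> carrier (sq_e M)" "y \<in> carrier (sq_e N)" "z \<in> carrier (sq_e K)"
      and u: "u = circ M N x y" by auto
    \<comment> \<open>Expanding \<open>H\<close> on either bracketing gives the same three summands,
      once \<open>\<Delta> (y \<circ> z) = \<Delta>(y) \<otimes> \<Delta>(z)\<close> is
      used.\<close>
    show "sq_H RR (phi z u) = assoc_ee (sq_cross (M \<diamond> N) u u) (sq_H K z) \<otimes>\<^bsub>sq_ee RR\<^esub>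
        assoc_ee (sq_H (M \<diamond> N) u) (sq_Delta K z)"
      unfolding u using m by (simp add: R.T.ee.m_assoc)
  qed (auto simp: T_assoc_ee phi_right phi_mult phi_right_P)
  then show ?thesis unfolding is_associator_iff by auto
qed

lemma associator_eqI:
  assumes "square_group Q" "f \<in> sg_hom LL Q" "g \<in> sg_hom LL Q"
    and "\<And>x y z. \<lbrakk>x \<in> carrier (sq_e M); y \<in> carrier (sq_e N); z \<in> carrier (sq_e K)\<rbrakk> \<Longrightarrow>
      map_e f (circ (M \<diamond> N) K (circ M N x y) z) = map_e g (circ (M \<diamond> N) K (circ M N x y) z)"
    and "\<And>a b c. \<lbrakk>a \<in> carrier (sq_ee M); b \<in> carrier (sq_ee N); c \<in> carrier (sq_ee K)\<rbrakk> \<Longrightarrow>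
      map_ee f (pure_ee (M \<diamond> N) K (pure_ee M N a b) c) = map_ee g (pure_ee (M \<diamond> N) K (pure_ee M N a b) c)"
  shows "f = g"
  by (rule L.arr_eqI_gen[OF assms(1-3) MN.gen_tensor(1) NK.N.gen_carrier(1) MN.gen_tensor(2) NK.N.gen_carrier(2)])
    (use assms(4,5) in auto)

lemma ex1_associator: "\<exists>!\<alpha>. is_associator M N K \<alpha>"
proof (rule ex_ex1I[OF ex_associator])
  fix t t' assume "is_associator M N K t" "is_associator M N K t'"
  then show "t = t'"
    unfolding is_associator_iff by (intro associator_eqI[OF R.square_group_tensor]) auto
qed

lemma is_associator: "is_associator M N K (associator M N K)"
  unfolding associator_def by (rule theI'[OF ex1_associator])

lemma associator_hom: "associator M N K \<in> sg_hom LL RR"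
  and associator_ee [simp]: "\<lbrakk>a \<in> carrier (sq_ee M); b \<in> carrier (sq_ee N); c \<in> carrier (sq_ee K)\<rbrakk> \<Longrightarrow>
      map_ee (associator M N K) (pure_ee (M \<diamond> N) K (pure_ee M N a b) c) = pure_ee M (N \<diamond> K) a (pure_ee N K b c)"
  and associator_e [simp]: "\<lbrakk>x \<in> carrier (sq_e M); y \<in> carrier (sq_e N); z \<in> carrier (sq_e K)\<rbrakk> \<Longrightarrow>
      map_e (associator M N K) (circ (M \<diamond> N) K (circ M N x y) z) = circ M (N \<diamond> K) x (circ N K y z)"
  using is_associator by (auto simp: is_associator_iff)

sublocale as: sg_mor LL RR "associator M N K"
  by (rule sg_morI) (rule L.square_group_tensor R.square_group_tensor associator_hom)+

end

section \<open>The inverse of the associativity map\<close>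

context sq_triple
begin

text \<open>For fixed \<open>x\<close> this is a homomorphism, as the tensor product is additive on
  the right. Its value on \<open>P (b \<otimes> c)\<close> is what relation (4) prescribes,
  rebracketed on the ee-level.\<close>

definition "is_chi x h \<longleftrightarrow> h \<in> hom (sq_e (N \<diamond> K)) (sq_e LL) \<and>
    (\<forall>y \<in> carrier (sq_e N). \<forall>z \<in> carrier (sq_e K).
      h (circ N K y z) = circ (M \<diamond> N) K (circ M N x y) z) \<and>
    (\<forall>b \<in> carrier (sq_ee N). \<forall>c \<in> carrier (sq_ee K). h (sq_P (N \<diamond> K) (pure_ee N K b c)) =
      sq_P LL (pure_ee (M \<diamond> N) K (pure_ee M N (sq_cross M x x) b) c))"

lemma ex_chi:
  assumes x: "x \<in> carrier (sq_e M)"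
  shows "\<exists>h. is_chi x h"
proof -
  let ?f = "\<lambda>y z. circ (M \<diamond> N) K (circ M N x y) z"
  let ?g = "\<lambda>b c. sq_P LL (pure_ee (M \<diamond> N) K (pure_ee M N (sq_cross M x x) b) c)"
  obtain h where "h \<in> hom (tensor_e N K) (sq_e LL)"
    "\<And>y z. \<lbrakk>y \<in> carrier (sq_e N); z \<in> carrier (sq_e K)\<rbrakk> \<Longrightarrow> h (circ N K y z) = ?f y z"
    "\<And>b c. \<lbrakk>b \<in> carrier (sq_ee N); c \<in> carrier (sq_ee K)\<rbrakk> \<Longrightarrow> h (bar N K b c) = ?g b c"
  proof (rule NK.tensor_e_hom[OF L.T.e.is_group, of ?f ?g])
    show "bihom (sq_ee N) (sq_ee K) (sq_e LL) ?g"
      by (rule bihomI) (use x in simp_all)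
    show "central (sq_e LL) (?g b c)" if "b \<in> carrier (sq_ee N)" "c \<in> carrier (sq_ee K)" for b c
      using that x by (simp add: L.T.P_central)
  next
    fix b c assume "b \<in> carrier (sq_ee N)" "c \<in> carrier (sq_ee K)"
    then show "?g (sq_T N b) (sq_T K c) = inv\<^bsub>sq_e LL\<^esub> ?g b c"
      using L.P_pure_T[of "pure_ee M N (sq_cross M x x) b" "sq_T K c"] x by simp
  qed (use x in \<open>simp_all add: L.t_circ_left\<close>, blast?)
  then show ?thesis by (intro exI[of _ h]) (simp add: is_chi_def)
qed

definition "chi x = (SOME h. is_chi x h)"

lemma
  assumes "x \<in> carrier (sq_e M)"
  shows chi_hom: "chi x \<in> hom (sq_e (N \<diamond> K)) (sq_e LL)"
    and chi_circ [simp]: "\<lbrakk>y \<in> carrier (sq_e N); z \<in> carrier (sq_e K)\<rbrakk> \<Longrightarrow>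
      chi x (circ N K y z) = circ (M \<diamond> N) K (circ M N x y) z"
    and chi_pure: "\<lbrakk>b \<in> carrier (sq_ee N); c \<in> carrier (sq_ee K)\<rbrakk> \<Longrightarrow>
      chi x (sq_P (N \<diamond> K) (pure_ee N K b c)) =
      sq_P LL (pure_ee (M \<diamond> N) K (pure_ee M N (sq_cross M x x) b) c)"
  using someI_ex[OF ex_chi[OF assms], folded chi_def, unfolded is_chi_def] by blast+

lemma chi_closed [simp]:
  "\<lbrakk>x \<in> carrier (sq_e M); v \<in> carrier (sq_e (N \<diamond> K))\<rbrakk> \<Longrightarrow> chi x v \<in> carrier (sq_e LL)"
  using hom_in_carrier[OF chi_hom] .

lemma chi_mult [simp]:
  "\<lbrakk>x \<in> carrier (sq_e M); u \<in> carrier (sq_e (N \<diamond> K)); v \<in> carrier (sq_e (N \<diamond> K))\<rbrakk> \<Longrightarrow>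
    chi x (u \<otimes>\<^bsub>sq_e (N \<diamond> K)\<^esub> v) = chi x u \<otimes>\<^bsub>sq_e LL\<^esub> chi x v"
  using hom_mult[OF chi_hom] .

lemma chi_P [simp]:
  assumes "x \<in> carrier (sq_e M)" "w \<in> carrier (sq_ee (N \<diamond> K))"
  shows "chi x (sq_P (N \<diamond> K) w) = sq_P LL (assoc_ee_inv (sq_cross M x x) w)"
  using assms(2)
proof (induction rule: NK.t_induct)
  case (pure b c)
  then show ?case using assms(1) by (simp add: chi_pure)
next
  case (mult u v)
  then show ?case using assms(1) by simp
qed

lemma cross_chi [simp]:
  assumes x: "x \<in> carrier (sq_e M)" "x' \<in> carrier (sq_e M)"
    and v: "v \<in> carrier (sq_e (N \<diamond> K))" "v' \<in> carrier (sq_e (N \<diamond> K))"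
  shows "sq_cross LL (chi x v) (chi x' v') = assoc_ee_inv (sq_cross M x x') (sq_cross (N \<diamond> K) v v')"
proof (rule bihom_eq_on_generators[OF NK.T.e.is_group NK.T.e.is_group L.T.ee.is_group _ _
      NK.circ_gens NK.circ_gens _ v])
  show "bihom (sq_e (N \<diamond> K)) (sq_e (N \<diamond> K)) (sq_ee LL) (\<lambda>v v'. sq_cross LL (chi x v) (chi x' v'))"
    by (rule bihomI) (use x in simp_all)
  show "bihom (sq_e (N \<diamond> K)) (sq_e (N \<diamond> K)) (sq_ee LL) (\<lambda>v v'. assoc_ee_inv (sq_cross M x x') (sq_cross (N \<diamond> K) v v'))"
    by (rule bihomI) (use x in simp_all)
qed (use x in auto)

text \<open>Both sides are homomorphisms in \<open>v\<close>: on the right, the commutator from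
  exchanging \<open>chi x1 v\<close> and \<open>chi x2 u\<close> cancels the cross term of
  \<open>H (u + v)\<close>. It remains to compare \<open>circ\<close> elements and the image of
  \<open>P\<close>.\<close>

lemma chi_left:
  assumes x: "x1 \<in> carrier (sq_e M)" "x2 \<in> carrier (sq_e M)" and v: "v \<in> carrier (sq_e (N \<diamond> K))"
  shows "chi (x1 \<otimes>\<^bsub>sq_e M\<^esub> x2) v = chi x1 v \<otimes>\<^bsub>sq_e LL\<^esub> chi x2 v \<otimes>\<^bsub>sq_e LL\<^esub>
    sq_P LL (assoc_ee_inv (sq_cross M x2 x1) (sq_H (N \<diamond> K) v))"
proof (rule NK.T.e.generate_hom_eq[OF L.T.e.is_group chi_hom _ NK.circ_gens(1),
      of _ "\<lambda>v. chi x1 v \<otimes>\<^bsub>sq_e LL\<^esub> chi x2 v \<otimes>\<^bsub>sq_e LL\<^esub> sq_P LL (assoc_ee_inv (sq_cross M x2 x1) (sq_H (N \<diamond> K) v))"])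
  show "(\<lambda>v. chi x1 v \<otimes>\<^bsub>sq_e LL\<^esub> chi x2 v \<otimes>\<^bsub>sq_e LL\<^esub> sq_P LL (assoc_ee_inv (sq_cross M x2 x1) (sq_H (N \<diamond> K) v)))
      \<in> hom (sq_e (N \<diamond> K)) (sq_e LL)" (is "?F \<in> _")
  proof (rule homI)
    fix u v assume m: "u \<in> carrier (sq_e (N \<diamond> K))" "v \<in> carrier (sq_e (N \<diamond> K))"
    note m = m x
    let ?P = "\<lambda>w. sq_P LL (assoc_ee_inv (sq_cross M x2 x1) w)"
    \<comment> \<open>Applying \<open>T\<close> to both tensor factors swaps the arguments of both
      cross-effects and changes the sign under \<open>P\<close>.\<close>
    have "sq_P LL (assoc_ee_inv (sq_cross M x1 x2) (sq_cross (N \<diamond> K) v u)) =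
        inv\<^bsub>sq_e LL\<^esub> ?P (sq_cross (N \<diamond> K) u v)"
      using arg_cong[OF P_assoc_ee_inv_T[of "sq_cross (N \<diamond> K) v u" "sq_cross M x2 x1"], of "m_inv (sq_e LL)"] m
      by simp
    then have com: "chi x1 v \<otimes>\<^bsub>sq_e LL\<^esub> chi x2 u = chi x2 u \<otimes>\<^bsub>sq_e LL\<^esub> chi x1 v \<otimes>\<^bsub>sq_e LL\<^esub>
        inv\<^bsub>sq_e LL\<^esub> ?P (sq_cross (N \<diamond> K) u v)"
      using L.T.commutation[of "chi x1 v" "chi x2 u"] m by simp
    have "?F (u \<otimes>\<^bsub>sq_e (N \<diamond> K)\<^esub> v) = chi x1 u \<otimes>\<^bsub>sq_e LL\<^esub> (chi x1 v \<otimes>\<^bsub>sq_e LL\<^esub> chi x2 u) \<otimes>\<^bsub>sq_e LL\<^esub> chi x2 v \<otimes>\<^bsub>sq_e LL\<^esub>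
        (?P (sq_H (N \<diamond> K) u) \<otimes>\<^bsub>sq_e LL\<^esub> ?P (sq_H (N \<diamond> K) v) \<otimes>\<^bsub>sq_e LL\<^esub> ?P (sq_cross (N \<diamond> K) u v))"
      using m by (simp add: NK.T.H_mult L.T.e.m_assoc)
    also have "\<dots> = ?F u \<otimes>\<^bsub>sq_e LL\<^esub> ?F v"
      unfolding com using m
      by - (rule prep_eqI, (rule L.T.preps | (rule L.T.prep_P, simp; fail) | rule L.T.prep_at, simp; fail)+,
          simp_all add: algebra_simps)
    finally show "?F (u \<otimes>\<^bsub>sq_e (N \<diamond> K)\<^esub> v) = ?F u \<otimes>\<^bsub>sq_e LL\<^esub> ?F v" .
  qed (use x in simp)
  show "v \<in> generate (sq_e (N \<diamond> K)) ({circ N K y z |y z. y \<in> carrier (sq_e N) \<and> z \<in> carrier (sq_e K)} \<union>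
    sq_P (N \<diamond> K) ` carrier (sq_ee (N \<diamond> K)))"
    using v NK.circ_gens(2) by simp
  fix s assume "s \<in> {circ N K y z |y z. y \<in> carrier (sq_e N) \<and> z \<in> carrier (sq_e K)} \<union>
    sq_P (N \<diamond> K) ` carrier (sq_ee (N \<diamond> K))"
  then consider y z where "y \<in> carrier (sq_e N)" "z \<in> carrier (sq_e K)" "s = circ N K y z"
    | w where "w \<in> carrier (sq_ee (N \<diamond> K))" "s = sq_P (N \<diamond> K) w" by blast
  then show "chi (x1 \<otimes>\<^bsub>sq_e M\<^esub> x2) s = chi x1 s \<otimes>\<^bsub>sq_e LL\<^esub> chi x2 s \<otimes>\<^bsub>sq_e LL\<^esub>
    sq_P LL (assoc_ee_inv (sq_cross M x2 x1) (sq_H (N \<diamond> K) s))"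
  proof cases
    case 1
    then show ?thesis using x by (simp add: MN.t_circ_left L.t_circ_left L.T.e.m_assoc)
  next
    case 2
    \<comment> \<open>With \<open>H P w = T w + w\<close> the correction becomes the two mixed terms
      of \<open>(x1 + x2|x1 + x2)\<close> paired with \<open>w\<close>.\<close>
    have "sq_P LL (assoc_ee_inv (sq_cross M x2 x1) (sq_T (N \<diamond> K) w)) = sq_P LL (assoc_ee_inv (sq_cross M x1 x2) w)"
      using arg_cong[OF P_assoc_ee_inv_T[of w "sq_cross M x2 x1"], of "m_inv (sq_e LL)"] x 2(1) by simp
    then show ?thesis
      using x 2(1)
      by (simp add: 2(2) NK.T.H_P)
        (rule prep_eqI, (rule L.T.preps | (rule L.T.prep_P, simp; fail) | rule L.T.prep_at, simp; fail)+, simp_all add: algebra_simps)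
  qed
qed (use x in simp)

text \<open>Both sides are homomorphisms in \<open>v\<close>. On \<open>circ\<close> elements this
  is relation (5) used twice together with \<open>Delta_circ\<close>; on the image of
  \<open>P\<close> both sides vanish.\<close>

lemma P_chi:
  assumes a: "a \<in> carrier (sq_ee M)" and v: "v \<in> carrier (sq_e (N \<diamond> K))"
  shows "chi (sq_P M a) v = sq_P LL (assoc_ee_inv a (sq_Delta (N \<diamond> K) v))"
proof (rule NK.T.e.generate_hom_eq[OF L.T.e.is_group chi_hom _ NK.circ_gens(1),
      of _ "\<lambda>v. sq_P LL (assoc_ee_inv a (sq_Delta (N \<diamond> K) v))"])
  show "(\<lambda>v. sq_P LL (assoc_ee_inv a (sq_Delta (N \<diamond> K) v))) \<in> hom (sq_e (N \<diamond> K)) (sq_e LL)"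
    by (rule homI) (use a in simp_all)
  show "v \<in> generate (sq_e (N \<diamond> K)) ({circ N K y z |y z. y \<in> carrier (sq_e N) \<and> z \<in> carrier (sq_e K)} \<union>
    sq_P (N \<diamond> K) ` carrier (sq_ee (N \<diamond> K)))"
    using v NK.circ_gens(2) by simp
qed (use a in auto)

lemma ex_associator_inv:
  obtains t where "t \<in> sg_hom RR LL"
    "\<And>x v. \<lbrakk>x \<in> carrier (sq_e M); v \<in> carrier (sq_e (N \<diamond> K))\<rbrakk> \<Longrightarrow> map_e t (circ M (N \<diamond> K) x v) = chi x v"
    "\<And>a w. \<lbrakk>a \<in> carrier (sq_ee M); w \<in> carrier (sq_ee (N \<diamond> K))\<rbrakk> \<Longrightarrow> map_ee t (pure_ee M (N \<diamond> K) a w) = assoc_ee_inv a w"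
proof (rule R.tensor_morphism[OF L.square_group_tensor MN.M.gen_carrier(1) NK.gen_tensor(1) assoc_ee_inv_bihom, of chi])
  fix x v assume "v \<in> {circ N K y z |y z. y \<in> carrier (sq_e N) \<and> z \<in> carrier (sq_e K)}" "x \<in> carrier (sq_e M)"
  then obtain y z where m: "y \<in> carrier (sq_e N)" "z \<in> carrier (sq_e K)" "x \<in> carrier (sq_e M)"
    and v: "v = circ N K y z" by auto
  show "sq_H LL (chi x v) = assoc_ee_inv (sq_cross M x x) (sq_H (N \<diamond> K) v) \<otimes>\<^bsub>sq_ee LL\<^esub>
      assoc_ee_inv (sq_H M x) (sq_Delta (N \<diamond> K) v)"
    unfolding v using m by (simp add: L.T.ee.m_assoc)
qed (auto simp: T_assoc_ee_inv chi_left P_chi)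

lemma associator_iso: "associator M N K \<in> sg_iso LL RR"
proof -
  obtain t where t: "t \<in> sg_hom RR LL"
    "\<And>x v. \<lbrakk>x \<in> carrier (sq_e M); v \<in> carrier (sq_e (N \<diamond> K))\<rbrakk> \<Longrightarrow> map_e t (circ M (N \<diamond> K) x v) = chi x v"
    "\<And>a w. \<lbrakk>a \<in> carrier (sq_ee M); w \<in> carrier (sq_ee (N \<diamond> K))\<rbrakk> \<Longrightarrow> map_ee t (pure_ee M (N \<diamond> K) a w) = assoc_ee_inv a w"
    by (rule ex_associator_inv) blast
  show ?thesis
  proof (rule sg_isoI[OF associator_hom t(1)])
    show "t \<cdot> associator M N K = sg_id LL"
      by (rule associator_eqI[OF L.square_group_tensor
            sg_comp_hom[OF L.square_group_tensor associator_hom t(1)] sg_id_hom[OF L.square_group_tensor]])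
        (simp_all add: sg_comp_simps[OF associator_hom] t)
    show "associator M N K \<cdot> t = sg_id RR"
      by (rule R.arr_eqI_gen[OF R.square_group_tensor
            sg_comp_hom[OF R.square_group_tensor t(1) associator_hom] sg_id_hom[OF R.square_group_tensor]
            MN.M.gen_carrier(1) NK.gen_tensor(1) MN.M.gen_carrier(2) NK.gen_tensor(2)])
        (auto simp: sg_comp_simps[OF t(1)] t)
  qed
qed

end

lemma sq_tripleI:
  assumes "square_group M" "square_group N" "square_group K"
  shows "sq_triple M N K"
  using assms by (simp add: sq_triple_def sq_pairI sq_pair.square_group_tensor)

lemma sg_mor_tensor: "\<lbrakk>sg_mor M M' f; sg_mor N N' g\<rbrakk> \<Longrightarrow> sg_mor (M \<diamond> N) (M' \<diamond> N') (f \<diamond>\<^sub>m g)"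
proof -
  assume "sg_mor M M' f" "sg_mor N N' g"
  then interpret sg_mor_pair M M' f N N' g by (rule sg_mor_pairI)
  show ?thesis by (rule fg.sg_mor_axioms)
qed

lemma associator_natural:
  assumes f: "sg_mor M M' f" and g: "sg_mor N N' g" and h: "sg_mor K K' h"
  shows "associator M' N' K' \<cdot> ((f \<diamond>\<^sub>m g) \<diamond>\<^sub>m h) = (f \<diamond>\<^sub>m (g \<diamond>\<^sub>m h)) \<cdot> associator M N K"
proof -
  interpret f: sg_mor M M' f by fact
  interpret g: sg_mor N N' g by fact
  interpret h: sg_mor K K' h by fact
  interpret a: sq_triple M N K
    by (intro sq_tripleI f.M.square_group_axioms g.M.square_group_axioms h.M.square_group_axioms)
  interpret b: sq_triple M' N' K'
    by (intro sq_tripleI f.N.square_group_axioms g.N.square_group_axioms h.N.square_group_axioms)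
  interpret fg: sg_mor_pair M M' f N N' g by (intro sg_mor_pairI f g)
  interpret gh: sg_mor_pair N N' g K K' h by (intro sg_mor_pairI g h)
  interpret l: sg_mor_pair "M \<diamond> N" "M' \<diamond> N'" "f \<diamond>\<^sub>m g" K K' h by (intro sg_mor_pairI sg_mor_tensor f g h)
  interpret r: sg_mor_pair M M' f "N \<diamond> K" "N' \<diamond> K'" "g \<diamond>\<^sub>m h" by (intro sg_mor_pairI sg_mor_tensor f g h)
  show ?thesis
    by (rule a.associator_eqI[OF b.R.square_group_tensor
          sg_comp_hom[OF a.L.square_group_tensor l.tensor_arr_hom b.associator_hom]
          sg_comp_hom[OF a.L.square_group_tensor a.associator_hom r.tensor_arr_hom]])
      (simp_all add: sg_comp_simps[OF a.associator_hom] sg_comp_simps[OF l.tensor_arr_hom])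
qed

section \<open>Coherence\<close>

lemma square_group_tensorI: "\<lbrakk>square_group M; square_group N\<rbrakk> \<Longrightarrow> square_group (M \<diamond> N)"
  by (rule sq_pair.square_group_tensor) (rule sq_pairI)

lemma sq_unitI: "square_group M \<Longrightarrow> sq_unit M"
  by (simp add: sq_unit_def)

lemma left_unitor_natural:
  assumes "sg_mor M M' f"
  shows "left_unitor M' \<cdot> (sg_id Z_nil \<diamond>\<^sub>m f) = f \<cdot> left_unitor M"
proof -
  interpret f: sg_mor M M' f by fact
  interpret u: sq_unit M by (intro sq_unitI f.M.square_group_axioms)
  interpret u': sq_unit M' by (intro sq_unitI f.N.square_group_axioms)
  interpret t: sg_mor_pair Z_nil Z_nil "sg_id Z_nil" M M' f
    by (intro sg_mor_pairI sg_mor_id square_group_Z_nil assms)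
  show ?thesis
    by (rule u.ZM.arr_eqI[OF f.N.square_group_axioms gen_e_Z_nil f.M.gen_carrier(1)
          sg_comp_hom[OF u.ZM.square_group_tensor t.tensor_arr_hom u'.left_unitor_hom]
          sg_comp_hom[OF u.ZM.square_group_tensor u.left_unitor_hom f.f]])
      (simp_all add: sg_comp_simps[OF t.tensor_arr_hom] sg_comp_simps[OF u.left_unitor_hom] f.ee.hom_int_pow)
qed

lemma right_unitor_natural:
  assumes "sg_mor M M' f"
  shows "right_unitor M' \<cdot> (f \<diamond>\<^sub>m sg_id Z_nil) = f \<cdot> right_unitor M"
proof -
  interpret f: sg_mor M M' f by fact
  interpret u: sq_unit M by (intro sq_unitI f.M.square_group_axioms)
  interpret u': sq_unit M' by (intro sq_unitI f.N.square_group_axioms)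
  interpret t: sg_mor_pair M M' f Z_nil Z_nil "sg_id Z_nil"
    by (intro sg_mor_pairI sg_mor_id square_group_Z_nil assms)
  show ?thesis
    by (rule u.MZ.arr_eqI[OF f.N.square_group_axioms f.M.gen_carrier(1) gen_e_Z_nil
          sg_comp_hom[OF u.MZ.square_group_tensor t.tensor_arr_hom u'.right_unitor_hom]
          sg_comp_hom[OF u.MZ.square_group_tensor u.right_unitor_hom f.f]])
      (simp_all add: sg_comp_simps[OF t.tensor_arr_hom] sg_comp_simps[OF u.right_unitor_hom] f.ee.hom_int_pow)
qed

text \<open>At the generator 1 the correction term of the braiding disappears because
  \<open>H(1) = 0\<close>.\<close>

lemma unitor_braiding:
  assumes "square_group M"
  shows "left_unitor M \<cdot> braiding M Z_nil = right_unitor M"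
proof -
  interpret u: sq_unit M by (intro sq_unitI assms)
  interpret b: sq_swap M Z_nil by (intro sq_swapI assms square_group_Z_nil)
  show ?thesis
    by (rule u.MZ.arr_eqI[OF assms u.gen_carrier(1) gen_e_Z_nil
          sg_comp_hom[OF u.MZ.square_group_tensor b.braiding_hom u.left_unitor_hom] u.right_unitor_hom])
      (simp_all add: sg_comp_simps[OF b.braiding_hom])
qed

lemma (in sq_pair) pure_pow:
  assumes "a \<in> carrier (sq_ee M)" "b \<in> carrier (sq_ee N)"
  shows "pure_ee M N (a [^]\<^bsub>sq_ee M\<^esub> (n::int)) b = pure_ee M N a (b [^]\<^bsub>sq_ee N\<^esub> n)"
proof -
  have r: "pure_ee M N a \<in> hom (sq_ee N) (sq_ee (M \<diamond> N))"
    and l: "(\<lambda>a. pure_ee M N a b) \<in> hom (sq_ee M) (sq_ee (M \<diamond> N))"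
    using assms bihom_hom_left[OF t_pure_bihom] bihom_hom_right[OF t_pure_bihom] by simp_all
  show ?thesis
    using hom_int_pow[OF l assms(1) M.ee.is_group T.ee.is_group, of n]
      hom_int_pow[OF r assms(2) N.ee.is_group T.ee.is_group, of n] by simp
qed

lemma triangle:
  assumes M: "square_group M" and N: "square_group N"
  shows "(sg_id M \<diamond>\<^sub>m left_unitor N) \<cdot> associator M Z_nil N = right_unitor M \<diamond>\<^sub>m sg_id N"
proof -
  interpret MN: sq_pair M N by (intro sq_pairI assms)
  interpret uM: sq_unit M by (intro sq_unitI assms)
  interpret uN: sq_unit N by (intro sq_unitI assms)
  interpret a: sq_triple M Z_nil N by (intro sq_tripleI assms square_group_Z_nil)
  interpret l: sg_mor_pair M M "sg_id M" "Z_nil \<diamond> N" N "left_unitor N"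
    by (intro sg_mor_pairI sg_mor_id M uN.lu.sg_mor_axioms)
  interpret r: sg_mor_pair "M \<diamond> Z_nil" M "right_unitor M" N N "sg_id N"
    by (intro sg_mor_pairI sg_mor_id N uM.ru.sg_mor_axioms)
  \<comment> \<open>Only the integer 1 has to occur in the middle, where both unit isomorphisms have
    no correction.\<close>
  have x1: "gen_e (M \<diamond> Z_nil) {circ M Z_nil x n |x n. x \<in> carrier (sq_e M) \<and> n \<in> {1}}"
    by (rule uM.MZ.gen_e_tensor[OF square_group.gen_carrier(1)[OF M] gen_e_Z_nil])
  show ?thesis
    by (rule a.L.arr_eqI_gen[OF square_group_tensorI[OF M N]
          sg_comp_hom[OF a.L.square_group_tensor a.associator_hom l.tensor_arr_hom] r.tensor_arr_hom
          x1 square_group.gen_carrier(1)[OF N] uM.MZ.gen_tensor(2) square_group.gen_carrier(2)[OF N]])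
      (auto simp: sg_comp_simps[OF a.associator_hom] MN.pure_pow)
qed

text \<open>It suffices to look at fully left-bracketed \<open>circ\<close> elements and pure
  tensors; on these all five arrows merely move brackets.\<close>

lemma pentagon:
  assumes M: "square_group M" and N: "square_group N" and K: "square_group K" and L: "square_group L"
  shows "associator M N (K \<diamond> L) \<cdot> associator (M \<diamond> N) K L =
    (sg_id M \<diamond>\<^sub>m associator N K L) \<cdot> associator M (N \<diamond> K) L \<cdot> (associator M N K \<diamond>\<^sub>m sg_id L)"
proof -
  interpret MN: sq_pair M N by (intro sq_pairI assms)
  interpret NK: sq_pair N K by (intro sq_pairI assms)
  interpret KL: sq_pair K L by (intro sq_pairI assms)
  interpret MNK: sq_triple M N K by (intro sq_tripleI assms)
  interpret NKL: sq_triple N K L by (intro sq_tripleI assms)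
  interpret a1: sq_triple "M \<diamond> N" K L by (intro sq_tripleI MN.square_group_tensor assms)
  interpret a2: sq_triple M N "K \<diamond> L" by (intro sq_tripleI KL.square_group_tensor assms)
  interpret a3: sq_triple M "N \<diamond> K" L by (intro sq_tripleI NK.square_group_tensor assms)
  interpret l: sg_mor_pair M M "sg_id M" "(N \<diamond> K) \<diamond> L" "N \<diamond> (K \<diamond> L)" "associator N K L"
    by (intro sg_mor_pairI sg_mor_id M NKL.as.sg_mor_axioms)
  interpret r: sg_mor_pair "(M \<diamond> N) \<diamond> K" "M \<diamond> (N \<diamond> K)" "associator M N K" L L "sg_id L"
    by (intro sg_mor_pairI sg_mor_id L MNK.as.sg_mor_axioms)
  have dom: "square_group (((M \<diamond> N) \<diamond> K) \<diamond> L)" and cod: "square_group (M \<diamond> (N \<diamond> (K \<diamond> L)))"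
    by (intro square_group_tensorI assms)+
  note ar = sg_comp_hom[OF dom r.tensor_arr_hom a3.associator_hom]
  show ?thesis
    by (rule a1.L.arr_eqI_gen[OF cod
          sg_comp_hom[OF dom a1.associator_hom a2.associator_hom]
          sg_comp_hom[OF dom ar l.tensor_arr_hom]
          MNK.L.gen_e_tensor[OF MN.gen_tensor(1) square_group.gen_carrier(1)[OF K]] square_group.gen_carrier(1)[OF L]
          MNK.L.gen_ee_tensor[OF MN.gen_tensor(2) square_group.gen_carrier(2)[OF K]] square_group.gen_carrier(2)[OF L]])
      (auto simp: sg_comp_simps[OF a1.associator_hom] sg_comp_simps[OF ar]
        sg_comp_simps[OF r.tensor_arr_hom])
qed

text \<open>Both composites send \<open>(x \<circ> y) \<circ> z\<close> to
  \<open>y \<circ> (z \<circ> x)\<close> minus \<open>P\<close> of \<open>(y|y) \<otimes> (H(z)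
  \<otimes> T H(x)) + H(y) \<otimes> (\<Delta>(z) \<otimes> T H(x))\<close>. On the left both terms
  come from \<open>H (y \<circ> z)\<close>; on the right they come from the two separate braidings
  through relations (4) and (5).\<close>

lemma hexagon:
  assumes M: "square_group M" and N: "square_group N" and K: "square_group K"
  shows "associator N K M \<cdot> braiding M (N \<diamond> K) \<cdot> associator M N K =
    (sg_id N \<diamond>\<^sub>m braiding M K) \<cdot> associator N M K \<cdot> (braiding M N \<diamond>\<^sub>m sg_id K)"
proof -
  interpret MN: sq_swap M N by (intro sq_swapI assms)
  interpret MK: sq_swap M K by (intro sq_swapI assms)
  interpret NK: sq_pair N K by (intro sq_pairI assms)
  interpret M_NK: sq_swap M "N \<diamond> K" by (intro sq_swapI NK.square_group_tensor assms)
  interpret MNK: sq_triple M N K by (intro sq_tripleI assms)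
  interpret NKM: sq_triple N K M by (intro sq_tripleI assms)
  interpret NMK: sq_triple N M K by (intro sq_tripleI assms)
  interpret l: sg_mor_pair N N "sg_id N" "M \<diamond> K" "K \<diamond> M" "braiding M K"
    by (intro sg_mor_pairI sg_mor_id N MK.br.sg_mor_axioms)
  interpret r: sg_mor_pair "M \<diamond> N" "N \<diamond> M" "braiding M N" K K "sg_id K"
    by (intro sg_mor_pairI sg_mor_id K MN.br.sg_mor_axioms)
  have dom: "square_group ((M \<diamond> N) \<diamond> K)" and cod: "square_group (N \<diamond> (K \<diamond> M))"
    by (intro square_group_tensorI assms)+
  note h1 = sg_comp_hom[OF dom MNK.associator_hom M_NK.braiding_hom]
  note h2 = sg_comp_hom[OF dom r.tensor_arr_hom NMK.associator_hom]
  note comps = sg_comp_simps[OF MNK.associator_hom] sg_comp_simps[OF h1]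
    sg_comp_simps[OF r.tensor_arr_hom] sg_comp_simps[OF h2]
  show ?thesis
  proof (rule MNK.associator_eqI[OF cod
        sg_comp_hom[OF dom h1 NKM.associator_hom] sg_comp_hom[OF dom h2 l.tensor_arr_hom]])
    fix x y z assume m: "x \<in> carrier (sq_e M)" "y \<in> carrier (sq_e N)" "z \<in> carrier (sq_e K)"
    then show "map_e (associator N K M \<cdot> braiding M (N \<diamond> K) \<cdot> associator M N K)
        (circ (M \<diamond> N) K (circ M N x y) z) =
      map_e ((sg_id N \<diamond>\<^sub>m braiding M K) \<cdot> associator N M K \<cdot> (braiding M N \<diamond>\<^sub>m sg_id K))
        (circ (M \<diamond> N) K (circ M N x y) z)"
      by (simp add: comps NMK.L.t_circ_left NKM.R.T.e.inv_mult_group flip: MN.NM.T.P_inv MK.NM.T.P_inv)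
        (rule prep_eqI, (rule NKM.R.T.preps | (rule NKM.R.T.prep_P, simp; fail) | rule NKM.R.T.prep_at, simp; fail)+, simp_all add: algebra_simps)
  qed (simp add: comps)
qed

theorem theorem3:
  fixes M :: "('m, 'mm) sq_grp" and M' :: "('m1, 'mm1) sq_grp" and M'' :: "('m2, 'mm2) sq_grp"
    and N :: "('n, 'nn) sq_grp" and N' :: "('n1, 'nn1) sq_grp" and N'' :: "('n2, 'nn2) sq_grp"
    and K :: "('k, 'kk) sq_grp" and K' :: "('k1, 'kk1) sq_grp"
    and L :: "('l, 'll) sq_grp"
  assumes "square_group M" "square_group M'" "square_group M''"
    and "square_group N" "square_group N'" "square_group N''"
    and "square_group K" "square_group K'" "square_group L"
  shows
    \<comment> \<open>the tensor product is a well-defined bifunctor on square groups\<close>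
    "(\<exists>!p. is_tensor_P M N p) \<and> (\<exists>!h. is_tensor_H M N h) \<and> square_group (M \<diamond> N) \<and>
     (\<forall>f \<in> sg_hom M M'. \<forall>g \<in> sg_hom N N'.
        (\<exists>!t. is_tensor_arr f g t) \<and> f \<diamond>\<^sub>m g \<in> sg_hom (M \<diamond> N) (M' \<diamond> N')) \<and>
     sg_id M \<diamond>\<^sub>m sg_id N = sg_id (M \<diamond> N) \<and>
     (\<forall>f \<in> sg_hom M M'. \<forall>f' \<in> sg_hom M' M''. \<forall>g \<in> sg_hom N N'. \<forall>g' \<in> sg_hom N' N''.
        (f' \<cdot> f) \<diamond>\<^sub>m (g' \<cdot> g) = (f' \<diamond>\<^sub>m g') \<cdot> (f \<diamond>\<^sub>m g)) \<and>

     \<comment> \<open>the unit object and the unit isomorphisms\<close>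
     square_group Z_nil \<and>
     (\<exists>!l. is_left_unitor M l) \<and> left_unitor M \<in> sg_iso (Z_nil \<diamond> M) M \<and>
     (\<exists>!r. is_right_unitor M r) \<and> right_unitor M \<in> sg_iso (M \<diamond> Z_nil) M \<and>
     (\<forall>f \<in> sg_hom M M'.
        left_unitor M' \<cdot> (sg_id Z_nil \<diamond>\<^sub>m f) = f \<cdot> left_unitor M \<and>
        right_unitor M' \<cdot> (f \<diamond>\<^sub>m sg_id Z_nil) = f \<cdot> right_unitor M) \<and>

     \<comment> \<open>the associativity isomorphism\<close>
     (\<exists>!\<alpha>. is_associator M N K \<alpha>) \<and>
     associator M N K \<in> sg_iso ((M \<diamond> N) \<diamond> K) (M \<diamond> (N \<diamond> K)) \<and>
     (\<forall>a \<in> carrier (sq_ee M). \<forall>b \<in> carrier (sq_ee N). \<forall>c \<in> carrier (sq_ee K).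
        map_ee (associator M N K) (pure_ee (M \<diamond> N) K (pure_ee M N a b) c) =
          pure_ee M (N \<diamond> K) a (pure_ee N K b c)) \<and>
     (\<forall>x \<in> carrier (sq_e M). \<forall>y \<in> carrier (sq_e N). \<forall>z \<in> carrier (sq_e K).
        map_e (associator M N K) (circ (M \<diamond> N) K (circ M N x y) z) =
          circ M (N \<diamond> K) x (circ N K y z)) \<and>
     (\<forall>a \<in> carrier (sq_ee M). \<forall>b \<in> carrier (sq_ee N). \<forall>z \<in> carrier (sq_e K).
        map_e (associator M N K) (circ (M \<diamond> N) K (bar M N a b) z) =
          bar M (N \<diamond> K) a (pure_ee N K b (sq_Delta K z))) \<and>
     (\<forall>a \<in> carrier (sq_ee M). \<forall>b \<in> carrier (sq_ee N). \<forall>c \<in> carrier (sq_ee K).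
        map_e (associator M N K) (bar (M \<diamond> N) K (pure_ee M N a b) c) =
          bar M (N \<diamond> K) a (pure_ee N K b c)) \<and>
     (\<forall>f \<in> sg_hom M M'. \<forall>g \<in> sg_hom N N'. \<forall>h \<in> sg_hom K K'.
        associator M' N' K' \<cdot> ((f \<diamond>\<^sub>m g) \<diamond>\<^sub>m h) =
          (f \<diamond>\<^sub>m (g \<diamond>\<^sub>m h)) \<cdot> associator M N K) \<and>

     \<comment> \<open>the commutativity isomorphism\<close>
     (\<exists>!\<beta>. is_braiding M N \<beta>) \<and>
     braiding M N \<in> sg_iso (M \<diamond> N) (N \<diamond> M) \<and>
     (\<forall>a \<in> carrier (sq_ee M). \<forall>b \<in> carrier (sq_ee N).
        map_ee (braiding M N) (pure_ee M N a b) = pure_ee N M b a) \<and>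
     (\<forall>x \<in> carrier (sq_e M). \<forall>y \<in> carrier (sq_e N).
        map_e (braiding M N) (circ M N x y) =
          circ N M y x \<otimes>\<^bsub>sq_e (N \<diamond> M)\<^esub>
            inv\<^bsub>sq_e (N \<diamond> M)\<^esub> bar N M (sq_H N y) (sq_T M (sq_H M x))) \<and>
     (\<forall>a \<in> carrier (sq_ee M). \<forall>b \<in> carrier (sq_ee N).
        map_e (braiding M N) (bar M N a b) = bar N M b a) \<and>
     (\<forall>f \<in> sg_hom M M'. \<forall>g \<in> sg_hom N N'.
        braiding M' N' \<cdot> (f \<diamond>\<^sub>m g) = (g \<diamond>\<^sub>m f) \<cdot> braiding M N) \<and>

     \<comment> \<open>coherence: pentagon, triangle, hexagon, symmetry, unit\<close>
     associator M N (K \<diamond> L) \<cdot> associator (M \<diamond> N) K L =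
       (sg_id M \<diamond>\<^sub>m associator N K L) \<cdot> associator M (N \<diamond> K) L
         \<cdot> (associator M N K \<diamond>\<^sub>m sg_id L) \<and>
     (sg_id M \<diamond>\<^sub>m left_unitor N) \<cdot> associator M Z_nil N = right_unitor M \<diamond>\<^sub>m sg_id N \<and>
     associator N K M \<cdot> braiding M (N \<diamond> K) \<cdot> associator M N K =
       (sg_id N \<diamond>\<^sub>m braiding M K) \<cdot> associator N M K \<cdot> (braiding M N \<diamond>\<^sub>m sg_id K) \<and>
     braiding N M \<cdot> braiding M N = sg_id (M \<diamond> N) \<and>
     left_unitor M \<cdot> braiding M Z_nil = right_unitor M \<and>

     \<comment> \<open>the element \<open>x\<close> paired with \<open>P (b \<otimes> c)\<close> under associativity\<close>
     (\<forall>x \<in> carrier (sq_e M). \<forall>b \<in> carrier (sq_ee N). \<forall>c \<in> carrier (sq_ee K).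
        circ M (N \<diamond> K) x (bar N K b c) =
          bar M (N \<diamond> K) (sq_cross M x x) (pure_ee N K b c) \<and>
        map_e (associator M N K)
            (bar (M \<diamond> N) K (pure_ee M N (sq_cross M x x) b) c) =
          circ M (N \<diamond> K) x (bar N K b c))"
proof -
  note sg = assms
  interpret MN: sq_swap M N by (intro sq_swapI sg)
  interpret a: sq_triple M N K by (intro sq_tripleI sg)
  interpret u: sq_unit M by (intro sq_unitI sg)
  have f: "f \<in> sg_hom M M' \<Longrightarrow> sg_mor M M' f" and f': "f' \<in> sg_hom M' M'' \<Longrightarrow> sg_mor M' M'' f'" for f f'
    by (intro sg_morI sg; assumption)+
  have g: "g \<in> sg_hom N N' \<Longrightarrow> sg_mor N N' g" and g': "g' \<in> sg_hom N' N'' \<Longrightarrow> sg_mor N' N'' g'" for g g'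
    by (intro sg_morI sg; assumption)+
  have h: "h \<in> sg_hom K K' \<Longrightarrow> sg_mor K K' h" for h
    by (intro sg_morI sg; assumption)
  show ?thesis
  proof (intro conjI ballI)
    show "\<exists>!p. is_tensor_P M N p" by (rule MN.MN.ex1_tensor_P)
    show "\<exists>!h. is_tensor_H M N h" by (rule MN.MN.ex1_tensor_H)
    show "square_group (M \<diamond> N)" by (intro square_group_tensorI sg)
    show "sg_id M \<diamond>\<^sub>m sg_id N = sg_id (M \<diamond> N)" by (intro tensor_arr_id sg)
    show "square_group Z_nil" by (rule square_group_Z_nil)
    show "\<exists>!l. is_left_unitor M l" "\<exists>!r. is_right_unitor M r"
      by (rule u.ex1_left_unitor u.ex1_right_unitor)+
    show "left_unitor M \<in> sg_iso (Z_nil \<diamond> M) M" "right_unitor M \<in> sg_iso (M \<diamond> Z_nil) M"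
      by (rule u.left_unitor_iso u.right_unitor_iso)+
    show "\<exists>!\<alpha>. is_associator M N K \<alpha>" by (rule a.ex1_associator)
    show "associator M N K \<in> sg_iso ((M \<diamond> N) \<diamond> K) (M \<diamond> (N \<diamond> K))" by (rule a.associator_iso)
    show "\<exists>!\<beta>. is_braiding M N \<beta>" by (rule MN.ex1_braiding)
    show "braiding M N \<in> sg_iso (M \<diamond> N) (N \<diamond> M)" by (intro braiding_iso sg)
    show "associator M N (K \<diamond> L) \<cdot> associator (M \<diamond> N) K L =
       (sg_id M \<diamond>\<^sub>m associator N K L) \<cdot> associator M (N \<diamond> K) L
         \<cdot> (associator M N K \<diamond>\<^sub>m sg_id L)" by (intro pentagon sg)
    show "(sg_id M \<diamond>\<^sub>m left_unitor N) \<cdot> associator M Z_nil N = right_unitor M \<diamond>\<^sub>m sg_id N"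
      by (intro triangle sg)
    show "associator N K M \<cdot> braiding M (N \<diamond> K) \<cdot> associator M N K =
       (sg_id N \<diamond>\<^sub>m braiding M K) \<cdot> associator N M K \<cdot> (braiding M N \<diamond>\<^sub>m sg_id K)"
      by (intro hexagon sg)
    show "braiding N M \<cdot> braiding M N = sg_id (M \<diamond> N)" by (intro braiding_braiding sg)
    show "left_unitor M \<cdot> braiding M Z_nil = right_unitor M" by (intro unitor_braiding sg)
  next
    fix f g assume "f \<in> sg_hom M M'" "g \<in> sg_hom N N'"
    then interpret fg: sg_mor_pair M M' f N N' g by (intro sg_mor_pairI f g)
    show "\<exists>!t. is_tensor_arr f g t" by (rule fg.ex1_tensor_arr)
    show "f \<diamond>\<^sub>m g \<in> sg_hom (M \<diamond> N) (M' \<diamond> N')" by (rule fg.tensor_arr_hom)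
    show "braiding M' N' \<cdot> (f \<diamond>\<^sub>m g) = (g \<diamond>\<^sub>m f) \<cdot> braiding M N"
      by (rule braiding_natural[OF fg.F.sg_mor_axioms fg.G.sg_mor_axioms])
  next
    fix f f' g g'
    assume m: "f \<in> sg_hom M M'" "f' \<in> sg_hom M' M''" "g \<in> sg_hom N N'" "g' \<in> sg_hom N' N''"
    show "(f' \<cdot> f) \<diamond>\<^sub>m (g' \<cdot> g) = (f' \<diamond>\<^sub>m g') \<cdot> (f \<diamond>\<^sub>m g)"
      by (rule tensor_arr_comp[OF f[OF m(1)] f'[OF m(2)] g[OF m(3)] g'[OF m(4)]])
  next
    fix f assume m: "f \<in> sg_hom M M'"
    show "left_unitor M' \<cdot> (sg_id Z_nil \<diamond>\<^sub>m f) = f \<cdot> left_unitor M"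
      "right_unitor M' \<cdot> (f \<diamond>\<^sub>m sg_id Z_nil) = f \<cdot> right_unitor M"
      by (rule left_unitor_natural[OF f[OF m]] right_unitor_natural[OF f[OF m]])+
  next
    fix f g h assume m: "f \<in> sg_hom M M'" "g \<in> sg_hom N N'" "h \<in> sg_hom K K'"
    show "associator M' N' K' \<cdot> ((f \<diamond>\<^sub>m g) \<diamond>\<^sub>m h) = (f \<diamond>\<^sub>m (g \<diamond>\<^sub>m h)) \<cdot> associator M N K"
      by (rule associator_natural[OF f[OF m(1)] g[OF m(2)] h[OF m(3)]])
  \<comment> \<open>What is left are values on generators. After \<open>bar_P\<close>, those on
    \<open>bar\<close> reduce to the ee-level by compatibility with \<open>P\<close>, and the final
    clause is relation (4) in \<open>M \<diamond> (N \<diamond> K)\<close>.\<close>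
  qed simp_all
qed

end
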